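(* Let $(G_1,G_2)$ be a matched pair of locally compact groups with $G_1$ abelian, let $\mathbb{G}=(M,\Delta_M)$ be the von Neumann algebraic version of the associated bicrossed product quantum group, and let $\gamma\colon L(G_1)\to L(G_1)\otimes M$ be the von Neumann algebraic action of $\mathbb{G}$ on $L(G_1)$ given by $\gamma(x)=\Delta_M(x\otimes1)$ (regarding $L(G_1)\otimes M\subset M\otimes M$ via $x\mapsto x\otimes 1$ on the first factor). Then $\gamma$ is ergodic, i.e. $\{x\in L(G_1):\gamma(x)=x\otimes1_M\}=\mathbb{C}\cdot1$.
   Context: All Hilbert spaces are separable; $\otimes$ of von Neumann algebras is the von Neumann tensor product. Matched pair: $G_1,G_2,G$ are locally compact groups with fixed left Haar measures, there are a homomorphism $i\colon G_1\hookrightarrow G$ and an anti-homomorphism $j\colon G_2\hookrightarrow G$, with closed images and homeomorphisms onto these images, such that $(g,h)\mapsto i(g)j(h)$ is a homeomorphism of $G_1\times G_2$ onto an open subset $\Omega$ of $G$ with complement of measure zero. Then there are almost everywhere defined measurable maps $(g,h)\mapsto\alpha_g(h)\in G_2$ and $(g,h)\mapsto\beta_h(g)\in G_1$ with $j(\alpha_g(h))\,i(\beta_h(g))=i(g)j(h)$ for almost all $g\in G_1$, $h\in G_2$. Bicrossed product: $\mathbb{W}$ is the unitary on $L^2(G_1\times G_2\times G_1\times G_2)$ given by $\mathbb{W}\xi(g,s,h,t)=\xi(\beta_{\alpha_g(s)^{-1}t}(h)g,\,s,\,h,\,\alpha_g(s)^{-1}t)$. $M\subset\mathbb{B}(L^2(G_1\times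 G_2))$ is the von Neumann algebra generated by $\alpha(L^\infty(G_2))$ and $L(G_1)\otimes1$, where $\alpha(f)(g,s)=f(\alpha_g(s))$ and $L(G_1)$ is the group von Neumann algebra of $G_1$, generated by the operators $\lambda_g\xi'(h)=\xi'(hg)$ on $L^2(G_1)$; $\Delta_M(z)=\mathbb{W}^*(1\otimes z)\mathbb{W}$. A (right) von Neumann algebraic action of $(M,\Delta_M)$ on a von Neumann algebra $N$ is a faithful normal unital $*$-homomorphism $\gamma\colon N\to N\otimes M$ with $(\mathrm{id}_N\otimes\Delta_M)\gamma=(\gamma\otimes\mathrm{id}_M)\gamma$; it is ergodic if $\{x\in N:\gamma(x)=x\otimes1_M\}=\mathbb{C}\cdot1_N$. *)

theory Defs
  imports "HOL-Analysis.Analysis"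
begin

section \<open>Locally compact groups and matched pairs\<close>

text \<open>
  Groups are written additively because the library's type class of (not necessarily
  commutative) topological groups is additive: \<open>g + h\<close> is the product, \<open>- g\<close> the inverse and
  \<open>0\<close> the neutral element; the class does not include commutativity.
  Second countability expresses that the Hilbert space of square integrable functions is
  separable.
\<close>

class locally_compact_group = topological_group_add + t2_space + second_countable_topology +
  assumes compact_neighbourhood: "\<exists>U K. open U \<and> compact K \<and> x \<in> U \<and> U \<subseteq> K"

text \<open>Regularity need not be demanded: on a second countable locally compact Hausdorff space
  every Borel measure that is finite on compact sets is regular.\<close>

definition left_haar_measure :: "'a::locally_compact_group measure \<Rightarrow> bool" where
  "left_haar_measure \<mu> \<longleftrightarrow>
     sets \<mu> = sets borel \<and>
     (\<forall>K. compact K \<longrightarrow> emeasure \<mu> K < \<infinity>) \<and>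
     emeasure \<mu> UNIV \<noteq> 0 \<and>
     (\<forall>g. distr \<mu> borel (\<lambda>x. g + x) = \<mu>)"

definition matched_pair ::
  "'a::locally_compact_group measure \<Rightarrow> 'b::locally_compact_group measure \<Rightarrow>
   'c::locally_compact_group measure \<Rightarrow> ('a \<Rightarrow> 'c) \<Rightarrow> ('b \<Rightarrow> 'c) \<Rightarrow> bool" where
  "matched_pair \<mu>\<^sub>1 \<mu>\<^sub>2 \<mu> i j \<longleftrightarrow>
     left_haar_measure \<mu>\<^sub>1 \<and> left_haar_measure \<mu>\<^sub>2 \<and> left_haar_measure \<mu> \<and>
     (\<forall>x y. i (x + y) = i x + i y) \<and>
     (\<forall>x y. j (x + y) = j y + j x) \<and>
     closed (range i) \<and> (\<exists>i'. homeomorphism UNIV (range i) i i') \<and>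
     closed (range j) \<and> (\<exists>j'. homeomorphism UNIV (range j) j j') \<and>
     (let \<theta> = (\<lambda>(g, h). i g + j h); \<Omega> = range \<theta>
      in open \<Omega> \<and> (\<exists>\<theta>'. homeomorphism UNIV \<Omega> \<theta> \<theta>') \<and> emeasure \<mu> (- \<Omega>) = 0)"

text \<open>The almost everywhere defined maps are represented by total measurable functions, whose
  values off a null set are arbitrary; \<open>\<alpha> g h\<close> and \<open>\<beta> h g\<close> stand for \<open>\<alpha>\<^sub>g(h)\<close> and \<open>\<beta>\<^sub>h(g)\<close>.\<close>

definition matched_pair_maps ::
  "'a::locally_compact_group measure \<Rightarrow> 'b::locally_compact_group measure \<Rightarrow>
   ('a \<Rightarrow> 'c::locally_compact_group) \<Rightarrow> ('b \<Rightarrow> 'c) \<Rightarrow>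
   ('a \<Rightarrow> 'b \<Rightarrow> 'b) \<Rightarrow> ('b \<Rightarrow> 'a \<Rightarrow> 'a) \<Rightarrow> bool" where
  "matched_pair_maps \<mu>\<^sub>1 \<mu>\<^sub>2 i j \<alpha> \<beta> \<longleftrightarrow>
     (\<lambda>(g, h). \<alpha> g h) \<in> borel_measurable (\<mu>\<^sub>1 \<Otimes>\<^sub>M \<mu>\<^sub>2) \<and>
     (\<lambda>(g, h). \<beta> h g) \<in> borel_measurable (\<mu>\<^sub>1 \<Otimes>\<^sub>M \<mu>\<^sub>2) \<and>
     (AE (g, h) in \<mu>\<^sub>1 \<Otimes>\<^sub>M \<mu>\<^sub>2. j (\<alpha> g h) + i (\<beta> h g) = i g + j h)"


section \<open>The Hilbert space of square integrable functions\<close>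

text \<open>Vectors are classes of square integrable functions modulo equality almost everywhere.\<close>

type_synonym 'a l2_vec = "('a \<Rightarrow> complex) set"
type_synonym 'a l2_op = "'a l2_vec \<Rightarrow> 'a l2_vec"

definition l2_funs :: "'a measure \<Rightarrow> ('a \<Rightarrow> complex) set" where
  "l2_funs \<mu> = {f \<in> borel_measurable \<mu>. integrable \<mu> (\<lambda>x. (cmod (f x))\<^sup>2)}"

definition l2_class :: "'a measure \<Rightarrow> ('a \<Rightarrow> complex) \<Rightarrow> 'a l2_vec" where
  "l2_class \<mu> f = {f' \<in> l2_funs \<mu>. AE x in \<mu>. f' x = f x}"

definition L2 :: "'a measure \<Rightarrow> 'a l2_vec set" where
  "L2 \<mu> = l2_class \<mu> ` l2_funs \<mu>"

definition l2_rep :: "'a l2_vec \<Rightarrow> 'a \<Rightarrow> complex" where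
  "l2_rep u = (SOME f. f \<in> u)"

definition l2_add :: "'a measure \<Rightarrow> 'a l2_vec \<Rightarrow> 'a l2_vec \<Rightarrow> 'a l2_vec" where
  "l2_add \<mu> u v = l2_class \<mu> (\<lambda>x. l2_rep u x + l2_rep v x)"

definition l2_scale :: "'a measure \<Rightarrow> complex \<Rightarrow> 'a l2_vec \<Rightarrow> 'a l2_vec" where
  "l2_scale \<mu> c u = l2_class \<mu> (\<lambda>x. c * l2_rep u x)"

definition l2_inner :: "'a measure \<Rightarrow> 'a l2_vec \<Rightarrow> 'a l2_vec \<Rightarrow> complex" where
  "l2_inner \<mu> u v = (\<integral>x. cnj (l2_rep u x) * l2_rep v x \<partial>\<mu>)"

definition l2_norm :: "'a measure \<Rightarrow> 'a l2_vec \<Rightarrow> real" where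
  "l2_norm \<mu> u = sqrt (Re (l2_inner \<mu> u u))"

definition l2_tensor :: "'a measure \<Rightarrow> 'b measure \<Rightarrow> 'a l2_vec \<Rightarrow> 'b l2_vec \<Rightarrow> ('a \<times> 'b) l2_vec" where
  "l2_tensor \<mu> \<nu> u v = l2_class (\<mu> \<Otimes>\<^sub>M \<nu>) (\<lambda>(x, y). l2_rep u x * l2_rep v y)"


section \<open>Bounded operators\<close>

text \<open>Operators are extensional (\<open>undefined\<close> off the Hilbert space), so that HOL equality of
  operators is equality on the Hilbert space.\<close>

definition bounded_ops :: "'a measure \<Rightarrow> 'a l2_op set" where
  "bounded_ops \<mu> = {T \<in> L2 \<mu> \<rightarrow>\<^sub>E L2 \<mu>.
     (\<forall>u\<in>L2 \<mu>. \<forall>v\<in>L2 \<mu>. T (l2_add \<mu> u v) = l2_add \<mu> (T u) (T v)) \<and>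
     (\<forall>c. \<forall>u\<in>L2 \<mu>. T (l2_scale \<mu> c u) = l2_scale \<mu> c (T u)) \<and>
     (\<exists>C. \<forall>u\<in>L2 \<mu>. l2_norm \<mu> (T u) \<le> C * l2_norm \<mu> u)}"

definition op_id :: "'a measure \<Rightarrow> 'a l2_op" where
  "op_id \<mu> = (\<lambda>u\<in>L2 \<mu>. u)"

definition op_add :: "'a measure \<Rightarrow> 'a l2_op \<Rightarrow> 'a l2_op \<Rightarrow> 'a l2_op" where
  "op_add \<mu> S T = (\<lambda>u\<in>L2 \<mu>. l2_add \<mu> (S u) (T u))"

definition op_scale :: "'a measure \<Rightarrow> complex \<Rightarrow> 'a l2_op \<Rightarrow> 'a l2_op" where
  "op_scale \<mu> c T = (\<lambda>u\<in>L2 \<mu>. l2_scale \<mu> c (T u))"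

definition op_mult :: "'a measure \<Rightarrow> 'a l2_op \<Rightarrow> 'a l2_op \<Rightarrow> 'a l2_op" where
  "op_mult \<mu> S T = (\<lambda>u\<in>L2 \<mu>. S (T u))"

definition op_adjoint :: "'a measure \<Rightarrow> 'a l2_op \<Rightarrow> 'a l2_op" where
  "op_adjoint \<mu> T = (THE S. S \<in> bounded_ops \<mu> \<and>
     (\<forall>u\<in>L2 \<mu>. \<forall>v\<in>L2 \<mu>. l2_inner \<mu> (S u) v = l2_inner \<mu> u (T v)))"

definition op_tensor :: "'a measure \<Rightarrow> 'b measure \<Rightarrow> 'a l2_op \<Rightarrow> 'b l2_op \<Rightarrow> ('a \<times> 'b) l2_op" where
  "op_tensor \<mu> \<nu> S T = (THE R. R \<in> bounded_ops (\<mu> \<Otimes>\<^sub>M \<nu>) \<and>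
     (\<forall>u\<in>L2 \<mu>. \<forall>v\<in>L2 \<nu>. R (l2_tensor \<mu> \<nu> u v) = l2_tensor \<mu> \<nu> (S u) (T v)))"


section \<open>Von Neumann algebras and normal homomorphisms\<close>

definition commutant :: "'a measure \<Rightarrow> 'a l2_op set \<Rightarrow> 'a l2_op set" where
  "commutant \<mu> A = {T \<in> bounded_ops \<mu>. \<forall>S\<in>A. op_mult \<mu> S T = op_mult \<mu> T S}"

definition von_neumann_algebra :: "'a measure \<Rightarrow> 'a l2_op set \<Rightarrow> bool" where
  "von_neumann_algebra \<mu> A \<longleftrightarrow>
     A \<subseteq> bounded_ops \<mu> \<and> (\<forall>T\<in>A. op_adjoint \<mu> T \<in> A) \<and> commutant \<mu> (commutant \<mu> A) = A"

definition vn_generated :: "'a measure \<Rightarrow> 'a l2_op set \<Rightarrow> 'a l2_op set" where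
  "vn_generated \<mu> S = \<Inter>{A. von_neumann_algebra \<mu> A \<and> S \<subseteq> A}"

definition vn_tensor ::
  "'a measure \<Rightarrow> 'a l2_op set \<Rightarrow> 'b measure \<Rightarrow> 'b l2_op set \<Rightarrow> ('a \<times> 'b) l2_op set" where
  "vn_tensor \<mu> A \<nu> B = vn_generated (\<mu> \<Otimes>\<^sub>M \<nu>) {op_tensor \<mu> \<nu> S T | S T. S \<in> A \<and> T \<in> B}"

definition self_adjoint_part :: "'a measure \<Rightarrow> 'a l2_op set \<Rightarrow> 'a l2_op set" where
  "self_adjoint_part \<mu> A = {T \<in> A. op_adjoint \<mu> T = T}"

definition op_le :: "'a measure \<Rightarrow> 'a l2_op \<Rightarrow> 'a l2_op \<Rightarrow> bool" where
  "op_le \<mu> S T \<longleftrightarrow> (\<forall>u\<in>L2 \<mu>. Re (l2_inner \<mu> u (S u)) \<le> Re (l2_inner \<mu> u (T u)))"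

definition op_lub :: "'a measure \<Rightarrow> 'a l2_op set \<Rightarrow> 'a l2_op set \<Rightarrow> 'a l2_op \<Rightarrow> bool" where
  "op_lub \<mu> A D S \<longleftrightarrow> S \<in> self_adjoint_part \<mu> A \<and> (\<forall>T\<in>D. op_le \<mu> T S) \<and>
     (\<forall>R\<in>self_adjoint_part \<mu> A. (\<forall>T\<in>D. op_le \<mu> T R) \<longrightarrow> op_le \<mu> S R)"

text \<open>Normality is preservation of suprema of bounded increasing nets of self-adjoint elements,
  stated for upward directed sets.\<close>

definition normal_map ::
  "'a measure \<Rightarrow> 'a l2_op set \<Rightarrow> 'b measure \<Rightarrow> 'b l2_op set \<Rightarrow> ('a l2_op \<Rightarrow> 'b l2_op) \<Rightarrow> bool" where
  "normal_map \<mu> A \<nu> B \<Phi> \<longleftrightarrow>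
     (\<forall>D S. D \<subseteq> self_adjoint_part \<mu> A \<and> D \<noteq> {} \<and>
        (\<forall>T\<in>D. \<forall>T'\<in>D. \<exists>R\<in>D. op_le \<mu> T R \<and> op_le \<mu> T' R) \<and> op_lub \<mu> A D S
        \<longrightarrow> op_lub \<nu> B (\<Phi> ` D) (\<Phi> S))"

definition normal_unital_star_hom ::
  "'a measure \<Rightarrow> 'a l2_op set \<Rightarrow> 'b measure \<Rightarrow> 'b l2_op set \<Rightarrow> ('a l2_op \<Rightarrow> 'b l2_op) \<Rightarrow> bool" where
  "normal_unital_star_hom \<mu> A \<nu> B \<Phi> \<longleftrightarrow>
     \<Phi> \<in> A \<rightarrow> B \<and>
     (\<forall>S\<in>A. \<forall>T\<in>A. \<Phi> (op_add \<mu> S T) = op_add \<nu> (\<Phi> S) (\<Phi> T)) \<and>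
     (\<forall>c. \<forall>T\<in>A. \<Phi> (op_scale \<mu> c T) = op_scale \<nu> c (\<Phi> T)) \<and>
     (\<forall>S\<in>A. \<forall>T\<in>A. \<Phi> (op_mult \<mu> S T) = op_mult \<nu> (\<Phi> S) (\<Phi> T)) \<and>
     (\<forall>T\<in>A. \<Phi> (op_adjoint \<mu> T) = op_adjoint \<nu> (\<Phi> T)) \<and>
     \<Phi> (op_id \<mu>) = op_id \<nu> \<and>
     normal_map \<mu> A \<nu> B \<Phi>"

text \<open>\<open>is_tensor_hom \<mu> A \<nu> B \<mu>' A' \<nu>' B' \<Phi> \<Psi> \<Theta>\<close> says that \<open>\<Theta>\<close> is the tensor product
  \<open>\<Phi> \<otimes> \<Psi>\<close> of \<open>\<Phi> : A \<rightarrow> A'\<close> and \<open>\<Psi> : B \<rightarrow> B'\<close>, i.e. the normal homomorphism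
  \<open>A \<otimes> B \<rightarrow> A' \<otimes> B'\<close> with \<open>S \<otimes> T \<mapsto> \<Phi>(S) \<otimes> \<Psi>(T)\<close>. The values of \<open>\<Theta>\<close> on \<open>A \<otimes> B\<close> are determined by this.\<close>

definition is_tensor_hom ::
  "'a measure \<Rightarrow> 'a l2_op set \<Rightarrow> 'b measure \<Rightarrow> 'b l2_op set \<Rightarrow>
   'c measure \<Rightarrow> 'c l2_op set \<Rightarrow> 'd measure \<Rightarrow> 'd l2_op set \<Rightarrow>
   ('a l2_op \<Rightarrow> 'c l2_op) \<Rightarrow> ('b l2_op \<Rightarrow> 'd l2_op) \<Rightarrow> (('a \<times> 'b) l2_op \<Rightarrow> ('c \<times> 'd) l2_op) \<Rightarrow> bool" where
  "is_tensor_hom \<mu> A \<nu> B \<mu>' A' \<nu>' B' \<Phi> \<Psi> \<Theta> \<longleftrightarrow>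
     normal_unital_star_hom (\<mu> \<Otimes>\<^sub>M \<nu>) (vn_tensor \<mu> A \<nu> B) (\<mu>' \<Otimes>\<^sub>M \<nu>') (vn_tensor \<mu>' A' \<nu>' B') \<Theta> \<and>
     (\<forall>S\<in>A. \<forall>T\<in>B. \<Theta> (op_tensor \<mu> \<nu> S T) = op_tensor \<mu>' \<nu>' (\<Phi> S) (\<Psi> T))"


section \<open>Actions of von Neumann algebraic quantum groups\<close>

definition l2_assoc ::
  "'a measure \<Rightarrow> 'b measure \<Rightarrow> 'c measure \<Rightarrow> (('a \<times> 'b) \<times> 'c) l2_vec \<Rightarrow> ('a \<times> 'b \<times> 'c) l2_vec" where
  "l2_assoc \<mu> \<nu> \<rho> u = l2_class (\<mu> \<Otimes>\<^sub>M \<nu> \<Otimes>\<^sub>M \<rho>) (\<lambda>(x, y, z). l2_rep u ((x, y), z))"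

text \<open>A right action on \<open>N\<close> acting on \<open>L2 \<mu>\<close>, of \<open>(M, \<Delta>)\<close> with \<open>M\<close> acting on \<open>L2 \<nu>\<close>. In the
  identity \<open>(id \<otimes> \<Delta>) \<gamma> = (\<gamma> \<otimes> id) \<gamma>\<close> the two sides act on \<open>L2 (\<mu> \<Otimes>\<^sub>M (\<nu> \<Otimes>\<^sub>M \<nu>))\<close> and
  \<open>L2 ((\<mu> \<Otimes>\<^sub>M \<nu>) \<Otimes>\<^sub>M \<nu>)\<close>; they are identified through \<open>l2_assoc\<close>.\<close>

definition vn_action ::
  "'a measure \<Rightarrow> 'a l2_op set \<Rightarrow> 'b measure \<Rightarrow> 'b l2_op set \<Rightarrow> ('b l2_op \<Rightarrow> ('b \<times> 'b) l2_op) \<Rightarrow>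
   ('a l2_op \<Rightarrow> ('a \<times> 'b) l2_op) \<Rightarrow> bool" where
  "vn_action \<mu> N \<nu> M \<Delta> \<gamma> \<longleftrightarrow>
     normal_unital_star_hom \<mu> N (\<mu> \<Otimes>\<^sub>M \<nu>) (vn_tensor \<mu> N \<nu> M) \<gamma> \<and>
     inj_on \<gamma> N \<and>
     (\<exists>id_\<Delta> \<gamma>_id.
        is_tensor_hom \<mu> N \<nu> M \<mu> N (\<nu> \<Otimes>\<^sub>M \<nu>) (vn_tensor \<nu> M \<nu> M) (\<lambda>x. x) \<Delta> id_\<Delta> \<and>
        is_tensor_hom \<mu> N \<nu> M (\<mu> \<Otimes>\<^sub>M \<nu>) (vn_tensor \<mu> N \<nu> M) \<nu> M \<gamma> (\<lambda>x. x) \<gamma>_id \<and>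
        (\<forall>x\<in>N. \<forall>u\<in>L2 ((\<mu> \<Otimes>\<^sub>M \<nu>) \<Otimes>\<^sub>M \<nu>).
           id_\<Delta> (\<gamma> x) (l2_assoc \<mu> \<nu> \<nu> u) = l2_assoc \<mu> \<nu> \<nu> (\<gamma>_id (\<gamma> x) u)))"

definition ergodic_action ::
  "'a measure \<Rightarrow> 'a l2_op set \<Rightarrow> 'b measure \<Rightarrow> ('a l2_op \<Rightarrow> ('a \<times> 'b) l2_op) \<Rightarrow> bool" where
  "ergodic_action \<mu> N \<nu> \<gamma> \<longleftrightarrow>
     {x \<in> N. \<gamma> x = op_tensor \<mu> \<nu> x (op_id \<nu>)} = {op_scale \<mu> c (op_id \<mu>) | c. True}"


section \<open>The bicrossed product\<close>

definition group_translation :: "'a::locally_compact_group measure \<Rightarrow> 'a \<Rightarrow> 'a l2_op" where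
  "group_translation \<mu> g = (\<lambda>u\<in>L2 \<mu>. l2_class \<mu> (\<lambda>h. l2_rep u (h + g)))"

definition group_vn_algebra :: "'a::locally_compact_group measure \<Rightarrow> 'a l2_op set" where
  "group_vn_algebra \<mu> = vn_generated \<mu> (range (group_translation \<mu>))"

definition Linfty :: "'a measure \<Rightarrow> ('a \<Rightarrow> complex) set" where
  "Linfty \<mu> = {f \<in> borel_measurable \<mu>. \<exists>C. AE x in \<mu>. cmod (f x) \<le> C}"

definition mult_op :: "'a measure \<Rightarrow> ('a \<Rightarrow> complex) \<Rightarrow> 'a l2_op" where
  "mult_op \<mu> f = (\<lambda>u\<in>L2 \<mu>. l2_class \<mu> (\<lambda>x. f x * l2_rep u x))"

definition bicrossed_algebra ::
  "'a::locally_compact_group measure \<Rightarrow> 'b::locally_compact_group measure \<Rightarrow> ('a \<Rightarrow> 'b \<Rightarrow> 'b) \<Rightarrow>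
   ('a \<times> 'b) l2_op set" where
  "bicrossed_algebra \<mu>\<^sub>1 \<mu>\<^sub>2 \<alpha> = vn_generated (\<mu>\<^sub>1 \<Otimes>\<^sub>M \<mu>\<^sub>2)
     ({mult_op (\<mu>\<^sub>1 \<Otimes>\<^sub>M \<mu>\<^sub>2) (\<lambda>(g, s). f (\<alpha> g s)) | f. f \<in> Linfty \<mu>\<^sub>2} \<union>
      {op_tensor \<mu>\<^sub>1 \<mu>\<^sub>2 x (op_id \<mu>\<^sub>2) | x. x \<in> group_vn_algebra \<mu>\<^sub>1})"

definition bicrossed_unitary ::
  "'a::locally_compact_group measure \<Rightarrow> 'b::locally_compact_group measure \<Rightarrow>
   ('a \<Rightarrow> 'b \<Rightarrow> 'b) \<Rightarrow> ('b \<Rightarrow> 'a \<Rightarrow> 'a) \<Rightarrow> (('a \<times> 'b) \<times> ('a \<times> 'b)) l2_op" where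
  "bicrossed_unitary \<mu>\<^sub>1 \<mu>\<^sub>2 \<alpha> \<beta> =
     (let \<pi> = (\<mu>\<^sub>1 \<Otimes>\<^sub>M \<mu>\<^sub>2) \<Otimes>\<^sub>M (\<mu>\<^sub>1 \<Otimes>\<^sub>M \<mu>\<^sub>2)
      in (\<lambda>u\<in>L2 \<pi>. l2_class \<pi>
        (\<lambda>((g, s), (h, t)). l2_rep u ((\<beta> (- \<alpha> g s + t) h + g, s), (h, - \<alpha> g s + t)))))"

definition bicrossed_comult ::
  "'a::locally_compact_group measure \<Rightarrow> 'b::locally_compact_group measure \<Rightarrow>
   ('a \<Rightarrow> 'b \<Rightarrow> 'b) \<Rightarrow> ('b \<Rightarrow> 'a \<Rightarrow> 'a) \<Rightarrow> ('a \<times> 'b) l2_op \<Rightarrow> (('a \<times> 'b) \<times> ('a \<times> 'b)) l2_op" where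
  "bicrossed_comult \<mu>\<^sub>1 \<mu>\<^sub>2 \<alpha> \<beta> z =
     (let \<nu> = \<mu>\<^sub>1 \<Otimes>\<^sub>M \<mu>\<^sub>2; \<pi> = \<nu> \<Otimes>\<^sub>M \<nu>; W = bicrossed_unitary \<mu>\<^sub>1 \<mu>\<^sub>2 \<alpha> \<beta>
      in op_mult \<pi> (op_adjoint \<pi> W) (op_mult \<pi> (op_tensor \<nu> \<nu> (op_id \<nu>) z) W))"

end

(*
  Composition with the bicrossed unitary W is composition with two skew translations: t is
  translated by a function of (g, s), then g is translated by a function of (h, t). If x in L(G_1)
  is invariant, then (1 (x) x (x) 1) W = W (x (x) 1 (x) 1). Since G_1 is abelian, x commutes with all
  translations, so x acting on the first variable commutes with the second skew translation, while
  x acting on the third variable commutes with the first one, which does not involve h. Cancelling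
  both gives that x on the first variable equals x on the third, hence x is scalar.
*)

theory Submission
  imports Defs
begin

section \<open>Square integrable functions\<close>

text \<open>Tensor products and adjoints of operators are definite descriptions, so nothing can be
  computed with them before an operator with the required property is exhibited. Adjoints come from
  Riesz representation. A leg of \<open>x\<close> is built by letting \<open>x\<close> act on almost
  every section of a square integrable function. The sections also give the commutation: once the
  remaining variables are frozen, a skew translation of \<open>g\<close> is translation by a
  constant, so it is enough that \<open>x\<close> commutes with every single translation. Both
  twists are measure preserving bijections, hence W is unitary, its adjoint is composition with the
  inverse bijection, and the invariance equation becomes an identity between functions. The last
  inference tests the two equal legs on products u(g) w(s) v(h) w(t). It yields (x u)(g) v(h) = u(g)
  (x v)(h) for almost all g and h, and pairing with a fixed nonzero v in the variable h shows that x
  u is a multiple of u by a factor that does not depend on u.\<close>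

definition l2sq :: "'a measure \<Rightarrow> ('a \<Rightarrow> complex) \<Rightarrow> ennreal" where
  "l2sq M f = (\<integral>\<^sup>+x. ennreal ((cmod (f x))\<^sup>2) \<partial>M)"

lemma l2_funs_iff: "f \<in> l2_funs M \<longleftrightarrow> f \<in> borel_measurable M \<and> l2sq M f < \<infinity>"
proof -
  have "integrable M (\<lambda>x. (cmod (f x))\<^sup>2) \<longleftrightarrow> l2sq M f < \<infinity>" if [measurable]: "f \<in> borel_measurable M"
    unfolding integrable_iff_bounded l2sq_def by simp
  then show ?thesis unfolding l2_funs_def by auto
qed

lemma l2_funs_measurable [measurable_dest]: "f \<in> l2_funs M \<Longrightarrow> f \<in> borel_measurable M"
  by (simp add: l2_funs_def)

lemma l2sq_finite: "f \<in> l2_funs M \<Longrightarrow> l2sq M f < \<infinity>"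
  by (simp add: l2_funs_iff)

lemma l2sq_cong_AE: "AE x in M. f x = g x \<Longrightarrow> l2sq M f = l2sq M g"
  unfolding l2sq_def by (intro nn_integral_cong_AE) auto

lemma l2sq_zero_iff:
  "f \<in> borel_measurable M \<Longrightarrow> l2sq M f = 0 \<longleftrightarrow> (AE x in M. f x = 0)"
  unfolding l2sq_def by (subst nn_integral_0_iff_AE) auto

lemma l2sq_cmult: "f \<in> borel_measurable M \<Longrightarrow> l2sq M (\<lambda>x. c * f x) = ennreal ((cmod c)\<^sup>2) * l2sq M f"
  unfolding l2sq_def by (subst nn_integral_cmult[symmetric])
    (auto simp: norm_mult power_mult_distrib ennreal_mult)

text \<open>Squared norms are kept in \<open>ennreal\<close>, where Tonelli and Fatou carry no
  integrability conditions. The factor 2 is the price for estimating sums without taking square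
  roots.\<close>

lemma cmod_add_sq: "(cmod (a + b))\<^sup>2 \<le> 2 * (cmod a)\<^sup>2 + 2 * (cmod b)\<^sup>2"
proof -
  have "(cmod (a + b))\<^sup>2 \<le> (cmod a + cmod b)\<^sup>2"
    by (intro power_mono norm_triangle_ineq) auto
  also have "\<dots> \<le> 2 * (cmod a)\<^sup>2 + 2 * (cmod b)\<^sup>2"
    using zero_le_power2[of "cmod a - cmod b"] by (simp add: power2_eq_square algebra_simps)
  finally show ?thesis .
qed

lemma l2sq_add_le:
  assumes [measurable]: "f \<in> borel_measurable M" "g \<in> borel_measurable M"
  shows "l2sq M (\<lambda>x. f x + g x) \<le> 2 * l2sq M f + 2 * l2sq M g"
proof -
  have "l2sq M (\<lambda>x. f x + g x)
      \<le> (\<integral>\<^sup>+x. 2 * ennreal ((cmod (f x))\<^sup>2) + 2 * ennreal ((cmod (g x))\<^sup>2) \<partial>M)"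
    unfolding l2sq_def
  proof (intro nn_integral_mono)
    fix x
    have "ennreal ((cmod (f x + g x))\<^sup>2) \<le> ennreal (2 * (cmod (f x))\<^sup>2 + 2 * (cmod (g x))\<^sup>2)"
      by (intro ennreal_leI cmod_add_sq)
    also have "\<dots> = 2 * ennreal ((cmod (f x))\<^sup>2) + 2 * ennreal ((cmod (g x))\<^sup>2)"
      by (simp add: ennreal_plus ennreal_mult)
    finally show "ennreal ((cmod (f x + g x))\<^sup>2) \<le> \<dots>" .
  qed
  also have "\<dots> = 2 * l2sq M f + 2 * l2sq M g"
    unfolding l2sq_def by (subst nn_integral_add) (auto simp: nn_integral_cmult)
  finally show ?thesis .
qed

lemma l2sq_minus_commute: "l2sq M (\<lambda>x. f x - g x) = l2sq M (\<lambda>x. g x - f x)"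
  unfolding l2sq_def by (simp add: norm_minus_commute)

lemma l2sq_diff_triangle:
  assumes "f \<in> borel_measurable M" "g \<in> borel_measurable M" "h \<in> borel_measurable M"
  shows "l2sq M (\<lambda>x. f x - h x) \<le> 2 * l2sq M (\<lambda>x. f x - g x) + 2 * l2sq M (\<lambda>x. g x - h x)"
  using l2sq_add_le[of "\<lambda>x. f x - g x" M "\<lambda>x. g x - h x"] assms by simp

lemma l2_funs_add:
  assumes f: "f \<in> l2_funs M" and g: "g \<in> l2_funs M"
  shows "(\<lambda>x. f x + g x) \<in> l2_funs M"
proof -
  have [measurable]: "f \<in> borel_measurable M" "g \<in> borel_measurable M"
    using f g by (auto dest: l2_funs_measurable)
  have "l2sq M (\<lambda>x. f x + g x) \<le> 2 * l2sq M f + 2 * l2sq M g"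
    by (rule l2sq_add_le) auto
  also have "\<dots> < \<infinity>" using f g by (simp add: l2_funs_iff ennreal_mult_less_top)
  finally show ?thesis by (simp add: l2_funs_iff)
qed

lemma l2_funs_cmult: "f \<in> l2_funs M \<Longrightarrow> (\<lambda>x. c * f x) \<in> l2_funs M"
  by (auto simp: l2_funs_iff l2sq_cmult ennreal_mult_less_top)

lemma l2_funs_diff:
  assumes f: "f \<in> l2_funs M" and g: "g \<in> l2_funs M"
  shows "(\<lambda>x. f x - g x) \<in> l2_funs M"
  using l2_funs_add[OF f l2_funs_cmult[OF g, of "-1"]] by simp

lemma l2_funs_cong_AE:
  "f \<in> l2_funs M \<Longrightarrow> g \<in> borel_measurable M \<Longrightarrow> AE x in M. f x = g x \<Longrightarrow> g \<in> l2_funs M"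
  using l2sq_cong_AE[of f g M] by (simp add: l2_funs_iff)

lemma l2_funs_zero: "(\<lambda>x. 0) \<in> l2_funs M"
  by (simp add: l2_funs_iff l2sq_def)

lemma l2_funs_indicator:
  "A \<in> sets M \<Longrightarrow> emeasure M A < \<infinity> \<Longrightarrow> indicator A \<in> l2_funs M"
proof -
  assume A: "A \<in> sets M" "emeasure M A < \<infinity>"
  have "l2sq M (indicator A) = (\<integral>\<^sup>+x. indicator A x \<partial>M)"
    unfolding l2sq_def by (intro nn_integral_cong) (auto split: split_indicator)
  then show ?thesis using A by (simp add: l2_funs_iff)
qed

text \<open>Here \<open>g\<close> may be any function: its class collects the square integrable
  functions almost everywhere equal to it, and \<open>f\<close> guarantees that this collection is
  not empty.\<close>

lemma l2_class_eq_iff: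
  assumes "f \<in> l2_funs M"
  shows "l2_class M f = l2_class M g \<longleftrightarrow> (AE x in M. f x = g x)"
proof
  assume "l2_class M f = l2_class M g"
  moreover have "f \<in> l2_class M f" using assms by (simp add: l2_class_def)
  ultimately show "AE x in M. f x = g x" by (auto simp: l2_class_def)
next
  assume ae: "AE x in M. f x = g x"
  show "l2_class M f = l2_class M g"
    unfolding l2_class_def using ae by (auto elim!: eventually_elim2)
qed

lemma l2_rep_class:
  assumes "f \<in> l2_funs M"
  shows "l2_rep (l2_class M f) \<in> l2_funs M" "AE x in M. l2_rep (l2_class M f) x = f x"
proof -
  have "f \<in> l2_class M f" using assms by (simp add: l2_class_def)
  then have "l2_rep (l2_class M f) \<in> l2_class M f" unfolding l2_rep_def by (rule someI[of "\<lambda>g. g \<in> l2_class M f"])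
  then show "l2_rep (l2_class M f) \<in> l2_funs M" "AE x in M. l2_rep (l2_class M f) x = f x"
    by (auto simp: l2_class_def)
qed

lemma l2_class_in_L2: "f \<in> l2_funs M \<Longrightarrow> l2_class M f \<in> L2 M"
  by (simp add: L2_def)

lemma L2E:
  assumes "u \<in> L2 M"
  obtains f where "f \<in> l2_funs M" "u = l2_class M f"
  using assms by (auto simp: L2_def)

lemma l2_rep_in_l2_funs: "u \<in> L2 M \<Longrightarrow> l2_rep u \<in> l2_funs M"
  by (auto elim!: L2E intro: l2_rep_class)

lemma l2_class_rep: "u \<in> L2 M \<Longrightarrow> l2_class M (l2_rep u) = u"
  by (metis L2E l2_class_eq_iff l2_rep_class)

lemma l2_add_class:
  assumes "f \<in> l2_funs M" "g \<in> l2_funs M"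
  shows "l2_add M (l2_class M f) (l2_class M g) = l2_class M (\<lambda>x. f x + g x)"
proof -
  have "AE x in M. l2_rep (l2_class M f) x + l2_rep (l2_class M g) x = f x + g x"
    using l2_rep_class(2)[OF assms(1)] l2_rep_class(2)[OF assms(2)] by eventually_elim simp
  then show ?thesis unfolding l2_add_def
    by (subst l2_class_eq_iff) (auto intro!: l2_funs_add l2_rep_class assms)
qed

lemma l2_scale_class:
  assumes "f \<in> l2_funs M"
  shows "l2_scale M c (l2_class M f) = l2_class M (\<lambda>x. c * f x)"
proof -
  have "AE x in M. c * l2_rep (l2_class M f) x = c * f x"
    using l2_rep_class(2)[OF assms(1)] by eventually_elim simp
  then show ?thesis unfolding l2_scale_def
    by (subst l2_class_eq_iff) (auto intro!: l2_funs_cmult l2_rep_class assms)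
qed

section \<open>The inner product on representatives\<close>

definition inner_fun :: "'a measure \<Rightarrow> ('a \<Rightarrow> complex) \<Rightarrow> ('a \<Rightarrow> complex) \<Rightarrow> complex" where
  "inner_fun M f g = (\<integral>x. cnj (f x) * g x \<partial>M)"

text \<open>Since 2|f||g| is at most |f|^2 + |g|^2, the product has an integrable majorant.\<close>

lemma integrable_cnj_mult:
  assumes f: "f \<in> l2_funs M" and g: "g \<in> l2_funs M"
  shows "integrable M (\<lambda>x. cnj (f x) * g x)"
proof (rule Bochner_Integration.integrable_bound)
  show "integrable M (\<lambda>x. (cmod (f x))\<^sup>2 + (cmod (g x))\<^sup>2)"
    using f g by (simp add: l2_funs_def)
  show "(\<lambda>x. cnj (f x) * g x) \<in> borel_measurable M"
    using f g by (auto dest!: l2_funs_measurable intro!: borel_measurable_times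
      borel_measurable_continuous_on[OF continuous_on_cnj[OF continuous_on_id]])
  show "AE x in M. norm (cnj (f x) * g x) \<le> norm ((cmod (f x))\<^sup>2 + (cmod (g x))\<^sup>2)"
  proof (intro AE_I2)
    fix x
    have "2 * (cmod (f x) * cmod (g x)) \<le> (cmod (f x))\<^sup>2 + (cmod (g x))\<^sup>2"
      using zero_le_power2[of "cmod (f x) - cmod (g x)"] by (simp add: power2_eq_square algebra_simps)
    moreover have "0 \<le> cmod (f x) * cmod (g x)" by simp
    ultimately show "norm (cnj (f x) * g x) \<le> norm ((cmod (f x))\<^sup>2 + (cmod (g x))\<^sup>2)"
      unfolding norm_mult complex_mod_cnj real_norm_def by linarith
  qed
qed

lemma inner_fun_cong_AE:
  assumes "f \<in> l2_funs M" "g \<in> l2_funs M" "f' \<in> l2_funs M" "g' \<in> l2_funs M"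
    "AE x in M. f x = f' x" "AE x in M. g x = g' x"
  shows "inner_fun M f g = inner_fun M f' g'"
  unfolding inner_fun_def
  apply (rule integral_cong_AE)
  subgoal by (rule borel_measurable_integrable[OF integrable_cnj_mult]) fact+
  subgoal by (rule borel_measurable_integrable[OF integrable_cnj_mult]) fact+
  using assms(5,6) by eventually_elim simp

lemma l2_inner_class:
  assumes "f \<in> l2_funs M" "g \<in> l2_funs M"
  shows "l2_inner M (l2_class M f) (l2_class M g) = inner_fun M f g"
  unfolding l2_inner_def inner_fun_def[symmetric]
  by (intro inner_fun_cong_AE l2_rep_class assms)

lemma inner_fun_self:
  assumes f: "f \<in> l2_funs M"
  shows "inner_fun M f f = complex_of_real (enn2real (l2sq M f))"
    and "ennreal (Re (inner_fun M f f)) = l2sq M f"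
proof -
  have "integrable M (\<lambda>x. (cmod (f x))\<^sup>2)" using f by (simp add: l2_funs_def)
  then have "l2sq M f = ennreal (\<integral>x. (cmod (f x))\<^sup>2 \<partial>M)"
    unfolding l2sq_def by (intro nn_integral_eq_integral) auto
  moreover have "inner_fun M f f = complex_of_real (\<integral>x. (cmod (f x))\<^sup>2 \<partial>M)"
    unfolding inner_fun_def
    by (subst integral_complex_of_real[symmetric], rule Bochner_Integration.integral_cong)
       (simp_all only: complex_norm_square mult.commute)
  moreover have "0 \<le> (\<integral>x. (cmod (f x))\<^sup>2 \<partial>M)" by simp
  ultimately show "inner_fun M f f = complex_of_real (enn2real (l2sq M f))"
    and "ennreal (Re (inner_fun M f f)) = l2sq M f" by auto
qed

lemma l2_norm_class_sq:
  assumes f: "f \<in> l2_funs M"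
  shows "ennreal ((l2_norm M (l2_class M f))\<^sup>2) = l2sq M f" "0 \<le> l2_norm M (l2_class M f)"
proof -
  have n: "0 \<le> Re (inner_fun M f f)" using inner_fun_self(1)[OF f] by simp
  then show "ennreal ((l2_norm M (l2_class M f))\<^sup>2) = l2sq M f"
    unfolding l2_norm_def l2_inner_class[OF f f] using inner_fun_self(2)[OF f] by simp
  show "0 \<le> l2_norm M (l2_class M f)"
    unfolding l2_norm_def l2_inner_class[OF f f] using n by simp
qed

lemma inner_fun_add_right:
  "f \<in> l2_funs M \<Longrightarrow> g \<in> l2_funs M \<Longrightarrow> h \<in> l2_funs M \<Longrightarrow>
   inner_fun M f (\<lambda>x. g x + h x) = inner_fun M f g + inner_fun M f h"
  unfolding inner_fun_def
  by (subst Bochner_Integration.integral_add[symmetric])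
     (simp_all add: integrable_cnj_mult distrib_left distrib_right)

lemma inner_fun_add_left:
  "f \<in> l2_funs M \<Longrightarrow> g \<in> l2_funs M \<Longrightarrow> h \<in> l2_funs M \<Longrightarrow>
   inner_fun M (\<lambda>x. f x + g x) h = inner_fun M f h + inner_fun M g h"
  unfolding inner_fun_def
  by (subst Bochner_Integration.integral_add[symmetric])
     (simp_all add: integrable_cnj_mult distrib_left distrib_right)

lemma inner_fun_scale_right: "inner_fun M f (\<lambda>x. c * g x) = c * inner_fun M f g"
  unfolding inner_fun_def by (subst integral_mult_right_zero[symmetric]) (simp add: algebra_simps)

lemma inner_fun_scale_left: "inner_fun M (\<lambda>x. c * f x) g = cnj c * inner_fun M f g"
  unfolding inner_fun_def by (subst integral_mult_right_zero[symmetric]) (simp add: algebra_simps)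

lemma inner_fun_cnj: "cnj (inner_fun M f g) = inner_fun M g f"
  unfolding inner_fun_def by (subst Bochner_Integration.integral_cnj[symmetric]) (simp add: mult.commute)

text \<open>Testing against the difference of the two functions shows that this difference has norm
  zero.\<close>

lemma inner_fun_eqI:
  assumes f: "f \<in> l2_funs M" and g: "g \<in> l2_funs M"
    and eq: "\<And>h. h \<in> l2_funs M \<Longrightarrow> inner_fun M f h = inner_fun M g h"
  shows "AE x in M. f x = g x"
proof -
  define d where "d = (\<lambda>x. f x + (-1) * g x)"
  have d: "d \<in> l2_funs M" unfolding d_def by (intro l2_funs_add l2_funs_cmult f g)
  have "inner_fun M d d = inner_fun M f d + inner_fun M (\<lambda>x. (-1) * g x) d"
    by (subst d_def) (intro inner_fun_add_left f l2_funs_cmult g d)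
  also have "\<dots> = 0" using eq[OF d] by (simp only: inner_fun_scale_left) simp
  finally have "l2sq M d = 0" using inner_fun_self(2)[OF d] by simp
  then have "AE x in M. d x = 0" using d by (simp add: l2sq_zero_iff l2_funs_measurable)
  then show ?thesis by eventually_elim (simp add: d_def)
qed

subsection \<open>Completeness\<close>

text \<open>The sum of the functions has a finite integral, so it is finite almost everywhere, and
  the terms of a convergent series tend to zero.\<close>

lemma AE_tendsto_zero_of_summable_integrals:
  fixes \<phi> :: "nat \<Rightarrow> 'a \<Rightarrow> ennreal"
  assumes [measurable]: "\<And>n. \<phi> n \<in> borel_measurable M"
    and le: "\<And>n. (\<integral>\<^sup>+x. \<phi> n x \<partial>M) \<le> ennreal ((1/2)^n)"
  shows "AE x in M. (\<lambda>n. \<phi> n x) \<longlonglongrightarrow> 0"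
proof -
  have "(\<integral>\<^sup>+x. (\<Sum>n. \<phi> n x) \<partial>M) = (\<Sum>n. \<integral>\<^sup>+x. \<phi> n x \<partial>M)"
    by (rule nn_integral_suminf) auto
  also have "\<dots> \<le> (\<Sum>n. ennreal ((1/2)^n))"
    by (intro suminf_le le) auto
  also have "\<dots> = ennreal (\<Sum>n. (1/2)^n)"
    by (rule suminf_ennreal2) (auto intro: summable_geometric)
  finally have "(\<integral>\<^sup>+x. (\<Sum>n. \<phi> n x) \<partial>M) \<noteq> \<infinity>" by (auto simp: top_unique)
  then have "AE x in M. (\<Sum>n. \<phi> n x) \<noteq> \<infinity>" by (intro nn_integral_PInf_AE) auto
  then show ?thesis
  proof eventually_elim
    case (elim x)
    then have fin: "\<phi> n x \<noteq> top" for n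
      using ennreal_suminf_lessD[of "\<lambda>n. \<phi> n x" top n] by (simp add: less_top)
    have "summable (\<lambda>n. enn2real (\<phi> n x))"
      using elim fin by (intro summable_suminf_not_top) (auto simp: less_top)
    then have "(\<lambda>n. enn2real (\<phi> n x)) \<longlonglongrightarrow> 0" by (rule summable_LIMSEQ_zero)
    then have "(\<lambda>n. ennreal (enn2real (\<phi> n x))) \<longlonglongrightarrow> ennreal 0" by (rule tendsto_ennrealI)
    then show ?case using fin by (simp add: less_top)
  qed
qed

lemma strict_mono_above:
  fixes N :: "nat \<Rightarrow> nat"
  obtains r where "strict_mono r" "\<And>n. N n \<le> r n"
proof
  define r where "r = rec_nat (N 0) (\<lambda>n k. max (Suc k) (N (Suc n)))"
  show "strict_mono r" unfolding strict_mono_Suc_iff by (simp add: r_def less_max_iff_disj)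
  show "N n \<le> r n" for n by (cases n) (auto simp: r_def)
qed

lemma tendsto_zero_imp_subseq_le:
  fixes a :: "nat \<Rightarrow> ennreal" and e :: "nat \<Rightarrow> real"
  assumes "a \<longlonglongrightarrow> 0" and "\<And>n. 0 < e n"
  obtains r where "strict_mono r" "\<And>n. a (r n) \<le> ennreal (e n)"
proof -
  have ev: "\<exists>N. \<forall>m\<ge>N. a m \<le> ennreal (e n)" for n
    using order_tendstoD(2)[OF assms(1), of "ennreal (e n)"] assms(2)[of n]
    by (auto simp: eventually_sequentially intro: less_imp_le)
  then obtain N :: "nat \<Rightarrow> nat" where N: "\<And>n m. N n \<le> m \<Longrightarrow> a m \<le> ennreal (e n)" by metis
  obtain r where "strict_mono r" "\<And>n. N n \<le> r n" using strict_mono_above[of N] by blast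
  then show thesis using N that by blast
qed

text \<open>Riesz-Fischer: a fast subsequence converges almost everywhere, and Fatou upgrades this
  to norm convergence of the whole sequence.\<close>

lemma l2_complete:
  assumes F: "\<And>n. F n \<in> l2_funs M"
    and Cauchy: "\<And>e::real. 0 < e \<Longrightarrow> \<exists>N. \<forall>m\<ge>N. \<forall>n\<ge>N. l2sq M (\<lambda>x. F m x - F n x) \<le> ennreal e"
  obtains f where "f \<in> l2_funs M" "(\<lambda>n. l2sq M (\<lambda>x. F n x - f x)) \<longlonglongrightarrow> 0"
proof -
  have [measurable]: "F n \<in> borel_measurable M" for n using F by (rule l2_funs_measurable)
  \<comment> \<open>The rate 1/8 leaves room for the weight 4^k: the weighted squared increments
    still have integrals at most 2^-k, so they tend to zero almost everywhere. Then the increments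
    are eventually below 2^-k, and their series converges absolutely.\<close>
  obtain N :: "nat \<Rightarrow> nat" where N: "\<And>k m n. N k \<le> m \<Longrightarrow> N k \<le> n \<Longrightarrow> l2sq M (\<lambda>x. F m x - F n x) \<le> ennreal ((1/8)^k)"
    using Cauchy[of "(1/8)^k" for k] by (metis zero_less_power zero_less_divide_1_iff zero_less_numeral)
  obtain r where r: "strict_mono r" and Nr: "\<And>n. N n \<le> r n" using strict_mono_above[of N] by blast
  define d where "d = (\<lambda>k x. F (r (Suc k)) x - F (r k) x)"
  have [measurable]: "d k \<in> borel_measurable M" for k unfolding d_def by simp
  have dle: "l2sq M (d k) \<le> ennreal ((1/8)^k)" for k
    unfolding d_def using Nr[of k] strict_monoD[OF r, of k "Suc k"] by (intro N) auto
  have "(\<integral>\<^sup>+x. ennreal (4^k) * ennreal ((cmod (d k x))\<^sup>2) \<partial>M) \<le> ennreal ((1/2)^k)" for k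
  proof -
    have "(\<integral>\<^sup>+x. ennreal (4^k) * ennreal ((cmod (d k x))\<^sup>2) \<partial>M) = ennreal (4^k) * l2sq M (d k)"
      unfolding l2sq_def by (rule nn_integral_cmult) simp
    also have "\<dots> \<le> ennreal (4^k) * ennreal ((1/8)^k)" by (intro mult_left_mono dle) simp
    also have "\<dots> = ennreal ((1/2)^k)"
      by (subst ennreal_mult[symmetric]) (auto simp: power_mult_distrib[symmetric])
    finally show ?thesis .
  qed
  then have "AE x in M. (\<lambda>k. ennreal (4^k) * ennreal ((cmod (d k x))\<^sup>2)) \<longlonglongrightarrow> 0"
    by (intro AE_tendsto_zero_of_summable_integrals) auto
  then have conv: "AE x in M. convergent (\<lambda>k. F (r k) x)"
  proof eventually_elim
    case (elim x)
    then have "eventually (\<lambda>k. ennreal (4^k) * ennreal ((cmod (d k x))\<^sup>2) < 1) sequentially"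
      by (intro order_tendstoD) auto
    then have "eventually (\<lambda>k. norm (d k x) \<le> (1/2)^k) sequentially"
    proof eventually_elim
      case (elim k)
      then have "ennreal (4^k * (cmod (d k x))\<^sup>2) < ennreal 1" by (simp add: ennreal_mult)
      then have "4^k * (cmod (d k x))\<^sup>2 < 1" by (subst (asm) ennreal_less_iff) auto
      moreover have "(4::real)^k = (2^k)\<^sup>2" by (simp add: power_mult_distrib[symmetric] power2_eq_square)
      ultimately have "(2^k * cmod (d k x))\<^sup>2 < 1\<^sup>2" by (simp add: power_mult_distrib)
      then have "2^k * cmod (d k x) < 1" by (rule power_less_imp_less_base) simp
      then show ?case by (simp add: power_one_over field_simps)
    qed
    then have "summable (\<lambda>k. d k x)"
      by (rule summable_comparison_test_ev) (simp add: summable_geometric)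
    then have "convergent (\<lambda>k. \<Sum>i<k. d i x)" by (simp add: summable_iff_convergent)
    moreover have "(\<Sum>i<k. d i x) = F (r k) x - F (r 0) x" for k
      unfolding d_def by (rule sum_lessThan_telescope)
    ultimately have "convergent (\<lambda>k. F (r k) x - F (r 0) x)" by simp
    then show ?case using convergent_add_const_right_iff[of "\<lambda>k. F (r k) x" "- F (r 0) x"] by simp
  qed
  define f where "f = (\<lambda>x. lim (\<lambda>k. F (r k) x))"
  have [measurable]: "f \<in> borel_measurable M" unfolding f_def by (rule borel_measurable_lim_metric) simp
  have lim: "AE x in M. (\<lambda>k. F (r k) x) \<longlonglongrightarrow> f x"
    using conv by eventually_elim (simp add: f_def convergent_LIMSEQ_iff)
  \<comment> \<open>Fatou along the subsequence: the Cauchy estimate between \<open>F n\<close> and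
    \<open>F (r k)\<close> survives the limit in k.\<close>
  have bnd: "l2sq M (\<lambda>x. F n x - f x) \<le> ennreal e"
    if P: "\<forall>m\<ge>P. \<forall>n\<ge>P. l2sq M (\<lambda>x. F m x - F n x) \<le> ennreal e" and n: "P \<le> n" for P n e
  proof -
    have "l2sq M (\<lambda>x. F n x - f x)
        = (\<integral>\<^sup>+x. liminf (\<lambda>k. ennreal ((cmod (F n x - F (r k) x))\<^sup>2)) \<partial>M)"
      unfolding l2sq_def
    proof (rule nn_integral_cong_AE)
      show "AE x in M. ennreal ((cmod (F n x - f x))\<^sup>2) =
          liminf (\<lambda>k. ennreal ((cmod (F n x - F (r k) x))\<^sup>2))"
        using lim
      proof eventually_elim
        case (elim x)
        have "(\<lambda>k. ennreal ((cmod (F n x - F (r k) x))\<^sup>2)) \<longlonglongrightarrow> ennreal ((cmod (F n x - f x))\<^sup>2)"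
          by (intro tendsto_intros elim)
        then show ?case by (intro lim_imp_Liminf[symmetric]) auto
      qed
    qed
    also have "\<dots> \<le> liminf (\<lambda>k. l2sq M (\<lambda>x. F n x - F (r k) x))"
      unfolding l2sq_def by (rule nn_integral_liminf) simp
    also have "\<dots> \<le> liminf (\<lambda>k. ennreal e)"
    proof (rule Liminf_mono)
      show "eventually (\<lambda>k. l2sq M (\<lambda>x. F n x - F (r k) x) \<le> ennreal e) sequentially"
        using eventually_ge_at_top[of P]
      proof eventually_elim
        case (elim k)
        then have "P \<le> r k" using seq_suble[OF r, of k] by simp
        then show ?case using P n by blast
      qed
    qed
    also have "\<dots> = ennreal e" by (rule Liminf_const) simp
    finally show ?thesis .
  qed
  have conv0: "(\<lambda>n. l2sq M (\<lambda>x. F n x - f x)) \<longlonglongrightarrow> 0"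
  proof (rule order_tendstoI)
    fix a :: ennreal assume "0 < a"
    then obtain e where e: "0 < e" "ennreal e < a"
      by (metis dense ennreal_cases ennreal_less_zero_iff less_top_ennreal order_less_trans ennreal_zero_less_top)
    obtain P where "\<forall>m\<ge>P. \<forall>n\<ge>P. l2sq M (\<lambda>x. F m x - F n x) \<le> ennreal e" using Cauchy[OF e(1)] by blast
    then show "eventually (\<lambda>n. l2sq M (\<lambda>x. F n x - f x) < a) sequentially"
      using bnd e(2) by (intro eventually_sequentiallyI[of P]) (rule order_le_less_trans)
  qed simp
  \<comment> \<open>One index at finite distance from \<open>f\<close> is enough to see that
    \<open>f\<close> is square integrable, as the difference of \<open>F P\<close> and
    \<open>F P - f\<close>.\<close>
  obtain P where P: "\<forall>m\<ge>P. \<forall>n\<ge>P. l2sq M (\<lambda>x. F m x - F n x) \<le> ennreal 1" using Cauchy[of 1] by auto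
  have "l2sq M (\<lambda>x. F P x - f x) \<le> ennreal 1" by (rule bnd[OF P]) simp
  then have "(\<lambda>x. F P x - f x) \<in> l2_funs M"
    by (auto simp: l2_funs_iff top_unique less_top[symmetric])
  from l2_funs_diff[OF F[of P] this] have "f \<in> l2_funs M" by simp
  then show thesis using conv0 by (rule that)
qed

section \<open>Operators\<close>

text \<open>A chosen representative of the image. The choice depends on the class of
  \<open>f\<close> alone, so almost everywhere equal arguments give literally equal functions,
  whereas linearity holds only almost everywhere.\<close>

definition op_fun :: "'a measure \<Rightarrow> 'a l2_op \<Rightarrow> ('a \<Rightarrow> complex) \<Rightarrow> 'a \<Rightarrow> complex" where
  "op_fun M T f = l2_rep (T (l2_class M f))"

text \<open>The way back from functions to operators. The map \<open>F\<close> has to respect sums,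
  multiples and equality only up to null sets, which is what fibrewise constructions
  deliver.\<close>

definition fun_op :: "'a measure \<Rightarrow> (('a \<Rightarrow> complex) \<Rightarrow> 'a \<Rightarrow> complex) \<Rightarrow> 'a l2_op" where
  "fun_op M F = (\<lambda>u\<in>L2 M. l2_class M (F (l2_rep u)))"

lemma bounded_ops_L2: "T \<in> bounded_ops M \<Longrightarrow> u \<in> L2 M \<Longrightarrow> T u \<in> L2 M"
  by (auto simp: bounded_ops_def PiE_def)

lemma op_fun_in_l2_funs:
  "T \<in> bounded_ops M \<Longrightarrow> f \<in> l2_funs M \<Longrightarrow> op_fun M T f \<in> l2_funs M"
  unfolding op_fun_def by (simp add: l2_rep_in_l2_funs bounded_ops_L2 l2_class_in_L2)

lemma class_op_fun:
  "T \<in> bounded_ops M \<Longrightarrow> f \<in> l2_funs M \<Longrightarrow> l2_class M (op_fun M T f) = T (l2_class M f)"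
  unfolding op_fun_def by (simp add: l2_class_rep bounded_ops_L2 l2_class_in_L2)

lemma op_fun_eqI:
  assumes "f \<in> l2_funs M" "g \<in> l2_funs M" "T (l2_class M f) = l2_class M g"
  shows "AE x in M. op_fun M T f x = g x"
  unfolding op_fun_def assms(3) by (rule l2_rep_class) fact

lemma op_fun_cong_AE:
  assumes "f \<in> l2_funs M" "AE x in M. f x = g x"
  shows "op_fun M T f = op_fun M T g"
  using assms l2_class_eq_iff[of f M g] by (simp add: op_fun_def)

lemma op_fun_add:
  assumes T: "T \<in> bounded_ops M" and f: "f \<in> l2_funs M" and g: "g \<in> l2_funs M"
  shows "AE x in M. op_fun M T (\<lambda>x. f x + g x) x = op_fun M T f x + op_fun M T g x"
proof (rule op_fun_eqI)
  have "T (l2_add M (l2_class M f) (l2_class M g)) = l2_add M (T (l2_class M f)) (T (l2_class M g))"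
    using T f g by (auto simp: bounded_ops_def l2_class_in_L2)
  then show "T (l2_class M (\<lambda>x. f x + g x)) = l2_class M (\<lambda>x. op_fun M T f x + op_fun M T g x)"
    using T f g by (simp add: l2_add_class op_fun_in_l2_funs class_op_fun[OF T f, symmetric]
        class_op_fun[OF T g, symmetric])
qed (intro l2_funs_add op_fun_in_l2_funs assms)+

lemma op_fun_scale:
  assumes T: "T \<in> bounded_ops M" and f: "f \<in> l2_funs M"
  shows "AE x in M. op_fun M T (\<lambda>x. c * f x) x = c * op_fun M T f x"
proof (rule op_fun_eqI)
  have "T (l2_scale M c (l2_class M f)) = l2_scale M c (T (l2_class M f))"
    using T f by (auto simp: bounded_ops_def l2_class_in_L2)
  then show "T (l2_class M (\<lambda>x. c * f x)) = l2_class M (\<lambda>x. c * op_fun M T f x)"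
    using T f by (simp add: l2_scale_class op_fun_in_l2_funs class_op_fun[OF T f, symmetric])
qed (intro l2_funs_cmult op_fun_in_l2_funs assms)+

lemma op_fun_diff:
  assumes T: "T \<in> bounded_ops M" and f: "f \<in> l2_funs M" and g: "g \<in> l2_funs M"
  shows "AE x in M. op_fun M T (\<lambda>x. f x - g x) x = op_fun M T f x - op_fun M T g x"
  using op_fun_add[OF T f l2_funs_cmult[OF g, of "-1"]] op_fun_scale[OF T g, of "-1"]
  by eventually_elim simp

text \<open>The bound in \<open>bounded_ops\<close> may carry a negative constant. Its square is
  nonnegative, and squaring is legitimate because the norm on the left is nonnegative.\<close>

lemma op_fun_bound:
  assumes T: "T \<in> bounded_ops M"
  obtains C :: real where "0 \<le> C" "\<And>f. f \<in> l2_funs M \<Longrightarrow> l2sq M (op_fun M T f) \<le> ennreal C * l2sq M f"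
proof -
  obtain C where C: "\<And>u. u \<in> L2 M \<Longrightarrow> l2_norm M (T u) \<le> C * l2_norm M u"
    using T unfolding bounded_ops_def by blast
  show thesis
  proof
    show "0 \<le> C\<^sup>2" by simp
    fix f assume f: "f \<in> l2_funs M"
    have Tf: "op_fun M T f \<in> l2_funs M" by (intro op_fun_in_l2_funs T f)
    have "(l2_norm M (l2_class M (op_fun M T f)))\<^sup>2 \<le> (C * l2_norm M (l2_class M f))\<^sup>2"
      using C[OF l2_class_in_L2[OF f]] l2_norm_class_sq(2)[OF Tf] class_op_fun[OF T f]
      by (intro power_mono) auto
    then show "l2sq M (op_fun M T f) \<le> ennreal (C\<^sup>2) * l2sq M f"
      unfolding l2_norm_class_sq(1)[OF Tf, symmetric] l2_norm_class_sq(1)[OF f, symmetric]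
      by (simp add: power_mult_distrib flip: ennreal_mult)
  qed
qed

lemma fun_op_class:
  assumes F: "\<And>f. f \<in> l2_funs M \<Longrightarrow> F f \<in> l2_funs M"
    and cong: "\<And>f g. f \<in> l2_funs M \<Longrightarrow> g \<in> l2_funs M \<Longrightarrow> AE x in M. f x = g x \<Longrightarrow> AE x in M. F f x = F g x"
    and f: "f \<in> l2_funs M"
  shows "fun_op M F (l2_class M f) = l2_class M (F f)"
proof -
  have "l2_class M (F (l2_rep (l2_class M f))) = l2_class M (F f)"
    by (subst l2_class_eq_iff) (intro F cong l2_rep_class f)+
  then show ?thesis using f by (simp add: fun_op_def l2_class_in_L2)
qed

lemma fun_op_bounded:
  assumes F: "\<And>f. f \<in> l2_funs M \<Longrightarrow> F f \<in> l2_funs M"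
    and cong: "\<And>f g. f \<in> l2_funs M \<Longrightarrow> g \<in> l2_funs M \<Longrightarrow> AE x in M. f x = g x \<Longrightarrow> AE x in M. F f x = F g x"
    and add: "\<And>f g. f \<in> l2_funs M \<Longrightarrow> g \<in> l2_funs M \<Longrightarrow> AE x in M. F (\<lambda>x. f x + g x) x = F f x + F g x"
    and scale: "\<And>c f. f \<in> l2_funs M \<Longrightarrow> AE x in M. F (\<lambda>x. c * f x) x = c * F f x"
    and C: "0 \<le> C" "\<And>f. f \<in> l2_funs M \<Longrightarrow> l2sq M (F f) \<le> ennreal C * l2sq M f"
  shows "fun_op M F \<in> bounded_ops M"
proof -
  have cl: "fun_op M F (l2_class M f) = l2_class M (F f)" if "f \<in> l2_funs M" for f
    by (rule fun_op_class) (simp_all add: F cong that)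
  have "fun_op M F \<in> L2 M \<rightarrow>\<^sub>E L2 M"
    by (auto simp: fun_op_def intro!: l2_class_in_L2 F l2_rep_in_l2_funs)
  moreover have "fun_op M F (l2_add M u v) = l2_add M (fun_op M F u) (fun_op M F v)"
    if "u \<in> L2 M" "v \<in> L2 M" for u v
    using that by (elim L2E) (simp add: l2_add_class cl F l2_funs_add l2_class_eq_iff add)
  moreover have "fun_op M F (l2_scale M c u) = l2_scale M c (fun_op M F u)" if "u \<in> L2 M" for c u
    using that by (elim L2E) (simp add: l2_scale_class cl F l2_funs_cmult l2_class_eq_iff scale)
  moreover have "l2_norm M (fun_op M F u) \<le> sqrt C * l2_norm M u" if u: "u \<in> L2 M" for u
  proof -
    obtain f where f: "f \<in> l2_funs M" "u = l2_class M f" using u by (rule L2E)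
    have "ennreal ((l2_norm M (l2_class M (F f)))\<^sup>2) \<le> ennreal C * ennreal ((l2_norm M (l2_class M f))\<^sup>2)"
      using C(2)[OF f(1)] by (simp add: l2_norm_class_sq f F)
    also have "\<dots> = ennreal ((sqrt C * l2_norm M (l2_class M f))\<^sup>2)"
      using C(1) by (simp add: power_mult_distrib ennreal_mult)
    finally have "(l2_norm M (l2_class M (F f)))\<^sup>2 \<le> (sqrt C * l2_norm M (l2_class M f))\<^sup>2"
      by (simp add: ennreal_le_iff)
    then show ?thesis unfolding f(2) cl[OF f(1)]
      by (rule power2_le_imp_le) (simp add: C(1) l2_norm_class_sq f)
  qed
  ultimately show ?thesis
    unfolding bounded_ops_def by (intro CollectI conjI ballI allI exI[of _ "sqrt C"])
qed

lemma bounded_ops_eqI: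
  assumes S: "S \<in> bounded_ops M" and T: "T \<in> bounded_ops M"
    and eq: "\<And>f. f \<in> l2_funs M \<Longrightarrow> S (l2_class M f) = T (l2_class M f)"
  shows "S = T"
proof (rule extensionalityI)
  show "S \<in> extensional (L2 M)" "T \<in> extensional (L2 M)"
    using S T by (auto simp: bounded_ops_def PiE_def)
qed (elim L2E, simp add: eq)

lemma op_id_bounded: "op_id M \<in> bounded_ops M"
proof -
  have "op_id M = fun_op M (\<lambda>f. f)"
    unfolding op_id_def fun_op_def by (rule restrict_ext) (simp add: l2_class_rep)
  also have "\<dots> \<in> bounded_ops M" by (rule fun_op_bounded[where C = 1]) auto
  finally show ?thesis .
qed

lemma op_mult_class: "f \<in> l2_funs M \<Longrightarrow> op_mult M S T (l2_class M f) = S (T (l2_class M f))"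
  by (simp add: op_mult_def l2_class_in_L2)

lemma op_mult_bounded:
  assumes S: "S \<in> bounded_ops M" and T: "T \<in> bounded_ops M"
  shows "op_mult M S T \<in> bounded_ops M"
proof -
  let ?F = "\<lambda>f. op_fun M S (op_fun M T f)"
  note in_l2 = op_fun_in_l2_funs[OF S] op_fun_in_l2_funs[OF T]
  obtain C where C: "0 \<le> C" "\<And>f. f \<in> l2_funs M \<Longrightarrow> l2sq M (op_fun M S f) \<le> ennreal C * l2sq M f"
    using op_fun_bound[OF S] by blast
  obtain D where D: "0 \<le> D" "\<And>f. f \<in> l2_funs M \<Longrightarrow> l2sq M (op_fun M T f) \<le> ennreal D * l2sq M f"
    using op_fun_bound[OF T] by blast
  have "op_mult M S T = fun_op M ?F"
    unfolding op_mult_def fun_op_def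
    by (rule restrict_ext)
       (simp add: class_op_fun S T l2_rep_in_l2_funs l2_class_rep op_fun_in_l2_funs)
  also have "\<dots> \<in> bounded_ops M"
  proof (rule fun_op_bounded[where C = "C * D"])
    fix f g assume f: "f \<in> l2_funs M" and g: "g \<in> l2_funs M"
    show "AE x in M. ?F (\<lambda>x. f x + g x) x = ?F f x + ?F g x"
      using op_fun_add[OF S, of "op_fun M T f" "op_fun M T g"] f g
      by (simp add: op_fun_cong_AE[OF _ op_fun_add[OF T f g]] in_l2 l2_funs_add)
    show "AE x in M. ?F f x = ?F g x" if "AE x in M. f x = g x"
      using op_fun_cong_AE[OF f that, of T] by simp
  next
    fix c f assume f: "f \<in> l2_funs M"
    show "AE x in M. ?F (\<lambda>x. c * f x) x = c * ?F f x"
      using op_fun_scale[OF S, of "op_fun M T f" c] f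
      by (simp add: op_fun_cong_AE[OF _ op_fun_scale[OF T f]] in_l2 l2_funs_cmult)
    have "l2sq M (?F f) \<le> ennreal C * l2sq M (op_fun M T f)" by (intro C in_l2 f)
    also have "\<dots> \<le> ennreal C * (ennreal D * l2sq M f)" by (intro mult_left_mono D f) simp
    finally show "l2sq M (?F f) \<le> ennreal (C * D) * l2sq M f"
      using C D by (simp add: ennreal_mult mult.assoc)
  qed (auto intro: in_l2 simp: C D)
  finally show ?thesis .
qed

lemma op_scale_id_class:
  "f \<in> l2_funs M \<Longrightarrow> op_scale M c (op_id M) (l2_class M f) = l2_class M (\<lambda>x. c * f x)"
  by (simp add: op_scale_def op_id_def l2_class_in_L2 l2_scale_class)

lemma op_scale_id_bounded: "op_scale M c (op_id M) \<in> bounded_ops M"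
proof -
  have "op_scale M c (op_id M) = fun_op M (\<lambda>f x. c * f x)"
    unfolding op_scale_def op_id_def fun_op_def
    by (rule restrict_ext) (simp add: l2_scale_def)
  also have "\<dots> \<in> bounded_ops M"
    by (rule fun_op_bounded[where C = "(cmod c)\<^sup>2"])
       (auto simp: l2_funs_cmult l2sq_cmult l2_funs_measurable distrib_left)
  finally show ?thesis .
qed

subsection \<open>Adjoints\<close>

lemma inner_op_cong:
  assumes "T \<in> bounded_ops M" "f \<in> l2_funs M" "g \<in> l2_funs M" "g' \<in> l2_funs M"
    and "AE x in M. op_fun M T g x = g' x"
  shows "inner_fun M f (op_fun M T g) = inner_fun M f g'"
  by (rule inner_fun_cong_AE) (auto simp: assms op_fun_in_l2_funs)

text \<open>Expand the squared norm of t f - g and divide by t. The free parameter serves to absorb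
  operator bounds: with t = C + 1 the last term is dominated when g is the image of a vector under
  an operator of squared bound C.\<close>

lemma inner_fun_young:
  assumes f: "f \<in> l2_funs M" and g: "g \<in> l2_funs M" and t: "0 < t"
  shows "2 * Re (inner_fun M f g) \<le> t * Re (inner_fun M f f) + Re (inner_fun M g g) / t"
proof -
  define d where "d = (\<lambda>x. complex_of_real t * f x + (-1) * g x)"
  have tf: "(\<lambda>x. complex_of_real t * f x) \<in> l2_funs M" "(\<lambda>x. (-1) * g x) \<in> l2_funs M"
    by (intro l2_funs_cmult f g)+
  have d: "d \<in> l2_funs M" unfolding d_def by (intro l2_funs_add tf)
  have "inner_fun M d d = t * (t * inner_fun M f f - inner_fun M f g) - (t * inner_fun M g f - inner_fun M g g)"
    using tf f g d unfolding d_def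
    by (simp only: inner_fun_add_left inner_fun_add_right inner_fun_scale_left inner_fun_scale_right l2_funs_add)
       (simp add: algebra_simps)
  then have "Re (inner_fun M d d) = t * (t * Re (inner_fun M f f) - Re (inner_fun M f g))
      - (t * Re (inner_fun M g f) - Re (inner_fun M g g))" by simp
  moreover have "Re (inner_fun M g f) = Re (inner_fun M f g)"
    using arg_cong[OF inner_fun_cnj[of M f g], of Re] by simp
  moreover have "0 \<le> Re (inner_fun M d d)" using inner_fun_self(1)[OF d] by simp
  ultimately have "0 \<le> t * (t * Re (inner_fun M f f)) - t * (2 * Re (inner_fun M f g)) + Re (inner_fun M g g)"
    by (simp only: right_diff_distrib)
  then show ?thesis using t by (simp add: field_simps)
qed

lemma Re_inner_commute: "Re (inner_fun M g f) = Re (inner_fun M f g)"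
  using arg_cong[OF inner_fun_cnj[of M f g], of Re] by simp

lemma Re_inner_self_nonneg: "f \<in> l2_funs M \<Longrightarrow> 0 \<le> Re (inner_fun M f f)"
  using inner_fun_self(1)[of f M] by simp

text \<open>Riesz representation of \<open>g \<mapsto> \<langle>f, T g\<rangle>\<close>: the representing vector minimises
  \<open>Q g = \<parallel>g\<parallel>\<^sup>2 - 2 Re \<langle>f, T g\<rangle>\<close>, and a minimising sequence is Cauchy by the parallelogram law.\<close>

lemma riesz_adjoint:
  assumes T: "T \<in> bounded_ops M" and f: "f \<in> l2_funs M"
  obtains h where "h \<in> l2_funs M" "\<And>g. g \<in> l2_funs M \<Longrightarrow> inner_fun M h g = inner_fun M f (op_fun M T g)"
proof -
  define ip where "ip = (\<lambda>a b. Re (inner_fun M a b))"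
  define B where "B = (\<lambda>g. Re (inner_fun M f (op_fun M T g)))"
  define Q where "Q = (\<lambda>g. ip g g - 2 * B g)"
  note in_l2 = l2_funs_add l2_funs_cmult op_fun_in_l2_funs[OF T]
  have ip_sym: "ip a b = ip b a" for a b unfolding ip_def by (rule Re_inner_commute)
  have ip_nonneg: "0 \<le> ip a a" if "a \<in> l2_funs M" for a
    unfolding ip_def using that by (rule Re_inner_self_nonneg)
  have ip_l2sq: "ennreal (ip a a) = l2sq M a" if "a \<in> l2_funs M" for a
    unfolding ip_def using inner_fun_self(2)[OF that] .
  have ip_add: "ip a (\<lambda>x. b x + c x) = ip a b + ip a c"
    if "a \<in> l2_funs M" "b \<in> l2_funs M" "c \<in> l2_funs M" for a b c
    unfolding ip_def by (simp add: inner_fun_add_right that)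
  have ip_add': "ip (\<lambda>x. b x + c x) a = ip b a + ip c a"
    if "a \<in> l2_funs M" "b \<in> l2_funs M" "c \<in> l2_funs M" for a b c
    unfolding ip_def by (simp add: inner_fun_add_left that)
  have ip_scale: "ip a (\<lambda>x. complex_of_real t * b x) = t * ip a b" for a b t
    unfolding ip_def by (simp add: inner_fun_scale_right)
  have ip_scale': "ip (\<lambda>x. complex_of_real t * b x) a = t * ip b a" for a b t
    unfolding ip_def by (simp add: inner_fun_scale_left)
  have young: "2 * ip a b \<le> ip a a + ip b b" if "a \<in> l2_funs M" "b \<in> l2_funs M" for a b
    unfolding ip_def using inner_fun_young[OF that, of 1] by simp
  have B_add: "B (\<lambda>x. a x + b x) = B a + B b" if a: "a \<in> l2_funs M" and b: "b \<in> l2_funs M" for a b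
  proof -
    have "inner_fun M f (op_fun M T (\<lambda>x. a x + b x))
        = inner_fun M f (\<lambda>x. op_fun M T a x + op_fun M T b x)"
      by (rule inner_op_cong[OF T f _ _ op_fun_add[OF T a b]]) (intro in_l2 a b)+
    then show ?thesis by (simp add: B_def inner_fun_add_right f a b in_l2)
  qed
  have inner_scale: "inner_fun M f (op_fun M T (\<lambda>x. c * a x)) = c * inner_fun M f (op_fun M T a)"
    if a: "a \<in> l2_funs M" for a c
    by (subst inner_op_cong[OF T f _ _ op_fun_scale[OF T a]])
       (auto intro!: in_l2 a simp: inner_fun_scale_right)
  have B_scale: "B (\<lambda>x. complex_of_real t * a x) = t * B a" if "a \<in> l2_funs M" for a t
    unfolding B_def by (simp add: inner_scale that)
  \<comment> \<open>Young's inequality with parameter C + 1 bounds the linear term by a constant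
    plus the squared norm of \<open>g\<close>; the added 1 keeps the parameter positive when C =
    0.\<close>
  have Q_below: "\<exists>K. \<forall>g\<in>l2_funs M. K \<le> Q g"
  proof -
    obtain C where C: "0 \<le> C" "\<And>g. g \<in> l2_funs M \<Longrightarrow> l2sq M (op_fun M T g) \<le> ennreal C * l2sq M g"
      using op_fun_bound[OF T] by blast
    have "- ((C + 1) * ip f f) \<le> Q g" if g: "g \<in> l2_funs M" for g
    proof -
      have "ennreal (ip (op_fun M T g) (op_fun M T g)) \<le> ennreal (C * ip g g)"
        using C(2)[OF g] C(1) by (simp add: ip_l2sq in_l2 g ennreal_mult ip_nonneg)
      then have le: "ip (op_fun M T g) (op_fun M T g) \<le> C * ip g g"
        using C(1) by (simp add: ip_nonneg g)
      have "2 * B g \<le> (C + 1) * ip f f + ip (op_fun M T g) (op_fun M T g) / (C + 1)"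
        unfolding B_def ip_def using C(1) by (intro inner_fun_young f in_l2 g) simp
      also have "ip (op_fun M T g) (op_fun M T g) / (C + 1) \<le> ip g g"
        using le C(1) ip_nonneg[OF g] by (simp add: divide_le_eq algebra_simps)
      finally show ?thesis by (simp add: Q_def)
    qed
    then show ?thesis by blast
  qed
  define I where "I = Inf (Q ` l2_funs M)"
  have ne: "l2_funs M \<noteq> {}" using f by blast
  have bdd: "bdd_below (Q ` l2_funs M)" using Q_below by (auto simp: bdd_below_def)
  have I_le: "I \<le> Q g" if "g \<in> l2_funs M" for g
    unfolding I_def using that bdd by (intro cInf_lower) auto
  have "\<exists>g\<in>l2_funs M. Q g < I + 1 / Suc n" for n
    using cInf_lessD[of "Q ` l2_funs M" "I + 1 / Suc n"] ne unfolding I_def by auto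
  then obtain F where F: "\<And>n. F n \<in> l2_funs M" "\<And>n. Q (F n) < I + 1 / Suc n" by metis
  \<comment> \<open>The squared norm of a - b is twice the sum of those of a and b, minus four times
    that of the midpoint \<open>?m\<close>. The linear parts cancel, and Q is at least I at the
    midpoint.\<close>
  have parallelogram: "ip (\<lambda>x. a x - b x) (\<lambda>x. a x - b x) \<le> 2 * (Q a - I) + 2 * (Q b - I)"
    if a: "a \<in> l2_funs M" and b: "b \<in> l2_funs M" for a b
  proof -
    let ?m = "\<lambda>x. complex_of_real (1/2) * (a x + b x)"
    have eq: "(\<lambda>x. a x - b x) = (\<lambda>x. a x + complex_of_real (-1) * b x)" by simp
    have "ip (\<lambda>x. a x - b x) (\<lambda>x. a x - b x) = ip a a - 2 * ip a b + ip b b"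
      using a b unfolding eq
      by (simp only: ip_add ip_add' ip_scale ip_scale' in_l2) (simp add: ip_sym[of b a])
    moreover have "4 * ip ?m ?m = ip a a + 2 * ip a b + ip b b"
      using a b by (simp only: ip_add ip_add' ip_scale ip_scale' in_l2) (simp add: ip_sym[of b a])
    moreover have "2 * B ?m = B a + B b"
      using a b by (simp only: B_scale B_add in_l2) simp
    moreover have "I \<le> Q ?m" by (intro I_le in_l2 a b)
    ultimately show ?thesis by (simp add: Q_def)
  qed
  have diff_le: "l2sq M (\<lambda>x. F m x - F n x) \<le> ennreal (2 / Suc m + 2 / Suc n)" for m n
  proof -
    have "l2sq M (\<lambda>x. F m x - F n x) = ennreal (ip (\<lambda>x. F m x - F n x) (\<lambda>x. F m x - F n x))"
      by (rule ip_l2sq[symmetric]) (intro l2_funs_diff F)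
    also have "\<dots> \<le> ennreal (2 / Suc m + 2 / Suc n)"
      using parallelogram[OF F(1) F(1), of m n] F(2)[of m] F(2)[of n] by (intro ennreal_leI) simp
    finally show ?thesis .
  qed
  obtain h where h: "h \<in> l2_funs M" "(\<lambda>n. l2sq M (\<lambda>x. F n x - h x)) \<longlonglongrightarrow> 0"
  proof (rule l2_complete[OF F(1)])
    fix e :: real assume e: "0 < e"
    obtain N :: nat where N: "4 / e < N" using reals_Archimedean2 by blast
    have small: "2 / Suc n \<le> e / 2" if "N \<le> n" for n
    proof -
      have "4 / e < Suc n" using N that by linarith
      then show ?thesis using e by (simp add: field_simps)
    qed
    have "l2sq M (\<lambda>x. F m x - F n x) \<le> ennreal e" if "N \<le> m" "N \<le> n" for m n
      using small[OF that(1)] small[OF that(2)]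
      by (intro order_trans[OF diff_le] ennreal_leI) simp
    then show "\<exists>N. \<forall>m\<ge>N. \<forall>n\<ge>N. l2sq M (\<lambda>x. F m x - F n x) \<le> ennreal e" by blast
  qed
  have Re_eq: "ip h g = B g" if g: "g \<in> l2_funs M" for g
  proof -
    define D where "D = ip h g - B g"
    \<comment> \<open>First variation at the limit \<open>h\<close>, obtained from the minimising
      sequence: Q at \<open>F n + t g\<close> is at least I. The cross term with
      \<open>F n - h\<close> is split by Young's inequality, which doubles the quadratic term in t
      and leaves an error \<open>e n\<close> tending to zero.\<close>
    have lower: "0 \<le> 2 * (t\<^sup>2 * ip g g) + 2 * (t * D)" for t :: real
    proof -
      let ?v = "\<lambda>x. complex_of_real t * g x"
      have v: "?v \<in> l2_funs M" by (intro in_l2 g)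
      define e where "e = (\<lambda>n. ip (\<lambda>x. F n x - h x) (\<lambda>x. F n x - h x))"
      have bound: "- 1 / Suc n - e n \<le> 2 * (t\<^sup>2 * ip g g) + 2 * (t * D)" for n
      proof -
        have d: "(\<lambda>x. F n x - h x) \<in> l2_funs M" by (intro l2_funs_diff F h)
        have "I \<le> Q (\<lambda>x. F n x + ?v x)" by (intro I_le in_l2 F v g)
        also have "\<dots> = Q (F n) + 2 * ip (F n) ?v + ip ?v ?v - 2 * B ?v"
          using F(1)[of n] v unfolding Q_def
          by (simp only: ip_add ip_add' B_add in_l2) (simp add: ip_sym[of ?v "F n"])
        also have "ip (F n) ?v = ip (\<lambda>x. F n x - h x) ?v + ip h ?v"
          using ip_add'[OF v d h(1)] by simp
        finally have "I \<le> Q (F n) + 2 * ip (\<lambda>x. F n x - h x) ?v + 2 * ip h ?v + ip ?v ?v - 2 * B ?v"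
          by simp
        moreover have "2 * ip (\<lambda>x. F n x - h x) ?v \<le> e n + ip ?v ?v"
          unfolding e_def by (rule young[OF d v])
        moreover have "ip ?v ?v = t\<^sup>2 * ip g g" "ip h ?v - B ?v = t * D"
          using g by (simp_all only: ip_scale ip_scale' B_scale D_def)
            (simp_all add: power2_eq_square right_diff_distrib)
        ultimately show ?thesis using F(2)[of n] by simp
      qed
      have "(\<lambda>n. ennreal (e n)) \<longlonglongrightarrow> ennreal 0"
        using h(2) unfolding e_def by (simp add: ip_l2sq l2_funs_diff F h)
      then have "e \<longlonglongrightarrow> 0"
        by (subst (asm) tendsto_ennreal_iff) (auto simp: e_def intro!: always_eventually ip_nonneg l2_funs_diff F h)
      then have "(\<lambda>n. - 1 / Suc n - e n) \<longlonglongrightarrow> 0 - 0"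
        by (intro tendsto_diff lim_const_over_n[THEN LIMSEQ_Suc])
      from LIMSEQ_le_const2[OF this] show ?thesis using bound by auto
    qed
    define s where "s = ip g g"
    have s: "0 \<le> s" unfolding s_def by (rule ip_nonneg[OF g])
    have "D = 0"
    proof (rule ccontr)
      assume D: "D \<noteq> 0"
      \<comment> \<open>A multiple of -D small enough for the linear term to beat the quadratic one.
        The summand 1 covers the case s = 0.\<close>
      define t where "t = - D / (2 * (s + 1))"
      have D_eq: "D = - 2 * (s + 1) * t" unfolding t_def using s by (simp add: field_simps)
      then have "t \<noteq> 0" using D by auto
      have "2 * (t\<^sup>2 * s) + 2 * (t * D) = - (t\<^sup>2 * (2 * s + 4))"
        by (simp add: D_eq algebra_simps power2_eq_square)
      also have "\<dots> < 0" using \<open>t \<noteq> 0\<close> s by (simp add: zero_less_mult_iff)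
      finally show False using lower[of t] unfolding s_def by linarith
    qed
    then show ?thesis by (simp add: D_def)
  qed
  have "inner_fun M h g = inner_fun M f (op_fun M T g)" if g: "g \<in> l2_funs M" for g
  proof (rule complex_eqI)
    show "Re (inner_fun M h g) = Re (inner_fun M f (op_fun M T g))"
      using Re_eq[OF g] by (simp add: ip_def B_def)
    \<comment> \<open>Real parts determine the form: replacing \<open>g\<close> by
      \<open>\<i> * g\<close> turns imaginary parts into real ones.\<close>
    have "ip h (\<lambda>x. \<i> * g x) = B (\<lambda>x. \<i> * g x)" by (intro Re_eq in_l2 g)
    then show "Im (inner_fun M h g) = Im (inner_fun M f (op_fun M T g))"
      by (simp add: ip_def B_def inner_fun_scale_right inner_scale[OF g])
  qed
  with h(1) show thesis by (rule that)
qed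

text \<open>The Riesz vectors \<open>H f\<close> are determined up to null sets by their inner
  products, and this uniqueness makes \<open>H\<close> linear almost everywhere.\<close>

lemma adjoint_exists:
  assumes T: "T \<in> bounded_ops M"
  obtains S where "S \<in> bounded_ops M"
    "\<And>f g. f \<in> l2_funs M \<Longrightarrow> g \<in> l2_funs M \<Longrightarrow>
      inner_fun M (op_fun M S f) g = inner_fun M f (op_fun M T g)"
proof -
  have "\<exists>h. f \<in> l2_funs M \<longrightarrow> h \<in> l2_funs M \<and>
      (\<forall>g\<in>l2_funs M. inner_fun M h g = inner_fun M f (op_fun M T g))" for f
    using riesz_adjoint[OF T] by metis
  then obtain H where H: "\<And>f. f \<in> l2_funs M \<Longrightarrow> H f \<in> l2_funs M"
    "\<And>f g. f \<in> l2_funs M \<Longrightarrow> g \<in> l2_funs M \<Longrightarrow> inner_fun M (H f) g = inner_fun M f (op_fun M T g)"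
    by metis
  obtain C where C: "0 \<le> C" "\<And>g. g \<in> l2_funs M \<Longrightarrow> l2sq M (op_fun M T g) \<le> ennreal C * l2sq M g"
    using op_fun_bound[OF T] by blast
  note in_l2 = l2_funs_add l2_funs_cmult op_fun_in_l2_funs[OF T] H(1)
  have cong: "AE x in M. H f x = H g x"
    if f: "f \<in> l2_funs M" and g: "g \<in> l2_funs M" and ae: "AE x in M. f x = g x" for f g
  proof (rule inner_fun_eqI)
    fix h assume h: "h \<in> l2_funs M"
    show "inner_fun M (H f) h = inner_fun M (H g) h"
      unfolding H(2)[OF f h] H(2)[OF g h] by (rule inner_fun_cong_AE) (auto intro: in_l2 f g h ae)
  qed (intro in_l2 f g)+
  have bounded: "fun_op M H \<in> bounded_ops M"
  proof (rule fun_op_bounded[where C = "C + 1"])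
    fix f g assume f: "f \<in> l2_funs M" and g: "g \<in> l2_funs M"
    show "AE x in M. H f x = H g x" if "AE x in M. f x = g x" using f g that by (rule cong)
    show "AE x in M. H (\<lambda>x. f x + g x) x = H f x + H g x"
      by (rule inner_fun_eqI) (auto intro!: in_l2 f g simp: H(2) in_l2 inner_fun_add_left f g)
  next
    fix c f assume f: "f \<in> l2_funs M"
    show "AE x in M. H (\<lambda>x. c * f x) x = c * H f x"
      by (rule inner_fun_eqI) (auto intro!: in_l2 f simp: H(2) in_l2 inner_fun_scale_left f)
  next
    fix f assume f: "f \<in> l2_funs M"
    \<comment> \<open>The squared norm n of H f equals the inner product of f with v = T (H f).
      Young's inequality with parameter C + 1 gives 2 n at most (C + 1) times the squared norm of f,
      plus n, and one n is cancelled.\<close>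
    define n where "n = Re (inner_fun M (H f) (H f))"
    define v where "v = op_fun M T (H f)"
    have v: "v \<in> l2_funs M" unfolding v_def by (intro in_l2 f)
    have n: "0 \<le> n" unfolding n_def by (intro Re_inner_self_nonneg in_l2 f)
    have "ennreal (Re (inner_fun M v v)) \<le> ennreal (C * n)"
      using C(2)[of "H f"] C(1) n unfolding v_def n_def
      by (simp add: inner_fun_self(2) in_l2 f ennreal_mult)
    then have le: "Re (inner_fun M v v) \<le> C * n" using C(1) n by simp
    have "2 * n = 2 * Re (inner_fun M f v)" by (simp add: n_def v_def H(2) f in_l2)
    also have "\<dots> \<le> (C + 1) * Re (inner_fun M f f) + Re (inner_fun M v v) / (C + 1)"
      using C(1) by (intro inner_fun_young f v) simp
    also have "Re (inner_fun M v v) / (C + 1) \<le> n"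
      using le C(1) n by (simp add: divide_le_eq algebra_simps)
    finally have "ennreal n \<le> ennreal ((C + 1) * Re (inner_fun M f f))"
      by (intro ennreal_leI) simp
    then show "l2sq M (H f) \<le> ennreal (C + 1) * l2sq M f"
      using C(1) by (simp add: n_def inner_fun_self(2) in_l2 f ennreal_mult Re_inner_self_nonneg)
  qed (use C in \<open>auto intro: H\<close>)
  show thesis
  proof (rule that[OF bounded])
    fix f g assume f: "f \<in> l2_funs M" and g: "g \<in> l2_funs M"
    have "fun_op M H (l2_class M f) = l2_class M (H f)"
      by (rule fun_op_class) (simp_all add: H cong f)
    then have ae: "AE x in M. op_fun M (fun_op M H) f x = H f x"
      by (intro op_fun_eqI in_l2 f)
    show "inner_fun M (op_fun M (fun_op M H) f) g = inner_fun M f (op_fun M T g)"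
      unfolding H(2)[OF f g, symmetric]
      by (rule inner_fun_cong_AE) (auto intro!: in_l2 f g ae op_fun_in_l2_funs[OF bounded])
  qed
qed

lemma l2_inner_op:
  assumes "S \<in> bounded_ops M" "T \<in> bounded_ops M" "f \<in> l2_funs M" "g \<in> l2_funs M"
  shows "l2_inner M (S (l2_class M f)) (l2_class M g) = inner_fun M (op_fun M S f) g"
    and "l2_inner M (l2_class M f) (T (l2_class M g)) = inner_fun M f (op_fun M T g)"
  unfolding class_op_fun[OF assms(1,3), symmetric] class_op_fun[OF assms(2,4), symmetric]
  by (intro l2_inner_class op_fun_in_l2_funs assms)+

text \<open>Resolves the definite description: two operators satisfying the adjoint relation have
  the same inner products with every vector.\<close>

lemma op_adjoint_eqI:
  assumes S: "S \<in> bounded_ops M" and T: "T \<in> bounded_ops M"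
    and eq: "\<And>f g. f \<in> l2_funs M \<Longrightarrow> g \<in> l2_funs M \<Longrightarrow>
      inner_fun M (op_fun M S f) g = inner_fun M f (op_fun M T g)"
  shows "op_adjoint M T = S"
  unfolding op_adjoint_def
proof (rule the_equality)
  show "S \<in> bounded_ops M \<and> (\<forall>u\<in>L2 M. \<forall>v\<in>L2 M. l2_inner M (S u) v = l2_inner M u (T v))"
  proof (intro conjI S ballI)
    fix u v assume "u \<in> L2 M" "v \<in> L2 M"
    then show "l2_inner M (S u) v = l2_inner M u (T v)"
      by (elim L2E) (simp add: l2_inner_op[OF S T] eq)
  qed
next
  fix R assume R: "R \<in> bounded_ops M \<and> (\<forall>u\<in>L2 M. \<forall>v\<in>L2 M. l2_inner M (R u) v = l2_inner M u (T v))"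
  then have Rb: "R \<in> bounded_ops M" ..
  show "R = S"
  proof (rule bounded_ops_eqI[OF Rb S])
    fix f assume f: "f \<in> l2_funs M"
    have "AE x in M. op_fun M R f x = op_fun M S f x"
    proof (rule inner_fun_eqI)
      fix g assume g: "g \<in> l2_funs M"
      have "l2_inner M (R (l2_class M f)) (l2_class M g) = l2_inner M (l2_class M f) (T (l2_class M g))"
        using R f g by (simp add: l2_class_in_L2)
      then show "inner_fun M (op_fun M R f) g = inner_fun M (op_fun M S f) g"
        by (simp add: l2_inner_op[OF Rb T f g] eq[OF f g])
    qed (intro op_fun_in_l2_funs Rb S f)+
    then have "l2_class M (op_fun M R f) = l2_class M (op_fun M S f)"
      by (subst l2_class_eq_iff) (intro op_fun_in_l2_funs Rb f)
    then show "R (l2_class M f) = S (l2_class M f)" by (simp add: class_op_fun Rb S f)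
  qed
qed

lemma op_adjoint:
  assumes T: "T \<in> bounded_ops M"
  shows "op_adjoint M T \<in> bounded_ops M"
    and "\<And>f g. f \<in> l2_funs M \<Longrightarrow> g \<in> l2_funs M \<Longrightarrow>
      inner_fun M (op_fun M (op_adjoint M T) f) g = inner_fun M f (op_fun M T g)"
  using adjoint_exists[OF T] op_adjoint_eqI[OF _ T] by metis+

section \<open>Square integrable functions on products\<close>

lemma l2sq_dominated:
  assumes [measurable]: "\<And>n. F n \<in> borel_measurable M" "f \<in> borel_measurable M"
    and g: "g \<in> l2_funs M"
    and bound: "\<And>n. AE x in M. cmod (F n x - f x) \<le> cmod (g x)"
    and lim: "AE x in M. (\<lambda>n. F n x) \<longlonglongrightarrow> f x"
  shows "(\<lambda>n. l2sq M (\<lambda>x. F n x - f x)) \<longlonglongrightarrow> 0"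
proof -
  have [measurable]: "g \<in> borel_measurable M" using g by (rule l2_funs_measurable)
  have "(\<lambda>n. \<integral>\<^sup>+x. ennreal ((cmod (F n x - f x))\<^sup>2) \<partial>M) \<longlonglongrightarrow> (\<integral>\<^sup>+x. 0 \<partial>M)"
  proof (rule nn_integral_dominated_convergence[where w = "\<lambda>x. ennreal ((cmod (g x))\<^sup>2)"])
    show "AE x in M. ennreal ((cmod (F n x - f x))\<^sup>2) \<le> ennreal ((cmod (g x))\<^sup>2)" for n
      using bound[of n] by eventually_elim (auto intro!: ennreal_leI power_mono)
    show "(\<integral>\<^sup>+x. ennreal ((cmod (g x))\<^sup>2) \<partial>M) < \<infinity>"
      using l2sq_finite[OF g] by (simp add: l2sq_def)
    show "AE x in M. (\<lambda>n. ennreal ((cmod (F n x - f x))\<^sup>2)) \<longlonglongrightarrow> 0"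
      using lim
    proof eventually_elim
      case (elim x)
      then have "(\<lambda>n. ennreal ((cmod (F n x - f x))\<^sup>2)) \<longlonglongrightarrow> ennreal ((cmod (f x - f x))\<^sup>2)"
        by (intro tendsto_intros)
      then show ?case by simp
    qed
  qed auto
  then show ?thesis by (simp add: l2sq_def)
qed

lemma l2_sum_closed:
  assumes "finite S" and "P (\<lambda>x. 0)"
    and "\<And>f g. f \<in> l2_funs M \<Longrightarrow> g \<in> l2_funs M \<Longrightarrow> P f \<Longrightarrow> P g \<Longrightarrow> P (\<lambda>x. f x + g x)"
    and "\<And>s. s \<in> S \<Longrightarrow> G s \<in> l2_funs M \<and> P (G s)"
  shows "(\<lambda>x. \<Sum>s\<in>S. G s x) \<in> l2_funs M \<and> P (\<lambda>x. \<Sum>s\<in>S. G s x)"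
  using assms(1,4)
  by (induction S rule: finite_induct) (simp_all add: assms(2,3) l2_funs_add l2_funs_zero)

section \<open>Sections and product functions, by Tonelli\<close>

context pair_sigma_finite
begin

lemma l2sq_pair:
  assumes [measurable]: "f \<in> borel_measurable (M1 \<Otimes>\<^sub>M M2)"
  shows "l2sq (M1 \<Otimes>\<^sub>M M2) f = (\<integral>\<^sup>+x. l2sq M2 (\<lambda>y. f (x, y)) \<partial>M1)"
  unfolding l2sq_def by (subst M2.nn_integral_fst[symmetric]) auto

lemma measurable_l2sq_section [measurable]:
  assumes [measurable]: "f \<in> borel_measurable (M1 \<Otimes>\<^sub>M M2)"
  shows "(\<lambda>x. l2sq M2 (\<lambda>y. f (x, y))) \<in> borel_measurable M1"
  unfolding l2sq_def by (rule M2.borel_measurable_nn_integral_fst) simp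

lemma AE_section_l2:
  assumes f: "f \<in> l2_funs (M1 \<Otimes>\<^sub>M M2)"
  shows "AE x in M1. (\<lambda>y. f (x, y)) \<in> l2_funs M2"
proof -
  have [measurable]: "f \<in> borel_measurable (M1 \<Otimes>\<^sub>M M2)" using f by (rule l2_funs_measurable)
  have "(\<integral>\<^sup>+x. l2sq M2 (\<lambda>y. f (x, y)) \<partial>M1) \<noteq> \<infinity>"
    using l2sq_finite[OF f] by (simp add: l2sq_pair)
  then have "AE x in M1. l2sq M2 (\<lambda>y. f (x, y)) \<noteq> \<infinity>"
    by (intro nn_integral_PInf_AE) auto
  then show ?thesis
    by (rule AE_mp) (auto intro!: AE_I2 simp: l2_funs_iff less_top)
qed

lemma l2_product:
  assumes u: "u \<in> l2_funs M1" and v: "v \<in> l2_funs M2"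
  shows "(\<lambda>(x, y). u x * v y) \<in> l2_funs (M1 \<Otimes>\<^sub>M M2)"
proof -
  have [measurable]: "u \<in> borel_measurable M1" "v \<in> borel_measurable M2"
    using u v by (auto dest: l2_funs_measurable)
  have "l2sq (M1 \<Otimes>\<^sub>M M2) (\<lambda>(x, y). u x * v y) = (\<integral>\<^sup>+x. ennreal ((cmod (u x))\<^sup>2) * l2sq M2 v \<partial>M1)"
    by (subst l2sq_pair) (auto simp: l2sq_cmult)
  also have "\<dots> = l2sq M1 u * l2sq M2 v"
    unfolding l2sq_def[of M1] by (rule nn_integral_multc) simp
  also have "\<dots> < \<infinity>" using u v by (simp add: l2_funs_iff ennreal_mult_less_top)
  finally show ?thesis by (simp add: l2_funs_iff)
qed

lemma l2_product_cong:
  assumes u: "u \<in> l2_funs M1" "u' \<in> l2_funs M1" and v: "v \<in> l2_funs M2" "v' \<in> l2_funs M2"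
    and "AE x in M1. u x = u' x" "AE y in M2. v y = v' y"
  shows "AE p in M1 \<Otimes>\<^sub>M M2. (\<lambda>(x, y). u x * v y) p = (\<lambda>(x, y). u' x * v' y) p"
proof -
  have [measurable]: "u \<in> borel_measurable M1" "v \<in> borel_measurable M2"
     "u' \<in> borel_measurable M1" "v' \<in> borel_measurable M2"
    using u v by (auto dest: l2_funs_measurable)
  show ?thesis
  proof (rule AE_pair_measure)
    show "AE x in M1. AE y in M2. (\<lambda>(x, y). u x * v y) (x, y) = (\<lambda>(x, y). u' x * v' y) (x, y)"
      using assms(5)
    proof eventually_elim
      case (elim x)
      show ?case using assms(6) by eventually_elim (simp add: elim)
    qed
  qed measurable
qed

lemma l2_tensor_class:
  assumes u: "u \<in> l2_funs M1" and v: "v \<in> l2_funs M2"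
  shows "l2_tensor M1 M2 (l2_class M1 u) (l2_class M2 v) = l2_class (M1 \<Otimes>\<^sub>M M2) (\<lambda>(x, y). u x * v y)"
  unfolding l2_tensor_def
  by (subst l2_class_eq_iff) (intro l2_product l2_product_cong l2_rep_class u v)+

text \<open>It suffices to treat indicators of sets \<open>E\<close> inside a box of finite measure; these form a
  Dynkin system.\<close>

lemma l2_pair_induct [consumes 1, case_names rectangle add scale lim]:
  assumes f: "f \<in> l2_funs (M1 \<Otimes>\<^sub>M M2)"
    and rectangle: "\<And>X Y. X \<in> sets M1 \<Longrightarrow> Y \<in> sets M2 \<Longrightarrow> emeasure M1 X < \<infinity> \<Longrightarrow> emeasure M2 Y < \<infinity> \<Longrightarrow>
        P (indicator (X \<times> Y))"
    and add: "\<And>f g. f \<in> l2_funs (M1 \<Otimes>\<^sub>M M2) \<Longrightarrow> g \<in> l2_funs (M1 \<Otimes>\<^sub>M M2) \<Longrightarrow> P f \<Longrightarrow> P g \<Longrightarrow>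
        P (\<lambda>x. f x + g x)"
    and scale: "\<And>c f. f \<in> l2_funs (M1 \<Otimes>\<^sub>M M2) \<Longrightarrow> P f \<Longrightarrow> P (\<lambda>x. c * f x)"
    and lim: "\<And>F f. (\<And>n::nat. F n \<in> l2_funs (M1 \<Otimes>\<^sub>M M2)) \<Longrightarrow> (\<And>n. P (F n)) \<Longrightarrow>
        f \<in> l2_funs (M1 \<Otimes>\<^sub>M M2) \<Longrightarrow>
        (\<lambda>n. l2sq (M1 \<Otimes>\<^sub>M M2) (\<lambda>x. F n x - f x)) \<longlonglongrightarrow> 0 \<Longrightarrow> P f"
  shows "P f"
proof -
  let ?M = "M1 \<Otimes>\<^sub>M M2"
  obtain A1 where A1: "range A1 \<subseteq> sets M1" "(\<Union>i. A1 i) = space M1" "\<And>i. emeasure M1 (A1 i) \<noteq> \<infinity>" "incseq A1"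
    using M1.sigma_finite_incseq by blast
  obtain A2 where A2: "range A2 \<subseteq> sets M2" "(\<Union>i. A2 i) = space M2" "\<And>i. emeasure M2 (A2 i) \<noteq> \<infinity>" "incseq A2"
    using M2.sigma_finite_incseq by blast
  define K where "K = (\<lambda>i. A1 i \<times> A2 i)"
  have A1s: "A1 i \<in> sets M1" and A2s: "A2 i \<in> sets M2" for i using A1 A2 by auto
  have K [measurable]: "K i \<in> sets ?M" for i unfolding K_def using A1s A2s by simp
  have K_fin: "emeasure ?M (K i) < \<infinity>" for i
    unfolding K_def using A1(3) A2(3) A1s A2s
    by (simp add: M2.emeasure_pair_measure_Times ennreal_mult_less_top less_top)
  have ind_l2: "indicator (E \<inter> K i) \<in> l2_funs ?M" if "E \<in> sets ?M" for E i
    using that le_less_trans[OF emeasure_mono[of "E \<inter> K i" "K i" ?M] K_fin]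
    by (intro l2_funs_indicator) auto
  have P0: "P (\<lambda>x. 0)"
    using scale[OF _ rectangle[of "{}" "{}"], of 0] l2_funs_indicator[of "{}" ?M] by simp
  have P_ind: "P (indicator (E \<inter> K i))" if E: "E \<in> sets ?M" for E i
  proof -
    have "E \<in> sigma_sets (space M1 \<times> space M2) {a \<times> b | a b. a \<in> sets M1 \<and> b \<in> sets M2}"
      using E by (simp add: sets_pair_measure)
    from Int_stable_pair_measure_generator pair_measure_closed this
    show ?thesis
    proof (induction rule: sigma_sets_induct_disjoint)
      case (basic X)
      then obtain a b where ab: "X = a \<times> b" "a \<in> sets M1" "b \<in> sets M2" by auto
      have "X \<inter> K i = (a \<inter> A1 i) \<times> (b \<inter> A2 i)" by (auto simp: ab K_def)
      moreover have "emeasure M1 (a \<inter> A1 i) < \<infinity>" "emeasure M2 (b \<inter> A2 i) < \<infinity>"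
        using A1(3)[of i] A2(3)[of i] A1s[of i] A2s[of i] ab
          emeasure_mono[of "a \<inter> A1 i" "A1 i" M1] emeasure_mono[of "b \<inter> A2 i" "A2 i" M2]
        by (auto simp: less_top[symmetric] top_unique)
      ultimately show ?case using rectangle[of "a \<inter> A1 i" "b \<inter> A2 i"] ab A1s A2s by simp
    next
      case empty
      then show ?case using P0 by (simp add: indicator_def)
    next
      case (compl E)
      then have E: "E \<in> sets ?M" by (simp add: sets_pair_measure)
      have "indicator ((space M1 \<times> space M2 - E) \<inter> K i)
          = (\<lambda>x. indicator (space ?M \<inter> K i) x + (-1) * indicator (E \<inter> K i) x :: complex)"
        using sets.sets_into_space[OF K, of i]
        by (auto simp: fun_eq_iff space_pair_measure split: split_indicator)
      moreover have "P (indicator (space ?M \<inter> K i))"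
      proof -
        have "space ?M \<inter> K i = A1 i \<times> A2 i"
          using sets.sets_into_space[OF K, of i] by (auto simp: K_def)
        then show ?thesis using rectangle[of "A1 i" "A2 i"] A1s A2s A1(3) A2(3) by (simp add: less_top)
      qed
      moreover have "P (\<lambda>x. (-1) * indicator (E \<inter> K i) x)"
        by (intro scale ind_l2 E compl)
      moreover have "(\<lambda>x. (-1) * indicator (E \<inter> K i) x) \<in> l2_funs ?M"
        by (intro l2_funs_cmult ind_l2 E)
      moreover have "indicator (space ?M \<inter> K i) \<in> l2_funs ?M"
        by (intro ind_l2) simp
      ultimately show ?case using add by presburger
    next
      case (union D)
      then have D: "D n \<in> sets ?M" for n by (auto simp: sets_pair_measure)
      define F where "F = (\<lambda>m x. \<Sum>n<m. indicator (D n \<inter> K i) x :: complex)"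
      have F: "F m \<in> l2_funs ?M \<and> P (F m)" for m
        unfolding F_def using union ind_l2[OF D] by (intro l2_sum_closed[where P = P] P0 add) auto
      have F_eq: "F m x = indicator ((\<Union>n<m. D n) \<inter> K i) x" for m x
      proof -
        have "disjoint_family_on D {..<m}"
          using union(1) by (rule disjoint_family_on_mono[rotated]) simp
        then have "(\<Sum>n<m. indicator (D n) x :: complex) = indicator (\<Union>n<m. D n) x"
          by (subst indicator_UN_disjoint) auto
        then show ?thesis
          unfolding F_def by (simp add: indicator_inter_arith sum_distrib_right[symmetric])
      qed
      have UD: "(\<Union>n. D n) \<in> sets ?M" using D by auto
      show ?case
      proof (rule lim)
        show "F n \<in> l2_funs ?M" "P (F n)" for n using F by auto
        show "indicator (\<Union> (range D) \<inter> K i) \<in> l2_funs ?M" by (intro ind_l2 UD)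
        show "(\<lambda>n. l2sq ?M (\<lambda>x. F n x - indicator (\<Union> (range D) \<inter> K i) x)) \<longlonglongrightarrow> 0"
        proof (rule l2sq_dominated)
          show "indicator (K i) \<in> l2_funs ?M" by (intro l2_funs_indicator K K_fin)
          show "AE x in ?M. cmod (F n x - indicator (\<Union> (range D) \<inter> K i) x) \<le> cmod (indicator (K i) x)" for n
            by (auto simp: F_eq split: split_indicator)
          show "AE x in ?M. (\<lambda>n. F n x) \<longlonglongrightarrow> indicator (\<Union> (range D) \<inter> K i) x"
          proof (intro AE_I2)
            fix x
            show "(\<lambda>n. F n x) \<longlonglongrightarrow> indicator (\<Union> (range D) \<inter> K i) x"
            proof (cases "x \<in> \<Union> (range D) \<inter> K i")
              case True
              then obtain m where "x \<in> D m" "x \<in> K i" by auto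
              then have "eventually (\<lambda>n. F n x = 1) sequentially"
                by (intro eventually_sequentiallyI[of "Suc m"]) (auto simp: F_eq indicator_def)
              then show ?thesis using True by (simp add: tendsto_eventually)
            next
              case False
              then have "F n x = 0" for n by (auto simp: F_eq indicator_def)
              then show ?thesis using False by simp
            qed
          qed
        qed (use F UD in \<open>auto dest!: l2_funs_measurable\<close>)
      qed
    qed
  qed
  have fm [measurable]: "f \<in> borel_measurable ?M" using f by (rule l2_funs_measurable)
  obtain s where s: "\<And>i. simple_function ?M (s i)" "\<And>x. x \<in> space ?M \<Longrightarrow> (\<lambda>i. s i x) \<longlonglongrightarrow> f x"
    "\<And>i x. x \<in> space ?M \<Longrightarrow> cmod (s i x) \<le> 2 * cmod (f x)"
    using borel_measurable_implies_sequence_metric[OF fm, of 0] by simp metis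
  have [measurable]: "s i \<in> borel_measurable ?M" for i
    using s(1) by (rule borel_measurable_simple_function)
  \<comment> \<open>Cutting the simple functions off to the boxes gives every level set, that of 0
    included, finite measure, so each term is a scalar multiple of an indicator already
    treated.\<close>
  define G where "G = (\<lambda>i x. \<Sum>c\<in>s i ` space ?M. c * indicator ((s i -` {c} \<inter> space ?M) \<inter> K i) x)"
  have level: "s i -` {c} \<inter> space ?M \<in> sets ?M" for i c
    using s(1) by (rule simple_functionD)
  have G: "G i \<in> l2_funs ?M \<and> P (G i)" for i
    unfolding G_def using simple_functionD(1)[OF s(1)]
    by (intro l2_sum_closed[where P = P] P0 add conjI l2_funs_cmult scale ind_l2 P_ind level)
  have G_eq: "G i x = s i x * indicator (K i) x" if x: "x \<in> space ?M" for i x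
  proof -
    have "G i x = (\<Sum>c\<in>s i ` space ?M. if c = s i x then s i x * indicator (K i) x else 0)"
      unfolding G_def using x by (intro sum.cong) (auto split: split_indicator)
    also have "\<dots> = s i x * indicator (K i) x"
      using x simple_functionD(1)[OF s(1)] by (simp add: sum.delta)
    finally show ?thesis .
  qed
  show ?thesis
  proof (rule lim)
    show "G n \<in> l2_funs ?M" "P (G n)" for n using G by auto
    show "(\<lambda>n. l2sq ?M (\<lambda>x. G n x - f x)) \<longlonglongrightarrow> 0"
    proof (rule l2sq_dominated)
      \<comment> \<open>The approximants are bounded by 2|f|, so their distance to f is at most
        3|f|.\<close>
      show "(\<lambda>x. 3 * f x) \<in> l2_funs ?M" by (intro l2_funs_cmult f)
      show "AE x in ?M. cmod (G n x - f x) \<le> cmod (3 * f x)" for n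
      proof (intro AE_I2)
        fix x assume x: "x \<in> space ?M"
        have "cmod (G n x - f x) \<le> cmod (G n x) + cmod (f x)" by (rule norm_triangle_ineq4)
        also have "cmod (G n x) \<le> cmod (s n x)" by (simp add: G_eq x split: split_indicator)
        also have "\<dots> \<le> 2 * cmod (f x)" by (rule s(3)[OF x])
        finally show "cmod (G n x - f x) \<le> cmod (3 * f x)" by (simp add: norm_mult)
      qed
      show "AE x in ?M. (\<lambda>n. G n x) \<longlonglongrightarrow> f x"
      proof (intro AE_I2)
        fix x assume x: "x \<in> space ?M"
        obtain a b where ab: "x = (a, b)" "a \<in> space M1" "b \<in> space M2"
          using x by (auto simp: space_pair_measure)
        then obtain m n where "a \<in> A1 m" "b \<in> A2 n" using A1(2) A2(2) by blast
        then have "x \<in> K k" if "max m n \<le> k" for k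
          using that incseqD[OF A1(4), of m k] incseqD[OF A2(4), of n k] by (auto simp: K_def ab)
        then have "eventually (\<lambda>k. s k x = G k x) sequentially"
          by (intro eventually_sequentiallyI[of "max m n"]) (simp add: G_eq[OF x])
        then show "(\<lambda>n. G n x) \<longlonglongrightarrow> f x" using s(2)[OF x] by (rule Lim_transform_eventually[rotated])
      qed
    qed (use G in \<open>auto dest: l2_funs_measurable\<close>)
  qed fact
qed

end

section \<open>Amplifications of operators\<close>

text \<open>This expresses that \<open>\<zeta>\<close> is the image of \<open>\<xi>\<close> under 1
  tensor \<open>S\<close>. It is a relation because \<open>op_fun\<close> picks a representative
  separately on each fibre, and these choices need not fit together to a jointly measurable
  function; \<open>\<zeta>\<close> is a measurable version, whose existence has to be
  proved.\<close>

definition fibrewise :: "'a measure \<Rightarrow> 'b measure \<Rightarrow> 'b l2_op \<Rightarrow>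
    ('a \<times> 'b \<Rightarrow> complex) \<Rightarrow> ('a \<times> 'b \<Rightarrow> complex) \<Rightarrow> bool" where
  "fibrewise M N S \<xi> \<zeta> \<longleftrightarrow> (AE y in M. (\<lambda>x. \<xi> (y, x)) \<in> l2_funs N \<and>
     (AE x in N. op_fun N S (\<lambda>x. \<xi> (y, x)) x = \<zeta> (y, x)))"

lemma op_id_class: "f \<in> l2_funs M \<Longrightarrow> op_id M (l2_class M f) = l2_class M f"
  by (simp add: op_id_def l2_class_in_L2)

context pair_sigma_finite
begin

lemma fibrewise_product:
  assumes S: "S \<in> bounded_ops M2" and v: "v \<in> l2_funs M2" and w: "w \<in> l2_funs M2"
    and ae: "AE x in M2. op_fun M2 S v x = w x"
  shows "fibrewise M1 M2 S (\<lambda>(y, x). u y * v x) (\<lambda>(y, x). u y * w x)"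
  unfolding fibrewise_def
proof (rule AE_I2, rule conjI)
  fix y
  show "(\<lambda>x. (\<lambda>(y, x). u y * v x) (y, x)) \<in> l2_funs M2" using l2_funs_cmult[OF v] by simp
  have "AE x in M2. op_fun M2 S (\<lambda>x. u y * v x) x = u y * w x"
    using op_fun_scale[OF S v, of "u y"] ae by eventually_elim simp
  then show "AE x in M2. op_fun M2 S (\<lambda>x. (\<lambda>(y, x). u y * v x) (y, x)) x = (\<lambda>(y, x). u y * w x) (y, x)"
    by simp
qed

lemma fibrewise_add:
  assumes S: "S \<in> bounded_ops M2" and "fibrewise M1 M2 S \<xi> \<zeta>" "fibrewise M1 M2 S \<xi>' \<zeta>'"
  shows "fibrewise M1 M2 S (\<lambda>p. \<xi> p + \<xi>' p) (\<lambda>p. \<zeta> p + \<zeta>' p)"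
  using assms(2,3) unfolding fibrewise_def
proof eventually_elim
  case (elim y)
  then have \<xi>: "(\<lambda>x. \<xi> (y, x)) \<in> l2_funs M2" "(\<lambda>x. \<xi>' (y, x)) \<in> l2_funs M2"
    and ae: "AE x in M2. op_fun M2 S (\<lambda>x. \<xi> (y, x)) x = \<zeta> (y, x)"
      "AE x in M2. op_fun M2 S (\<lambda>x. \<xi>' (y, x)) x = \<zeta>' (y, x)" by auto
  show ?case using op_fun_add[OF S \<xi>] ae by (auto intro: l2_funs_add \<xi>)
qed

lemma fibrewise_scale:
  assumes S: "S \<in> bounded_ops M2" and "fibrewise M1 M2 S \<xi> \<zeta>"
  shows "fibrewise M1 M2 S (\<lambda>p. c * \<xi> p) (\<lambda>p. c * \<zeta> p)"
  using assms(2) unfolding fibrewise_def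
proof eventually_elim
  case (elim y)
  then have \<xi>: "(\<lambda>x. \<xi> (y, x)) \<in> l2_funs M2"
    and ae: "AE x in M2. op_fun M2 S (\<lambda>x. \<xi> (y, x)) x = \<zeta> (y, x)" by auto
  show ?case using op_fun_scale[OF S \<xi>, of c] ae by (auto intro: l2_funs_cmult \<xi>)
qed

lemma fibrewise_diff:
  assumes S: "S \<in> bounded_ops M2" and "fibrewise M1 M2 S \<xi> \<zeta>" "fibrewise M1 M2 S \<xi>' \<zeta>'"
  shows "fibrewise M1 M2 S (\<lambda>p. \<xi> p - \<xi>' p) (\<lambda>p. \<zeta> p - \<zeta>' p)"
  using fibrewise_add[OF S assms(2) fibrewise_scale[OF S assms(3), of "-1"]] by simp

text \<open>The bound for \<open>S\<close> holds on almost every fibre with the same constant, so it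
  can be integrated over the first variable.\<close>

lemma fibrewise_bound:
  assumes C: "\<And>f. f \<in> l2_funs M2 \<Longrightarrow> l2sq M2 (op_fun M2 S f) \<le> ennreal C * l2sq M2 f"
    and fib: "fibrewise M1 M2 S \<xi> \<zeta>"
    and [measurable]: "\<xi> \<in> borel_measurable (M1 \<Otimes>\<^sub>M M2)" "\<zeta> \<in> borel_measurable (M1 \<Otimes>\<^sub>M M2)"
  shows "l2sq (M1 \<Otimes>\<^sub>M M2) \<zeta> \<le> ennreal C * l2sq (M1 \<Otimes>\<^sub>M M2) \<xi>"
proof -
  have "(\<integral>\<^sup>+y. l2sq M2 (\<lambda>x. \<zeta> (y, x)) \<partial>M1) \<le> (\<integral>\<^sup>+y. ennreal C * l2sq M2 (\<lambda>x. \<xi> (y, x)) \<partial>M1)"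
    using fib unfolding fibrewise_def
  proof (intro nn_integral_mono_AE, eventually_elim)
    case (elim y)
    then have "l2sq M2 (\<lambda>x. \<zeta> (y, x)) = l2sq M2 (op_fun M2 S (\<lambda>x. \<xi> (y, x)))"
      by (intro l2sq_cong_AE) (auto elim: eventually_mono)
    also have "\<dots> \<le> ennreal C * l2sq M2 (\<lambda>x. \<xi> (y, x))" using elim by (intro C) simp
    finally show ?case .
  qed
  then show ?thesis by (simp add: l2sq_pair nn_integral_cmult)
qed

lemma fibrewise_cong_AE:
  assumes [measurable]: "\<xi> \<in> borel_measurable (M1 \<Otimes>\<^sub>M M2)" "\<xi>' \<in> borel_measurable (M1 \<Otimes>\<^sub>M M2)"
      "\<zeta> \<in> borel_measurable (M1 \<Otimes>\<^sub>M M2)" "\<zeta>' \<in> borel_measurable (M1 \<Otimes>\<^sub>M M2)"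
    and \<xi>: "AE p in M1 \<Otimes>\<^sub>M M2. \<xi> p = \<xi>' p" and \<zeta>: "AE p in M1 \<Otimes>\<^sub>M M2. \<zeta> p = \<zeta>' p"
    and fib: "fibrewise M1 M2 S \<xi> \<zeta>"
  shows "fibrewise M1 M2 S \<xi>' \<zeta>'"
  using fib AE_pair[OF \<xi>] AE_pair[OF \<zeta>] AE_space unfolding fibrewise_def
proof eventually_elim
  case (elim y)
  have l2: "(\<lambda>x. \<xi>' (y, x)) \<in> l2_funs M2"
    using conjunct1[OF elim(1)] measurable_Pair2[OF assms(2) elim(4)] elim(2)
    by (rule l2_funs_cong_AE)
  have "op_fun M2 S (\<lambda>x. \<xi> (y, x)) = op_fun M2 S (\<lambda>x. \<xi>' (y, x))"
    using conjunct1[OF elim(1)] elim(2) by (rule op_fun_cong_AE)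
  moreover have "AE x in M2. op_fun M2 S (\<lambda>x. \<xi> (y, x)) x = \<zeta>' (y, x)"
    using conjunct2[OF elim(1)] elim(3) by eventually_elim simp
  ultimately show ?case using l2 by simp
qed

lemma fibrewise_unique:
  assumes S: "S \<in> bounded_ops M2"
    and fib: "fibrewise M1 M2 S \<xi> \<zeta>" "fibrewise M1 M2 S \<xi> \<zeta>'"
    and [measurable]: "\<zeta> \<in> borel_measurable (M1 \<Otimes>\<^sub>M M2)" "\<zeta>' \<in> borel_measurable (M1 \<Otimes>\<^sub>M M2)"
  shows "AE p in M1 \<Otimes>\<^sub>M M2. \<zeta> p = \<zeta>' p"
proof (rule AE_pair_measure)
  show "AE y in M1. AE x in M2. \<zeta> (y, x) = \<zeta>' (y, x)"
    using fib unfolding fibrewise_def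
  proof eventually_elim
    case (elim y)
    from conjunct2[OF elim(1)] conjunct2[OF elim(2)] show ?case by eventually_elim simp
  qed
qed measurable

text \<open>The functions \<open>\<xi>\<close> having a fibrewise image are closed under limits: the images form a Cauchy
  sequence, and along a subsequence almost every fibre converges.\<close>

lemma fibrewise_exists:
  assumes S: "S \<in> bounded_ops M2" and \<xi>: "\<xi> \<in> l2_funs (M1 \<Otimes>\<^sub>M M2)"
  shows "\<exists>\<zeta>\<in>l2_funs (M1 \<Otimes>\<^sub>M M2). fibrewise M1 M2 S \<xi> \<zeta>"
  using \<xi>
proof (induct rule: l2_pair_induct)
  case (rectangle X Y)
  have X: "indicator X \<in> l2_funs M1" and Y: "indicator Y \<in> l2_funs M2"
    using rectangle by (auto intro: l2_funs_indicator)
  have SY: "op_fun M2 S (indicator Y) \<in> l2_funs M2" by (intro op_fun_in_l2_funs S Y)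
  have "indicator (X \<times> Y) = (\<lambda>(y, x). indicator X y * indicator Y x :: complex)"
    by (auto simp: fun_eq_iff split: split_indicator)
  then show ?case
    using fibrewise_product[OF S Y SY, of "indicator X"] l2_product[OF X SY] by auto
next
  case (add f g)
  then show ?case using fibrewise_add[OF S] l2_funs_add by blast
next
  case (scale c f)
  then show ?case using fibrewise_scale[OF S] l2_funs_cmult by blast
next
  case (lim F f)
  let ?M = "M1 \<Otimes>\<^sub>M M2"
  obtain G where G: "\<And>n. G n \<in> l2_funs ?M" "\<And>n. fibrewise M1 M2 S (F n) (G n)"
    using lim(2) by metis
  obtain C where C: "0 \<le> C" "\<And>f. f \<in> l2_funs M2 \<Longrightarrow> l2sq M2 (op_fun M2 S f) \<le> ennreal C * l2sq M2 f"
    using op_fun_bound[OF S] by blast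
  have [measurable]: "F n \<in> borel_measurable ?M" "G n \<in> borel_measurable ?M" "f \<in> borel_measurable ?M" for n
    using lim G by (auto dest: l2_funs_measurable)
  have GF: "l2sq ?M (\<lambda>p. G m p - G n p) \<le> ennreal C * l2sq ?M (\<lambda>p. F m p - F n p)" for m n
    by (rule fibrewise_bound[OF C(2) fibrewise_diff[OF S G(2) G(2)]]) simp_all
  obtain g where g: "g \<in> l2_funs ?M" "(\<lambda>n. l2sq ?M (\<lambda>x. G n x - g x)) \<longlonglongrightarrow> 0"
  proof (rule l2_complete[OF G(1)])
    fix e :: real assume e: "0 < e"
    \<comment> \<open>The triangle inequality for squared distances through \<open>f\<close> costs 4
      d, and \<open>GF\<close> costs a factor C; adding 1 to C avoids dividing by zero.\<close>
    define d where "d = e / (4 * (C + 1))"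
    have d: "0 < d" using e C(1) by (simp add: d_def)
    have "eventually (\<lambda>n. l2sq ?M (\<lambda>x. F n x - f x) < ennreal d) sequentially"
      using lim(4) d by (intro order_tendstoD) auto
    then obtain N where N: "\<And>n. N \<le> n \<Longrightarrow> l2sq ?M (\<lambda>x. F n x - f x) \<le> ennreal d"
      by (auto simp: eventually_sequentially intro: less_imp_le)
    have "l2sq ?M (\<lambda>p. G m p - G n p) \<le> ennreal e" if "N \<le> m" "N \<le> n" for m n
    proof -
      have "l2sq ?M (\<lambda>p. F m p - F n p)
          \<le> 2 * l2sq ?M (\<lambda>p. F m p - f p) + 2 * l2sq ?M (\<lambda>p. f p - F n p)"
        by (rule l2sq_diff_triangle) simp_all
      also have "\<dots> \<le> 2 * ennreal d + 2 * ennreal d"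
        using N[OF that(1)] N[OF that(2)]
        by (intro add_mono mult_left_mono) (simp_all add: l2sq_minus_commute[of _ f])
      also have "\<dots> = ennreal (4 * d)"
        using d by (simp add: ennreal_mult' flip: distrib_right)
      finally have "l2sq ?M (\<lambda>p. G m p - G n p) \<le> ennreal C * ennreal (4 * d)"
        by (intro order_trans[OF GF] mult_left_mono) simp_all
      also have "\<dots> = ennreal (C * (4 * d))" using C(1) d by (simp add: ennreal_mult)
      also have "\<dots> \<le> ennreal e"
        using C(1) e by (intro ennreal_leI) (simp add: d_def field_simps)
      finally show ?thesis .
    qed
    then show "\<exists>N. \<forall>m\<ge>N. \<forall>n\<ge>N. l2sq ?M (\<lambda>p. G m p - G n p) \<le> ennreal e" by blast
  qed
  have [measurable]: "g \<in> borel_measurable ?M" using g(1) by (rule l2_funs_measurable)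
  define a where "a = (\<lambda>n. l2sq ?M (\<lambda>x. F n x - f x) + l2sq ?M (\<lambda>x. G n x - g x))"
  have "a \<longlonglongrightarrow> 0 + 0" unfolding a_def by (intro tendsto_add lim(4) g(2))
  then have "a \<longlonglongrightarrow> 0" by simp
  \<comment> \<open>Along this subsequence the errors of \<open>F\<close> and \<open>G\<close>
    together have summable integrals over the fibres, so both errors vanish in the limit on almost
    every fibre.\<close>
  then obtain r where r: "strict_mono r" "\<And>n. a (r n) \<le> ennreal ((1/2)^n)"
    using tendsto_zero_imp_subseq_le[of a "\<lambda>n. (1/2)^n"] by auto
  define \<phi> where "\<phi> = (\<lambda>n y. l2sq M2 (\<lambda>x. F (r n) (y, x) - f (y, x)) + l2sq M2 (\<lambda>x. G (r n) (y, x) - g (y, x)))"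
  have [measurable]: "\<phi> n \<in> borel_measurable M1" for n
    unfolding \<phi>_def using measurable_l2sq_section[of "\<lambda>p. F (r n) p - f p"]
      measurable_l2sq_section[of "\<lambda>p. G (r n) p - g p"] by simp
  have "(\<integral>\<^sup>+y. \<phi> n y \<partial>M1) = a (r n)" for n
    unfolding \<phi>_def a_def
    using measurable_l2sq_section[of "\<lambda>p. F (r n) p - f p"]
      measurable_l2sq_section[of "\<lambda>p. G (r n) p - g p"]
    by (subst nn_integral_add) (simp_all add: l2sq_pair)
  then have \<phi>: "AE y in M1. (\<lambda>n. \<phi> n y) \<longlonglongrightarrow> 0"
    using r(2) by (intro AE_tendsto_zero_of_summable_integrals) simp_all
  have G_AE: "AE y in M1. \<forall>n. (\<lambda>x. F (r n) (y, x)) \<in> l2_funs M2 \<and>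
     (AE x in M2. op_fun M2 S (\<lambda>x. F (r n) (y, x)) x = G (r n) (y, x))"
    using G(2) unfolding fibrewise_def by (simp add: AE_all_countable)
  have "fibrewise M1 M2 S f g"
    unfolding fibrewise_def
    using \<phi> G_AE AE_section_l2[OF lim(3)] AE_section_l2[OF g(1)] AE_space
  proof eventually_elim
    case (elim y)
    note fy = \<open>(\<lambda>x. f (y, x)) \<in> l2_funs M2\<close> and gy = \<open>(\<lambda>x. g (y, x)) \<in> l2_funs M2\<close>
    have Fy: "(\<lambda>x. F (r n) (y, x)) \<in> l2_funs M2"
      and Gy: "AE x in M2. op_fun M2 S (\<lambda>x. F (r n) (y, x)) x = G (r n) (y, x)" for n
      using elim(2) by auto
    have [measurable]: "(\<lambda>x. G n (y, x)) \<in> borel_measurable M2" for n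
      using l2_funs_measurable[OF G(1)] elim(5) by (rule measurable_Pair2)
    let ?Sf = "op_fun M2 S (\<lambda>x. f (y, x))"
    have Sf: "?Sf \<in> l2_funs M2" by (intro op_fun_in_l2_funs S fy)
    note [measurable] = l2_funs_measurable[OF Sf] l2_funs_measurable[OF gy] l2_funs_measurable[OF fy]
      l2_funs_measurable[OF Fy]
    \<comment> \<open>On a good fibre the sections of \<open>G (r n)\<close> approach the section of
      \<open>g\<close>, and they approach S applied to the section of \<open>f\<close> by
      boundedness of S. The two limits therefore agree.\<close>
    have "l2sq M2 (\<lambda>x. ?Sf x - g (y, x)) \<le> ennreal (2 * C + 2) * \<phi> n y" for n
    proof -
      have d: "(\<lambda>x. F (r n) (y, x) - f (y, x)) \<in> l2_funs M2" by (intro l2_funs_diff Fy fy)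
      have "AE x in M2. op_fun M2 S (\<lambda>x. F (r n) (y, x) - f (y, x)) x = G (r n) (y, x) - ?Sf x"
        using op_fun_diff[OF S Fy fy, of n] Gy[of n] by eventually_elim simp
      then have "l2sq M2 (\<lambda>x. G (r n) (y, x) - ?Sf x) = l2sq M2 (op_fun M2 S (\<lambda>x. F (r n) (y, x) - f (y, x)))"
        by (intro l2sq_cong_AE) auto
      also have "\<dots> \<le> ennreal C * l2sq M2 (\<lambda>x. F (r n) (y, x) - f (y, x))" by (rule C(2)[OF d])
      also have "\<dots> \<le> ennreal C * \<phi> n y" by (intro mult_left_mono) (simp_all add: \<phi>_def)
      finally have 1: "l2sq M2 (\<lambda>x. ?Sf x - G (r n) (y, x)) \<le> ennreal C * \<phi> n y"
        by (simp add: l2sq_minus_commute[of _ ?Sf])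
      have 2: "l2sq M2 (\<lambda>x. G (r n) (y, x) - g (y, x)) \<le> \<phi> n y" by (simp add: \<phi>_def)
      have "l2sq M2 (\<lambda>x. ?Sf x - g (y, x))
          \<le> 2 * l2sq M2 (\<lambda>x. ?Sf x - G (r n) (y, x)) + 2 * l2sq M2 (\<lambda>x. G (r n) (y, x) - g (y, x))"
        by (rule l2sq_diff_triangle) simp_all
      also have "\<dots> \<le> 2 * (ennreal C * \<phi> n y) + 2 * \<phi> n y"
        by (intro add_mono mult_left_mono 1 2) simp_all
      also have "\<dots> = ennreal (2 * C + 2) * \<phi> n y"
        using C(1) by (simp add: ennreal_mult distrib_right mult.assoc)
      finally show ?thesis .
    qed
    moreover have "(\<lambda>n. ennreal (2 * C + 2) * \<phi> n y) \<longlonglongrightarrow> ennreal (2 * C + 2) * 0"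
      by (intro ennreal_tendsto_cmult elim) simp
    ultimately have "l2sq M2 (\<lambda>x. ?Sf x - g (y, x)) \<le> 0"
      by (intro LIMSEQ_le_const[of "\<lambda>n. ennreal (2 * C + 2) * \<phi> n y"]) auto
    then have "AE x in M2. ?Sf x - g (y, x) = 0"
      by (subst l2sq_zero_iff[symmetric]) simp_all
    then show ?case using fy by (auto elim: eventually_mono)
  qed
  with g(1) show ?case by blast
qed

text \<open>Indicators of rectangles are elementary tensors, and agreement of two bounded operators
  passes to sums, multiples and norm limits, so the induction principle on the product reaches every
  vector.\<close>

lemma bounded_ops_eq_of_tensors:
  assumes R: "R \<in> bounded_ops (M1 \<Otimes>\<^sub>M M2)" and R': "R' \<in> bounded_ops (M1 \<Otimes>\<^sub>M M2)"
    and eq: "\<And>u v. u \<in> l2_funs M1 \<Longrightarrow> v \<in> l2_funs M2 \<Longrightarrow>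
      R (l2_class (M1 \<Otimes>\<^sub>M M2) (\<lambda>(x, y). u x * v y)) = R' (l2_class (M1 \<Otimes>\<^sub>M M2) (\<lambda>(x, y). u x * v y))"
  shows "R = R'"
proof (rule bounded_ops_eqI[OF R R'])
  let ?M = "M1 \<Otimes>\<^sub>M M2"
  fix f assume f: "f \<in> l2_funs ?M"
  then have "AE p in ?M. op_fun ?M R f p = op_fun ?M R' f p"
  proof (induct rule: l2_pair_induct)
    case (rectangle X Y)
    have "indicator (X \<times> Y) = (\<lambda>(x, y). indicator X x * indicator Y y :: complex)"
      by (auto simp: fun_eq_iff split: split_indicator)
    then show ?case
      unfolding op_fun_def using eq[of "indicator X" "indicator Y"] rectangle
      by (simp add: l2_funs_indicator)
  next
    case (add f g)
    show ?case using add(3,4) op_fun_add[OF R add(1,2)] op_fun_add[OF R' add(1,2)]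
      by eventually_elim simp
  next
    case (scale c f)
    show ?case using scale(2) op_fun_scale[OF R scale(1), of c] op_fun_scale[OF R' scale(1), of c]
      by eventually_elim simp
  next
    case (lim F f)
    note in_l2 = op_fun_in_l2_funs[OF R] op_fun_in_l2_funs[OF R']
    obtain C where C: "0 \<le> C" "\<And>f. f \<in> l2_funs ?M \<Longrightarrow> l2sq ?M (op_fun ?M R f) \<le> ennreal C * l2sq ?M f"
      using op_fun_bound[OF R] by blast
    obtain D where D: "0 \<le> D" "\<And>f. f \<in> l2_funs ?M \<Longrightarrow> l2sq ?M (op_fun ?M R' f) \<le> ennreal D * l2sq ?M f"
      using op_fun_bound[OF R'] by blast
    define e where "e = (\<lambda>n. l2sq ?M (\<lambda>p. F n p - f p))"
    let ?d = "\<lambda>p. op_fun ?M R f p - op_fun ?M R' f p"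
    note [measurable] = in_l2[OF lim(1), THEN l2_funs_measurable] in_l2[OF lim(3), THEN l2_funs_measurable]
    \<comment> \<open>The distance between the two images of \<open>f\<close> is measured through
      the common image of \<open>F n\<close>.\<close>
    have le: "l2sq ?M ?d \<le> (2 * ennreal C + 2 * ennreal D) * e n" for n
    proof -
      have d: "(\<lambda>p. F n p - f p) \<in> l2_funs ?M" by (intro l2_funs_diff lim)
      have "l2sq ?M (\<lambda>p. op_fun ?M R (F n) p - op_fun ?M R f p) = l2sq ?M (op_fun ?M R (\<lambda>p. F n p - f p))"
        by (rule l2sq_cong_AE[symmetric, OF op_fun_diff[OF R lim(1,3)]])
      also have "\<dots> \<le> ennreal C * e n" unfolding e_def by (rule C(2)[OF d])
      finally have 1: "l2sq ?M (\<lambda>p. op_fun ?M R f p - op_fun ?M R (F n) p) \<le> ennreal C * e n"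
        by (simp add: l2sq_minus_commute[of _ "op_fun ?M R f"])
      have "l2sq ?M (\<lambda>p. op_fun ?M R (F n) p - op_fun ?M R' f p)
          = l2sq ?M (\<lambda>p. op_fun ?M R' (F n) p - op_fun ?M R' f p)"
        using lim(2)[of n] by (intro l2sq_cong_AE) (auto elim: eventually_mono)
      also have "\<dots> = l2sq ?M (op_fun ?M R' (\<lambda>p. F n p - f p))"
        by (rule l2sq_cong_AE[symmetric, OF op_fun_diff[OF R' lim(1,3)]])
      also have "\<dots> \<le> ennreal D * e n" unfolding e_def by (rule D(2)[OF d])
      finally have 2: "l2sq ?M (\<lambda>p. op_fun ?M R (F n) p - op_fun ?M R' f p) \<le> ennreal D * e n" .
      have "l2sq ?M ?d \<le> 2 * l2sq ?M (\<lambda>p. op_fun ?M R f p - op_fun ?M R (F n) p)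
          + 2 * l2sq ?M (\<lambda>p. op_fun ?M R (F n) p - op_fun ?M R' f p)"
        by (rule l2sq_diff_triangle) simp_all
      also have "\<dots> \<le> 2 * (ennreal C * e n) + 2 * (ennreal D * e n)"
        by (intro add_mono mult_left_mono 1 2) simp_all
      finally show ?thesis by (simp add: distrib_right mult.assoc)
    qed
    have "(\<lambda>n. (2 * ennreal C + 2 * ennreal D) * e n) \<longlonglongrightarrow> (2 * ennreal C + 2 * ennreal D) * 0"
      unfolding e_def by (intro ennreal_tendsto_cmult lim) (simp add: ennreal_mult_less_top)
    then have "l2sq ?M ?d \<le> 0"
      using le by (intro LIMSEQ_le_const[of "\<lambda>n. (2 * ennreal C + 2 * ennreal D) * e n"]) auto
    then have "AE p in ?M. ?d p = 0" by (subst l2sq_zero_iff[symmetric]) simp_all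
    then show ?case by (auto elim: eventually_mono)
  qed
  then have "l2_class ?M (op_fun ?M R f) = l2_class ?M (op_fun ?M R' f)"
    using op_fun_in_l2_funs[OF R f] by (simp add: l2_class_eq_iff)
  then show "R (l2_class ?M f) = R' (l2_class ?M f)" by (simp add: class_op_fun R R' f)
qed

text \<open>The tool for evaluating \<open>op_tensor\<close>: uniqueness is settled here, so it
  remains to exhibit one bounded operator with the right values on elementary tensors.\<close>

lemma op_tensor_eqI:
  assumes R: "R \<in> bounded_ops (M1 \<Otimes>\<^sub>M M2)"
    and eq: "\<And>u v. u \<in> l2_funs M1 \<Longrightarrow> v \<in> l2_funs M2 \<Longrightarrow>
      R (l2_class (M1 \<Otimes>\<^sub>M M2) (\<lambda>(x, y). u x * v y)) =
      l2_tensor M1 M2 (S (l2_class M1 u)) (T (l2_class M2 v))"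
  shows "op_tensor M1 M2 S T = R"
  unfolding op_tensor_def
proof (rule the_equality)
  show "R \<in> bounded_ops (M1 \<Otimes>\<^sub>M M2) \<and>
    (\<forall>u\<in>L2 M1. \<forall>v\<in>L2 M2. R (l2_tensor M1 M2 u v) = l2_tensor M1 M2 (S u) (T v))"
  proof (intro conjI R ballI)
    fix u v assume "u \<in> L2 M1" "v \<in> L2 M2"
    then show "R (l2_tensor M1 M2 u v) = l2_tensor M1 M2 (S u) (T v)"
      by (elim L2E) (simp add: l2_tensor_class eq)
  qed
next
  fix R' assume R': "R' \<in> bounded_ops (M1 \<Otimes>\<^sub>M M2) \<and>
    (\<forall>u\<in>L2 M1. \<forall>v\<in>L2 M2. R' (l2_tensor M1 M2 u v) = l2_tensor M1 M2 (S u) (T v))"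
  show "R' = R"
  proof (rule bounded_ops_eq_of_tensors[OF _ R])
    fix u v assume u: "u \<in> l2_funs M1" and v: "v \<in> l2_funs M2"
    have "R' (l2_tensor M1 M2 (l2_class M1 u) (l2_class M2 v)) = l2_tensor M1 M2 (S (l2_class M1 u)) (T (l2_class M2 v))"
      using R' u v by (simp add: l2_class_in_L2)
    then show "R' (l2_class (M1 \<Otimes>\<^sub>M M2) (\<lambda>(x, y). u x * v y)) = R (l2_class (M1 \<Otimes>\<^sub>M M2) (\<lambda>(x, y). u x * v y))"
      by (simp add: l2_tensor_class u v eq)
  qed (use R' in blast)
qed

lemma op_tensor_scale_id:
  "op_tensor M1 M2 (op_scale M1 c (op_id M1)) (op_id M2) = op_scale (M1 \<Otimes>\<^sub>M M2) c (op_id (M1 \<Otimes>\<^sub>M M2))"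
proof (rule op_tensor_eqI[OF op_scale_id_bounded])
  fix u v assume u: "u \<in> l2_funs M1" and v: "v \<in> l2_funs M2"
  show "op_scale (M1 \<Otimes>\<^sub>M M2) c (op_id (M1 \<Otimes>\<^sub>M M2)) (l2_class (M1 \<Otimes>\<^sub>M M2) (\<lambda>(x, y). u x * v y)) =
      l2_tensor M1 M2 (op_scale M1 c (op_id M1) (l2_class M1 u)) (op_id M2 (l2_class M2 v))"
    by (simp add: op_scale_id_class[OF l2_product[OF u v, unfolded case_prod_unfold]] op_scale_id_class op_id_class l2_tensor_class
        l2_funs_cmult u v mult.assoc case_prod_unfold)
qed

end

section \<open>Measure preserving bijections\<close>

text \<open>The inverse laws are imposed on whole types, so compositions cancel by rewriting inside
  function arguments. That the inverse preserves the measure as well is a consequence, proved in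
  \<open>measure_iso_sym\<close>.\<close>

definition measure_iso :: "'a measure \<Rightarrow> 'b measure \<Rightarrow> ('a \<Rightarrow> 'b) \<Rightarrow> ('b \<Rightarrow> 'a) \<Rightarrow> bool" where
  "measure_iso M N \<theta> \<theta>' \<longleftrightarrow> \<theta> \<in> measurable M N \<and> \<theta>' \<in> measurable N M \<and>
     (\<forall>x. \<theta>' (\<theta> x) = x) \<and> (\<forall>y. \<theta> (\<theta>' y) = y) \<and> distr M N \<theta> = N"

lemma measure_isoI:
  assumes "\<theta> \<in> measurable M N" "\<theta>' \<in> measurable N M"
    "\<And>x. \<theta>' (\<theta> x) = x" "\<And>y. \<theta> (\<theta>' y) = y"
    "\<And>E. E \<in> sets N \<Longrightarrow> emeasure M (\<theta> -` E \<inter> space M) = emeasure N E"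
  shows "measure_iso M N \<theta> \<theta>'"
  unfolding measure_iso_def using assms
  by (auto intro!: measure_eqI simp: emeasure_distr)

lemma measure_iso_inverse:
  assumes "measure_iso M N \<theta> \<theta>'"
  shows "\<theta>' (\<theta> x) = x" "\<theta> (\<theta>' y) = y"
  using assms unfolding measure_iso_def by blast+

lemma measure_iso_sym:
  assumes "measure_iso M N \<theta> \<theta>'"
  shows "measure_iso N M \<theta>' \<theta>"
proof -
  have m: "\<theta> \<in> measurable M N" "\<theta>' \<in> measurable N M" and inv: "\<And>x. \<theta>' (\<theta> x) = x"
    and d: "distr M N \<theta> = N" using assms by (auto simp: measure_iso_def)
  have "distr N M \<theta>' = distr (distr M N \<theta>) M \<theta>'" by (simp add: d)
  also have "\<dots> = distr M M (\<theta>' \<circ> \<theta>)" using m by (simp add: distr_distr)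
  also have "\<dots> = M" by (simp add: comp_def inv distr_id)
  finally show ?thesis using assms by (auto simp: measure_iso_def)
qed

lemma measure_iso_comp:
  assumes "measure_iso M N \<theta> \<theta>'" "measure_iso N L \<psi> \<psi>'"
  shows "measure_iso M L (\<lambda>x. \<psi> (\<theta> x)) (\<lambda>x. \<theta>' (\<psi>' x))"
proof -
  have "distr M L (\<lambda>x. \<psi> (\<theta> x)) = distr (distr M N \<theta>) L \<psi>"
    using assms by (subst distr_distr) (auto simp: measure_iso_def comp_def)
  also have "\<dots> = L" using assms by (simp add: measure_iso_def)
  finally show ?thesis using assms
    by (auto simp: measure_iso_def intro: measurable_compose)
qed

lemma measure_iso_AE:
  assumes "measure_iso M N \<theta> \<theta>'" "AE y in N. P y"
  shows "AE x in M. P (\<theta> x)"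
proof -
  have m: "\<theta> \<in> measurable M N" and d: "distr M N \<theta> = N" using assms by (auto simp: measure_iso_def)
  show ?thesis by (rule AE_distrD[OF m]) (subst d, rule assms(2))
qed

lemma measure_iso_l2sq:
  assumes "measure_iso M N \<theta> \<theta>'" and f: "f \<in> borel_measurable N"
  shows "l2sq M (\<lambda>x. f (\<theta> x)) = l2sq N f"
proof -
  have "l2sq N f = l2sq (distr M N \<theta>) f" using assms by (simp add: measure_iso_def)
  also have "\<dots> = l2sq M (\<lambda>x. f (\<theta> x))"
    unfolding l2sq_def using assms by (subst nn_integral_distr) (auto simp: measure_iso_def)
  finally show ?thesis by simp
qed

lemma measure_iso_l2:
  assumes iso: "measure_iso M N \<theta> \<theta>'" and f: "f \<in> l2_funs N"
  shows "(\<lambda>x. f (\<theta> x)) \<in> l2_funs M"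
proof -
  have "(\<lambda>x. f (\<theta> x)) \<in> borel_measurable M"
    using iso l2_funs_measurable[OF f] unfolding measure_iso_def by (auto intro: measurable_compose)
  then show ?thesis using measure_iso_l2sq[OF iso l2_funs_measurable[OF f]] l2sq_finite[OF f]
    by (simp add: l2_funs_iff)
qed

lemma measure_iso_inner:
  assumes iso: "measure_iso M N \<theta> \<theta>'" and f: "f \<in> l2_funs N" and g: "g \<in> l2_funs N"
  shows "inner_fun M (\<lambda>x. f (\<theta> x)) (\<lambda>x. g (\<theta> x)) = inner_fun N f g"
proof -
  have "inner_fun N f g = inner_fun (distr M N \<theta>) f g" using iso by (simp add: measure_iso_def)
  also have "\<dots> = inner_fun M (\<lambda>x. f (\<theta> x)) (\<lambda>x. g (\<theta> x))"
    unfolding inner_fun_def using iso borel_measurable_integrable[OF integrable_cnj_mult[OF f g]]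
    by (subst integral_distr[where N = N]) (auto simp: measure_iso_def)
  finally show ?thesis by simp
qed

section \<open>Unitaries given by composition with measure preserving bijections\<close>

definition composition_op :: "'a measure \<Rightarrow> ('a \<Rightarrow> 'a) \<Rightarrow> 'a l2_op" where
  "composition_op M \<theta> = fun_op M (\<lambda>f x. f (\<theta> x))"

lemma composition_op_class:
  assumes "measure_iso M M \<theta> \<theta>'" "f \<in> l2_funs M"
  shows "composition_op M \<theta> (l2_class M f) = l2_class M (\<lambda>x. f (\<theta> x))"
  unfolding composition_op_def
proof (rule fun_op_class[OF _ _ assms(2)])
  fix f g assume "AE x in M. f x = g x"
  from measure_iso_AE[OF assms(1) this] show "AE x in M. f (\<theta> x) = g (\<theta> x)" .
qed (rule measure_iso_l2[OF assms(1)])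

lemma composition_op_bounded:
  assumes "measure_iso M M \<theta> \<theta>'"
  shows "composition_op M \<theta> \<in> bounded_ops M"
  unfolding composition_op_def
proof (rule fun_op_bounded[where C = 1])
  fix f g assume "AE x in M. f x = g x"
  from measure_iso_AE[OF assms this] show "AE x in M. f (\<theta> x) = g (\<theta> x)" .
next
  fix f assume "f \<in> l2_funs M"
  then show "l2sq M (\<lambda>x. f (\<theta> x)) \<le> ennreal 1 * l2sq M f"
    by (simp add: measure_iso_l2sq[OF assms] l2_funs_measurable)
qed (simp_all add: measure_iso_l2[OF assms])

lemma op_fun_composition:
  assumes "measure_iso M M \<theta> \<theta>'" "f \<in> l2_funs M"
  shows "AE x in M. op_fun M (composition_op M \<theta>) f x = f (\<theta> x)"
  by (rule op_fun_eqI) (fact assms(2) measure_iso_l2[OF assms] composition_op_class[OF assms])+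

text \<open>Substituting along \<open>\<theta>\<close> moves the composition from one argument of
  the inner product to the other.\<close>

lemma op_adjoint_composition:
  assumes iso: "measure_iso M M \<theta> \<theta>'"
  shows "op_adjoint M (composition_op M \<theta>) = composition_op M \<theta>'"
proof (rule op_adjoint_eqI)
  note iso' = measure_iso_sym[OF iso]
  show b: "composition_op M \<theta>' \<in> bounded_ops M" "composition_op M \<theta> \<in> bounded_ops M"
    using iso iso' by (auto intro: composition_op_bounded)
  fix f g assume f: "f \<in> l2_funs M" and g: "g \<in> l2_funs M"
  have "inner_fun M (op_fun M (composition_op M \<theta>') f) g = inner_fun M (\<lambda>x. f (\<theta>' x)) g"
    by (rule inner_fun_cong_AE[OF op_fun_in_l2_funs[OF b(1) f] g measure_iso_l2[OF iso' f] g
          op_fun_composition[OF iso' f]]) simp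
  also have "\<dots> = inner_fun M (\<lambda>x. f (\<theta>' (\<theta> x))) (\<lambda>x. g (\<theta> x))"
    by (rule measure_iso_inner[OF iso measure_iso_l2[OF iso' f] g, symmetric])
  also have "\<dots> = inner_fun M f (\<lambda>x. g (\<theta> x))"
    using iso by (simp add: measure_iso_def)
  also have "\<dots> = inner_fun M f (op_fun M (composition_op M \<theta>) g)"
    by (rule inner_op_cong[OF b(2) f g measure_iso_l2[OF iso g] op_fun_composition[OF iso g], symmetric])
  finally show "inner_fun M (op_fun M (composition_op M \<theta>') f) g
      = inner_fun M f (op_fun M (composition_op M \<theta>) g)" .
qed

lemma measure_iso_swap:
  assumes "sigma_finite_measure M" "sigma_finite_measure N"
  shows "measure_iso (N \<Otimes>\<^sub>M M) (M \<Otimes>\<^sub>M N) (\<lambda>(y, x). (x, y)) (\<lambda>(x, y). (y, x))"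
proof -
  interpret pair_sigma_finite M N using assms by (rule pair_sigma_finite.intro)
  show ?thesis unfolding measure_iso_def using distr_pair_swap by auto
qed

text \<open>The measure of a set is the integral of the measures of its sections, and each section
  is mapped by one of the fibre isomorphisms. Joint measurability has to be supplied, since it does
  not follow from the fibres.\<close>

lemma measure_iso_fibred:
  assumes sf: "sigma_finite_measure B" "sigma_finite_measure C"
    and m: "(\<lambda>(x, y). (x, \<psi> x y)) \<in> measurable (A \<Otimes>\<^sub>M B) (A \<Otimes>\<^sub>M C)"
      "(\<lambda>(x, y). (x, \<psi>' x y)) \<in> measurable (A \<Otimes>\<^sub>M C) (A \<Otimes>\<^sub>M B)"
    and iso: "\<And>x. measure_iso B C (\<psi> x) (\<psi>' x)"
  shows "measure_iso (A \<Otimes>\<^sub>M B) (A \<Otimes>\<^sub>M C) (\<lambda>(x, y). (x, \<psi> x y)) (\<lambda>(x, y). (x, \<psi>' x y))"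
proof (rule measure_isoI[OF m])
  show "(case case p of (x, y) \<Rightarrow> (x, \<psi> x y) of (x, y) \<Rightarrow> (x, \<psi>' x y)) = p" for p
    by (cases p) (simp add: measure_iso_inverse[OF iso])
  show "(case case p of (x, y) \<Rightarrow> (x, \<psi>' x y) of (x, y) \<Rightarrow> (x, \<psi> x y)) = p" for p
    by (cases p) (simp add: measure_iso_inverse[OF iso])
  fix E assume E: "E \<in> sets (A \<Otimes>\<^sub>M C)"
  let ?E' = "(\<lambda>(x, y). (x, \<psi> x y)) -` E \<inter> space (A \<Otimes>\<^sub>M B)"
  have "emeasure (A \<Otimes>\<^sub>M B) ?E' = (\<integral>\<^sup>+x. emeasure B (Pair x -` ?E') \<partial>A)"
    using measurable_sets[OF m(1) E] by (rule sigma_finite_measure.emeasure_pair_measure_alt[OF sf(1)])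
  also have "\<dots> = (\<integral>\<^sup>+x. emeasure C (Pair x -` E) \<partial>A)"
  proof (rule nn_integral_cong)
    fix x assume x: "x \<in> space A"
    have \<psi>: "\<psi> x \<in> measurable B C" and d: "distr B C (\<psi> x) = C"
      using iso[of x] by (simp_all add: measure_iso_def)
    have "Pair x -` ?E' = \<psi> x -` (Pair x -` E) \<inter> space B"
      using x by (auto simp: space_pair_measure)
    also have "emeasure B \<dots> = emeasure (distr B C (\<psi> x)) (Pair x -` E)"
      by (rule emeasure_distr[symmetric, OF \<psi> sets_Pair1[OF E]])
    finally show "emeasure B (Pair x -` ?E') = emeasure C (Pair x -` E)" by (simp add: d)
  qed
  also have "\<dots> = emeasure (A \<Otimes>\<^sub>M C) E"
    using E by (rule sigma_finite_measure.emeasure_pair_measure_alt[OF sf(2), symmetric])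
  finally show "emeasure (A \<Otimes>\<^sub>M B) ?E' = emeasure (A \<Otimes>\<^sub>M C) E" .
qed

lemma measure_iso_snd:
  assumes sf: "sigma_finite_measure B" "sigma_finite_measure C" and iso: "measure_iso B C \<psi> \<psi>'"
  shows "measure_iso (A \<Otimes>\<^sub>M B) (A \<Otimes>\<^sub>M C) (\<lambda>(x, y). (x, \<psi> y)) (\<lambda>(x, y). (x, \<psi>' y))"
proof (rule measure_iso_fibred[OF sf _ _ iso])
  have [measurable]: "\<psi> \<in> measurable B C" "\<psi>' \<in> measurable C B"
    using iso by (simp_all add: measure_iso_def)
  show "(\<lambda>(x, y). (x, \<psi> y)) \<in> measurable (A \<Otimes>\<^sub>M B) (A \<Otimes>\<^sub>M C)"
    "(\<lambda>(x, y). (x, \<psi>' y)) \<in> measurable (A \<Otimes>\<^sub>M C) (A \<Otimes>\<^sub>M B)" by measurable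
qed

lemma sigma_finite_pair_measure:
  assumes "sigma_finite_measure A" "sigma_finite_measure B"
  shows "sigma_finite_measure (A \<Otimes>\<^sub>M B)"
proof -
  interpret pair_sigma_finite A B using assms by (rule pair_sigma_finite.intro)
  show ?thesis by (rule P.sigma_finite_measure_axioms)
qed

text \<open>Both bracketings compute the measure of a set as the same iterated integral of its
  sections in the last variable.\<close>

lemma measure_iso_assoc:
  assumes sf: "sigma_finite_measure B" "sigma_finite_measure C"
  shows "measure_iso ((A \<Otimes>\<^sub>M B) \<Otimes>\<^sub>M C) (A \<Otimes>\<^sub>M B \<Otimes>\<^sub>M C) (\<lambda>((x, y), z). (x, y, z)) (\<lambda>(x, y, z). ((x, y), z))"
proof (rule measure_isoI)
  interpret B: sigma_finite_measure B by fact
  interpret C: sigma_finite_measure C by fact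
  interpret BC: sigma_finite_measure "B \<Otimes>\<^sub>M C" by (rule sigma_finite_pair_measure[OF sf])
  show \<theta>: "(\<lambda>((x, y), z). (x, y, z)) \<in> measurable ((A \<Otimes>\<^sub>M B) \<Otimes>\<^sub>M C) (A \<Otimes>\<^sub>M B \<Otimes>\<^sub>M C)"
    unfolding case_prod_unfold case_prod_beta by measurable
  show "(\<lambda>(x, y, z). ((x, y), z)) \<in> measurable (A \<Otimes>\<^sub>M B \<Otimes>\<^sub>M C) ((A \<Otimes>\<^sub>M B) \<Otimes>\<^sub>M C)"
    by measurable
  fix E assume E: "E \<in> sets (A \<Otimes>\<^sub>M B \<Otimes>\<^sub>M C)"
  let ?E' = "(\<lambda>((x, y), z). (x, y, z)) -` E \<inter> space ((A \<Otimes>\<^sub>M B) \<Otimes>\<^sub>M C)"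
  have E': "?E' \<in> sets ((A \<Otimes>\<^sub>M B) \<Otimes>\<^sub>M C)" by (rule measurable_sets[OF \<theta> E])
  have "emeasure ((A \<Otimes>\<^sub>M B) \<Otimes>\<^sub>M C) ?E' = (\<integral>\<^sup>+p. emeasure C (Pair p -` ?E') \<partial>(A \<Otimes>\<^sub>M B))"
    by (rule C.emeasure_pair_measure_alt[OF E'])
  also have "\<dots> = (\<integral>\<^sup>+x. \<integral>\<^sup>+y. emeasure C (Pair (x, y) -` ?E') \<partial>B \<partial>A)"
    by (rule B.nn_integral_fst[symmetric, OF C.measurable_emeasure_Pair[OF E']])
  also have "\<dots> = (\<integral>\<^sup>+x. \<integral>\<^sup>+y. emeasure C (Pair y -` Pair x -` E) \<partial>B \<partial>A)"
  proof (intro nn_integral_cong)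
    fix x y assume xy: "x \<in> space A" "y \<in> space B"
    have "Pair (x, y) -` ?E' = Pair y -` Pair x -` E"
      using xy sets.sets_into_space[OF E] by (auto simp: space_pair_measure)
    then show "emeasure C (Pair (x, y) -` ?E') = emeasure C (Pair y -` Pair x -` E)" by simp
  qed
  also have "\<dots> = (\<integral>\<^sup>+x. emeasure (B \<Otimes>\<^sub>M C) (Pair x -` E) \<partial>A)"
    by (intro nn_integral_cong C.emeasure_pair_measure_alt[symmetric] sets_Pair1[OF E])
  also have "\<dots> = emeasure (A \<Otimes>\<^sub>M B \<Otimes>\<^sub>M C) E" by (rule BC.emeasure_pair_measure_alt[symmetric, OF E])
  finally show "emeasure ((A \<Otimes>\<^sub>M B) \<Otimes>\<^sub>M C) ?E' = emeasure (A \<Otimes>\<^sub>M B \<Otimes>\<^sub>M C) E" .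
qed auto

subsection \<open>Amplification along a leg\<close>

text \<open>\<open>leg_op A B M \<theta> S\<close> lets \<open>S\<close> act on the second factor of \<open>A \<times> B\<close>, transported to \<open>M\<close> along
  \<open>\<theta> : A \<times> B \<rightarrow> M\<close>; it realises leg numbering such as \<open>1 \<otimes> 1 \<otimes> S \<otimes> 1\<close>.\<close>

definition leg_op :: "'a measure \<Rightarrow> 'b measure \<Rightarrow> 'c measure \<Rightarrow> ('a \<times> 'b \<Rightarrow> 'c) \<Rightarrow> 'b l2_op \<Rightarrow> 'c l2_op" where
  "leg_op A B M \<theta> S = fun_op M (\<lambda>\<xi>. SOME \<zeta>. \<zeta> \<in> l2_funs M \<and>
     fibrewise A B S (\<lambda>p. \<xi> (\<theta> p)) (\<lambda>p. \<zeta> (\<theta> p)))"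

context pair_sigma_finite
begin

context
  fixes M :: "'c measure" and \<theta> \<theta>' S
  assumes iso: "measure_iso (M1 \<Otimes>\<^sub>M M2) M \<theta> \<theta>'" and S: "S \<in> bounded_ops M2"
begin

lemma leg_exists:
  assumes \<xi>: "\<xi> \<in> l2_funs M"
  obtains \<zeta> where "\<zeta> \<in> l2_funs M" "fibrewise M1 M2 S (\<lambda>p. \<xi> (\<theta> p)) (\<lambda>p. \<zeta> (\<theta> p))"
proof -
  obtain \<zeta> where \<zeta>: "\<zeta> \<in> l2_funs (M1 \<Otimes>\<^sub>M M2)" "fibrewise M1 M2 S (\<lambda>p. \<xi> (\<theta> p)) \<zeta>"
    using fibrewise_exists[OF S measure_iso_l2[OF iso \<xi>]] by blast
  have "(\<lambda>p. \<zeta> (\<theta>' (\<theta> p))) = \<zeta>" by (simp only: measure_iso_inverse[OF iso])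
  then show thesis
    using that[of "\<lambda>p. \<zeta> (\<theta>' p)"] \<zeta> measure_iso_l2[OF measure_iso_sym[OF iso] \<zeta>(1)] by simp
qed

lemma leg_unique:
  assumes \<zeta>: "\<zeta> \<in> l2_funs M" "\<zeta>' \<in> l2_funs M"
    and fib: "fibrewise M1 M2 S \<xi> (\<lambda>p. \<zeta> (\<theta> p))" "fibrewise M1 M2 S \<xi> (\<lambda>p. \<zeta>' (\<theta> p))"
  shows "AE p in M. \<zeta> p = \<zeta>' p"
proof -
  have "AE p in M1 \<Otimes>\<^sub>M M2. \<zeta> (\<theta> p) = \<zeta>' (\<theta> p)"
    by (rule fibrewise_unique[OF S fib l2_funs_measurable[OF measure_iso_l2[OF iso \<zeta>(1)]]
          l2_funs_measurable[OF measure_iso_l2[OF iso \<zeta>(2)]]])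
  then have "AE p in M. \<zeta> (\<theta> (\<theta>' p)) = \<zeta>' (\<theta> (\<theta>' p))"
    by (rule measure_iso_AE[OF measure_iso_sym[OF iso]])
  then show ?thesis by (simp only: measure_iso_inverse[OF iso])
qed

lemma leg_fun:
  fixes \<xi>
  defines "\<zeta> \<equiv> SOME \<zeta>. \<zeta> \<in> l2_funs M \<and> fibrewise M1 M2 S (\<lambda>p. \<xi> (\<theta> p)) (\<lambda>p. \<zeta> (\<theta> p))"
  assumes "\<xi> \<in> l2_funs M"
  shows "\<zeta> \<in> l2_funs M \<and> fibrewise M1 M2 S (\<lambda>p. \<xi> (\<theta> p)) (\<lambda>p. \<zeta> (\<theta> p))"
proof -
  have "\<exists>\<zeta>. \<zeta> \<in> l2_funs M \<and> fibrewise M1 M2 S (\<lambda>p. \<xi> (\<theta> p)) (\<lambda>p. \<zeta> (\<theta> p))"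
    by (rule leg_exists[OF assms(2)]) blast
  then show ?thesis unfolding \<zeta>_def by (rule someI_ex)
qed

lemma leg_cong:
  assumes \<xi>: "\<xi> \<in> l2_funs M" "\<xi>' \<in> l2_funs M" and ae: "AE p in M. \<xi> p = \<xi>' p"
    and \<zeta>: "\<zeta> \<in> l2_funs M" "fibrewise M1 M2 S (\<lambda>p. \<xi> (\<theta> p)) (\<lambda>p. \<zeta> (\<theta> p))"
  shows "fibrewise M1 M2 S (\<lambda>p. \<xi>' (\<theta> p)) (\<lambda>p. \<zeta> (\<theta> p))"
proof (rule fibrewise_cong_AE[OF _ _ _ _ measure_iso_AE[OF iso ae] _ \<zeta>(2)])
  show "(\<lambda>p. \<xi> (\<theta> p)) \<in> borel_measurable (M1 \<Otimes>\<^sub>M M2)" "(\<lambda>p. \<xi>' (\<theta> p)) \<in> borel_measurable (M1 \<Otimes>\<^sub>M M2)"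
    "(\<lambda>p. \<zeta> (\<theta> p)) \<in> borel_measurable (M1 \<Otimes>\<^sub>M M2)"
    by (rule l2_funs_measurable[OF measure_iso_l2[OF iso]], fact)+
  then show "(\<lambda>p. \<zeta> (\<theta> p)) \<in> borel_measurable (M1 \<Otimes>\<^sub>M M2)" by blast
qed simp

text \<open>Any fibrewise image computes the leg operator, whichever one the choice in its
  definition picks, because two such images differ on a null set only.\<close>

lemma leg_op_class:
  assumes \<xi>: "\<xi> \<in> l2_funs M" and \<zeta>: "\<zeta> \<in> l2_funs M"
    and fib: "fibrewise M1 M2 S (\<lambda>p. \<xi> (\<theta> p)) (\<lambda>p. \<zeta> (\<theta> p))"
  shows "leg_op M1 M2 M \<theta> S (l2_class M \<xi>) = l2_class M \<zeta>"
proof -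
  have "leg_op M1 M2 M \<theta> S (l2_class M \<xi>) = l2_class M (SOME \<zeta>. \<zeta> \<in> l2_funs M \<and>
     fibrewise M1 M2 S (\<lambda>p. \<xi> (\<theta> p)) (\<lambda>p. \<zeta> (\<theta> p)))"
    unfolding leg_op_def
  proof (rule fun_op_class[OF _ _ \<xi>])
    fix f g assume f: "f \<in> l2_funs M" and g: "g \<in> l2_funs M" and ae: "AE p in M. f p = g p"
    show "AE p in M. (SOME \<zeta>. \<zeta> \<in> l2_funs M \<and> fibrewise M1 M2 S (\<lambda>p. f (\<theta> p)) (\<lambda>p. \<zeta> (\<theta> p))) p
      = (SOME \<zeta>. \<zeta> \<in> l2_funs M \<and> fibrewise M1 M2 S (\<lambda>p. g (\<theta> p)) (\<lambda>p. \<zeta> (\<theta> p))) p"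
      by (rule leg_unique[OF conjunct1[OF leg_fun[OF f]] conjunct1[OF leg_fun[OF g]]
        leg_cong[OF f g ae conjunct1[OF leg_fun[OF f]] conjunct2[OF leg_fun[OF f]]] conjunct2[OF leg_fun[OF g]]])
  qed (use leg_fun in blast)
  also have "\<dots> = l2_class M \<zeta>"
    using leg_unique[OF conjunct1[OF leg_fun[OF \<xi>]] \<zeta> conjunct2[OF leg_fun[OF \<xi>]] fib]
    unfolding l2_class_eq_iff[OF conjunct1[OF leg_fun[OF \<xi>]]] .
  finally show ?thesis .
qed

lemma leg_op_bounded: "leg_op M1 M2 M \<theta> S \<in> bounded_ops M"
proof -
  let ?F = "\<lambda>\<xi>. SOME \<zeta>. \<zeta> \<in> l2_funs M \<and> fibrewise M1 M2 S (\<lambda>p. \<xi> (\<theta> p)) (\<lambda>p. \<zeta> (\<theta> p))"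
  have F: "?F f \<in> l2_funs M" and fibF: "fibrewise M1 M2 S (\<lambda>p. f (\<theta> p)) (\<lambda>p. ?F f (\<theta> p))"
    if "f \<in> l2_funs M" for f using leg_fun[OF that] by auto
  obtain C where C: "0 \<le> C" "\<And>f. f \<in> l2_funs M2 \<Longrightarrow> l2sq M2 (op_fun M2 S f) \<le> ennreal C * l2sq M2 f"
    using op_fun_bound[OF S] by blast
  show ?thesis
    unfolding leg_op_def
  proof (rule fun_op_bounded)
    fix f g assume f: "f \<in> l2_funs M" and g: "g \<in> l2_funs M"
    show "AE p in M. ?F f p = ?F g p" if "AE p in M. f p = g p"
      by (rule leg_unique[OF F[OF f] F[OF g] leg_cong[OF f g that F[OF f] fibF[OF f]] fibF[OF g]])
    show "AE p in M. ?F (\<lambda>x. f x + g x) p = ?F f p + ?F g p"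
      by (rule leg_unique[OF F[OF l2_funs_add[OF f g]] l2_funs_add[OF F[OF f] F[OF g]]
        fibF[OF l2_funs_add[OF f g]] fibrewise_add[OF S fibF[OF f] fibF[OF g]]])
  next
    fix c f assume f: "f \<in> l2_funs M"
    show "AE p in M. ?F (\<lambda>x. c * f x) p = c * ?F f p"
      by (rule leg_unique[OF F[OF l2_funs_cmult[OF f]] l2_funs_cmult[OF F[OF f]]
        fibF[OF l2_funs_cmult[OF f]] fibrewise_scale[OF S fibF[OF f]]])
  next
    fix f assume f: "f \<in> l2_funs M"
    show "?F f \<in> l2_funs M" using f by (rule F)
    have "l2sq (M1 \<Otimes>\<^sub>M M2) (\<lambda>p. ?F f (\<theta> p)) \<le> ennreal C * l2sq (M1 \<Otimes>\<^sub>M M2) (\<lambda>p. f (\<theta> p))"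
      by (rule fibrewise_bound[OF C(2) fibF[OF f] l2_funs_measurable[OF measure_iso_l2[OF iso f]]
            l2_funs_measurable[OF measure_iso_l2[OF iso F[OF f]]]])
    then show "l2sq M (?F f) \<le> ennreal C * l2sq M f"
      by (simp add: measure_iso_l2sq[OF iso] l2_funs_measurable f F)
  qed (rule C)
qed

end

end

section \<open>Adjoining a further variable\<close>

lemma AE_fst:
  assumes Q: "sigma_finite_measure Q" and ae: "AE a in A. P a"
  shows "AE p in A \<Otimes>\<^sub>M Q. P (fst p)"
proof -
  obtain N where N: "{a \<in> space A. \<not> P a} \<subseteq> N" "emeasure A N = 0" "N \<in> sets A"
    using ae by (rule AE_E)
  show ?thesis
  proof (rule AE_I)
    show "{p \<in> space (A \<Otimes>\<^sub>M Q). \<not> P (fst p)} \<subseteq> N \<times> space Q"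
      using N(1) by (auto simp: space_pair_measure)
    \<comment> \<open>The factor \<open>space Q\<close> may have infinite measure; the product is
      zero since 0 times infinity is 0 in \<open>ennreal\<close>.\<close>
    show "emeasure (A \<Otimes>\<^sub>M Q) (N \<times> space Q) = 0"
      using N by (simp add: sigma_finite_measure.emeasure_pair_measure_Times[OF Q])
    show "N \<times> space Q \<in> sets (A \<Otimes>\<^sub>M Q)" using N by simp
  qed
qed

lemma AE_snd:
  assumes A: "sigma_finite_measure A" and ae: "AE a in A. P a"
  shows "AE p in Q \<Otimes>\<^sub>M A. P (snd p)"
proof -
  obtain N where N: "{a \<in> space A. \<not> P a} \<subseteq> N" "emeasure A N = 0" "N \<in> sets A"
    using ae by (rule AE_E)
  show ?thesis
  proof (rule AE_I)
    show "{p \<in> space (Q \<Otimes>\<^sub>M A). \<not> P (snd p)} \<subseteq> space Q \<times> N"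
      using N(1) by (auto simp: space_pair_measure)
    show "emeasure (Q \<Otimes>\<^sub>M A) (space Q \<times> N) = 0"
      using N by (simp add: sigma_finite_measure.emeasure_pair_measure_Times[OF A])
    show "space Q \<times> N \<in> sets (Q \<Otimes>\<^sub>M A)" using N by simp
  qed
qed

text \<open>On each fibre the new variable contributes the constant factor \<open>v (snd y)\<close>,
  which passes through \<open>S\<close>. This lets an iterated amplification be recognised as a
  single leg.\<close>

lemma fibrewise_mult_snd:
  assumes S: "S \<in> bounded_ops B" and Q: "sigma_finite_measure Q" and fib: "fibrewise A B S \<xi> \<zeta>"
  shows "fibrewise (A \<Otimes>\<^sub>M Q) B S (\<lambda>(y, b). \<xi> (fst y, b) * v (snd y)) (\<lambda>(y, b). \<zeta> (fst y, b) * v (snd y))"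
  using AE_fst[OF Q fib[unfolded fibrewise_def]] unfolding fibrewise_def
proof eventually_elim
  case (elim y)
  then have l2: "(\<lambda>b. \<xi> (fst y, b)) \<in> l2_funs B"
    and ae: "AE b in B. op_fun B S (\<lambda>b. \<xi> (fst y, b)) b = \<zeta> (fst y, b)" by auto
  have "AE b in B. op_fun B S (\<lambda>b. v (snd y) * \<xi> (fst y, b)) b = v (snd y) * \<zeta> (fst y, b)"
    using op_fun_scale[OF S l2, of "v (snd y)"] ae by eventually_elim simp
  then show ?case using l2_funs_cmult[OF l2, of "v (snd y)"] by (simp add: mult.commute)
qed

lemma fibrewise_mult_fst:
  assumes S: "S \<in> bounded_ops B" and A: "sigma_finite_measure A" and fib: "fibrewise A B S \<xi> \<zeta>"
  shows "fibrewise (Q \<Otimes>\<^sub>M A) B S (\<lambda>(y, b). v (fst y) * \<xi> (snd y, b)) (\<lambda>(y, b). v (fst y) * \<zeta> (snd y, b))"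
  using AE_snd[OF A fib[unfolded fibrewise_def]] unfolding fibrewise_def
proof eventually_elim
  case (elim y)
  then have l2: "(\<lambda>b. \<xi> (snd y, b)) \<in> l2_funs B"
    and ae: "AE b in B. op_fun B S (\<lambda>b. \<xi> (snd y, b)) b = \<zeta> (snd y, b)" by auto
  have "AE b in B. op_fun B S (\<lambda>b. v (fst y) * \<xi> (snd y, b)) b = v (fst y) * \<zeta> (snd y, b)"
    using op_fun_scale[OF S l2, of "v (fst y)"] ae by eventually_elim simp
  then show ?case using l2_funs_cmult[OF l2, of "v (fst y)"] by simp
qed

text \<open>Fibrewise action is set up on the second factor, so acting on the first one requires the
  swap of variables.\<close>

lemma op_tensor_id_right:
  assumes sf: "sigma_finite_measure M" "sigma_finite_measure N" and S: "S \<in> bounded_ops M"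
  shows "op_tensor M N S (op_id N) = leg_op N M (M \<Otimes>\<^sub>M N) (\<lambda>(y, x). (x, y)) S"
proof -
  interpret MN: pair_sigma_finite M N using sf by (rule pair_sigma_finite.intro)
  interpret NM: pair_sigma_finite N M using sf by (intro pair_sigma_finite.intro)
  note iso = measure_iso_swap[OF sf]
  note leg = NM.leg_op_bounded[OF iso S] NM.leg_op_class[OF iso S]
  show ?thesis
  proof (rule MN.op_tensor_eqI[OF leg(1)])
    fix u v assume u: "u \<in> l2_funs M" and v: "v \<in> l2_funs N"
    have Su: "op_fun M S u \<in> l2_funs M" by (intro op_fun_in_l2_funs S u)
    have "fibrewise N M S (\<lambda>(y, x). v y * u x) (\<lambda>(y, x). v y * op_fun M S u x)"
      by (rule NM.fibrewise_product[OF S u Su]) simp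
    then have "leg_op N M (M \<Otimes>\<^sub>M N) (\<lambda>(y, x). (x, y)) S (l2_class (M \<Otimes>\<^sub>M N) (\<lambda>(x, y). u x * v y))
        = l2_class (M \<Otimes>\<^sub>M N) (\<lambda>(x, y). op_fun M S u x * v y)"
      by (intro leg(2) MN.l2_product u v Su) (simp add: case_prod_unfold mult.commute)
    then show "leg_op N M (M \<Otimes>\<^sub>M N) (\<lambda>(y, x). (x, y)) S (l2_class (M \<Otimes>\<^sub>M N) (\<lambda>(x, y). u x * v y))
        = l2_tensor M N (S (l2_class M u)) (op_id N (l2_class N v))"
      by (simp add: op_id_class u v Su MN.l2_tensor_class class_op_fun[OF S u, symmetric])
  qed
qed

section \<open>Commutants\<close>

lemma commutant_subset_bounded: "commutant M A \<subseteq> bounded_ops M"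
  by (auto simp: commutant_def)

text \<open>Taking commutants reverses inclusions, and a set of bounded operators lies in its double
  commutant. Both facts are applied to \<open>A\<close> and to its commutant.\<close>

lemma triple_commutant:
  assumes "A \<subseteq> bounded_ops M"
  shows "commutant M (commutant M (commutant M A)) = commutant M A"
proof -
  have double: "B \<subseteq> commutant M (commutant M B)" if "B \<subseteq> bounded_ops M" for B
  proof
    fix T assume "T \<in> B"
    then show "T \<in> commutant M (commutant M B)" using that by (auto simp: commutant_def)
  qed
  have "commutant M C \<subseteq> commutant M B" if "B \<subseteq> C" for B C
    using that by (auto simp: commutant_def)
  then show ?thesis using double[OF assms] double[OF commutant_subset_bounded] by blast
qed

lemma inner_op_adjoint:
  assumes T: "T \<in> bounded_ops M" and f: "f \<in> l2_funs M" and g: "g \<in> l2_funs M"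
  shows "inner_fun M (op_fun M T f) g = inner_fun M f (op_fun M (op_adjoint M T) g)"
  using op_adjoint(2)[OF T g f] by (metis inner_fun_cnj)

lemma op_fun_mult:
  assumes T: "T \<in> bounded_ops M" and f: "f \<in> l2_funs M"
  shows "op_fun M (op_mult M S T) f = op_fun M S (op_fun M T f)"
  using assms by (simp add: op_fun_def op_mult_class l2_class_rep bounded_ops_L2 l2_class_in_L2)

text \<open>The double commutant condition is the triple commutant identity. For adjoints, moving S
  and the adjoint of T across the inner product reduces the claim to T commuting with the adjoint of
  S, which again belongs to \<open>A\<close>.\<close>

lemma von_neumann_algebra_commutant:
  assumes A: "A \<subseteq> bounded_ops M" and adj: "\<And>T. T \<in> A \<Longrightarrow> op_adjoint M T \<in> A"
  shows "von_neumann_algebra M (commutant M A)"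
  unfolding von_neumann_algebra_def
proof (intro conjI ballI commutant_subset_bounded triple_commutant A)
  fix T assume T': "T \<in> commutant M A"
  then have T: "T \<in> bounded_ops M" by (simp add: commutant_def)
  have Ts: "op_adjoint M T \<in> bounded_ops M" by (rule op_adjoint(1)[OF T])
  have "op_mult M S (op_adjoint M T) = op_mult M (op_adjoint M T) S" if SA: "S \<in> A" for S
  proof -
    have S: "S \<in> bounded_ops M" and Ss: "op_adjoint M S \<in> bounded_ops M"
      using SA A adj[OF SA] by auto
    note b = op_mult_bounded[OF S Ts] op_mult_bounded[OF Ts S]
    note in_l2 = op_fun_in_l2_funs[OF T] op_fun_in_l2_funs[OF Ts] op_fun_in_l2_funs[OF S]
      op_fun_in_l2_funs[OF Ss]
    have comm: "op_fun M T (op_fun M (op_adjoint M S) g) = op_fun M (op_adjoint M S) (op_fun M T g)"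
      if g: "g \<in> l2_funs M" for g
      using T' adj[OF SA] op_fun_mult[OF Ss g, of T] op_fun_mult[OF T g, of "op_adjoint M S"]
      by (simp add: commutant_def)
    show ?thesis
    proof (rule bounded_ops_eqI[OF b])
      fix f assume f: "f \<in> l2_funs M"
      have "AE x in M. op_fun M S (op_fun M (op_adjoint M T) f) x = op_fun M (op_adjoint M T) (op_fun M S f) x"
      proof (rule inner_fun_eqI)
        fix g assume g: "g \<in> l2_funs M"
        show "inner_fun M (op_fun M S (op_fun M (op_adjoint M T) f)) g
            = inner_fun M (op_fun M (op_adjoint M T) (op_fun M S f)) g"
          by (simp add: inner_op_adjoint[OF S] op_adjoint(2)[OF T] in_l2 f g comm)
      qed (intro in_l2 f)+
      then have "l2_class M (op_fun M S (op_fun M (op_adjoint M T) f))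
          = l2_class M (op_fun M (op_adjoint M T) (op_fun M S f))"
        by (subst l2_class_eq_iff) (intro in_l2 f)
      then show "op_mult M S (op_adjoint M T) (l2_class M f) = op_mult M (op_adjoint M T) S (l2_class M f)"
        by (simp add: op_mult_class f class_op_fun S Ts in_l2)
    qed
  qed
  then show "op_adjoint M T \<in> commutant M A" using Ts by (simp add: commutant_def)
qed

lemma op_mult_scale_id:
  assumes T: "T \<in> bounded_ops M"
  shows "op_mult M T (op_scale M c (op_id M)) = op_mult M (op_scale M c (op_id M)) T"
proof (rule bounded_ops_eqI)
  fix f assume f: "f \<in> l2_funs M"
  have "T (l2_class M (\<lambda>x. c * f x)) = l2_class M (op_fun M T (\<lambda>x. c * f x))"
    by (simp add: class_op_fun T f l2_funs_cmult)
  also have "\<dots> = l2_class M (\<lambda>x. c * op_fun M T f x)"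
    using op_fun_scale[OF T f] by (subst l2_class_eq_iff) (auto intro: op_fun_in_l2_funs T l2_funs_cmult f)
  finally show "op_mult M T (op_scale M c (op_id M)) (l2_class M f) = op_mult M (op_scale M c (op_id M)) T (l2_class M f)"
    by (simp add: op_mult_class f op_scale_id_class class_op_fun[OF T f, symmetric] op_fun_in_l2_funs T)
qed (intro op_mult_bounded op_scale_id_bounded T)+

text \<open>Scalars commute with every bounded operator, hence lie in every double commutant. This
  puts the scalars into L(G_1) and the unit into M.\<close>

lemma scale_id_in_vn_generated: "op_scale M c (op_id M) \<in> vn_generated M X"
  unfolding vn_generated_def
proof (intro InterI, clarify)
  fix A assume "von_neumann_algebra M A"
  then have "A = commutant M (commutant M A)" by (simp add: von_neumann_algebra_def)
  moreover have "op_scale M c (op_id M) \<in> commutant M (commutant M A)"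
    using commutant_subset_bounded[of M A]
    by (auto simp: commutant_def[of M "commutant M A"] op_scale_id_bounded op_mult_scale_id)
  ultimately show "op_scale M c (op_id M) \<in> A" by simp
qed

lemma op_scale_one_id: "op_scale M 1 (op_id M) = op_id M"
  by (rule bounded_ops_eqI[of _ M]) (simp_all add: op_scale_id_bounded op_id_bounded op_scale_id_class op_id_class)

section \<open>Locally compact groups\<close>

lemma left_haar_space: "left_haar_measure \<mu> \<Longrightarrow> space \<mu> = UNIV"
  using sets_eq_imp_space_eq[of \<mu> borel] by (simp add: left_haar_measure_def)

text \<open>Open sets contained in compact sets cover the group, and by second countability
  countably many of them suffice; each has finite measure.\<close>

lemma left_haar_sigma_finite:
  fixes \<mu> :: "'g::locally_compact_group measure"
  assumes \<mu>: "left_haar_measure \<mu>"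
  shows "sigma_finite_measure \<mu>"
proof
  have s: "sets \<mu> = sets borel" and fin: "\<And>K. compact K \<Longrightarrow> emeasure \<mu> K < \<infinity>"
    using \<mu> by (auto simp: left_haar_measure_def)
  define \<U> where "\<U> = {U :: 'g set. open U \<and> (\<exists>K. compact K \<and> U \<subseteq> K)}"
  obtain \<V> where \<V>: "\<V> \<subseteq> \<U>" "countable \<V>" "\<Union>\<V> = \<Union>\<U>"
  proof (rule Lindelof[of \<U>])
    show "open S" if "S \<in> \<U>" for S using that by (simp add: \<U>_def)
  qed
  have "x \<in> \<Union>\<U>" for x
  proof -
    obtain U K where "open U" "compact K" "x \<in> U" "U \<subseteq> K"
      using compact_neighbourhood[of x] by (elim exE conjE)
    then show ?thesis unfolding \<U>_def by (intro UnionI[of U]) auto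
  qed
  then have "\<Union>\<U> = UNIV" by (intro UNIV_eq_I[symmetric])
  moreover have "emeasure \<mu> U \<noteq> \<infinity>" if "U \<in> \<V>" for U
  proof -
    have "U \<in> \<U>" using that \<V>(1) by (rule subsetD[rotated])
    then obtain K where K: "compact K" "U \<subseteq> K" unfolding \<U>_def by (elim CollectE conjE exE)
    have "K \<in> sets \<mu>" unfolding s by (intro borel_closed compact_imp_closed K)
    then have "emeasure \<mu> U \<le> emeasure \<mu> K" using K(2) by (intro emeasure_mono)
    then show ?thesis using fin[OF K(1)] by (auto simp: top_unique)
  qed
  moreover have "\<V> \<subseteq> sets \<mu>"
  proof
    fix U assume "U \<in> \<V>"
    then have "U \<in> \<U>" using \<V>(1) by (rule subsetD[rotated])
    then show "U \<in> sets \<mu>" by (simp add: \<U>_def s)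
  qed
  ultimately show "\<exists>A. countable A \<and> A \<subseteq> sets \<mu> \<and> \<Union>A = space \<mu> \<and> (\<forall>a\<in>A. emeasure \<mu> a \<noteq> \<infinity>)"
    using \<V>(2,3) left_haar_space[OF \<mu>] by (intro exI[of _ \<V>] conjI ballI) simp_all
qed

lemma exists_positive_finite_set:
  assumes \<mu>: "sigma_finite_measure \<mu>" and "emeasure \<mu> (space \<mu>) \<noteq> 0"
  obtains X where "X \<in> sets \<mu>" "emeasure \<mu> X < \<infinity>" "emeasure \<mu> X \<noteq> 0"
proof -
  obtain A :: "nat \<Rightarrow> _" where A: "range A \<subseteq> sets \<mu>" "(\<Union>i. A i) = space \<mu>" "\<And>i. emeasure \<mu> (A i) \<noteq> \<infinity>"
    by (rule sigma_finite_measure.sigma_finite[OF \<mu>]) (rule that)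
  have "\<exists>i. emeasure \<mu> (A i) \<noteq> 0"
  proof (rule ccontr)
    assume "\<not> ?thesis"
    then have "emeasure \<mu> (\<Union>i. A i) = 0" using A(1) by (intro emeasure_UN_eq_0) auto
    then show False using assms(2) A(2) by simp
  qed
  then obtain i where "emeasure \<mu> (A i) \<noteq> 0" by blast
  moreover have "A i \<in> sets \<mu>" using A(1) by blast
  moreover have "emeasure \<mu> (A i) < \<infinity>" using A(3) by (simp add: less_top)
  ultimately show thesis by (rule that[rotated 2])
qed

lemma AE_obtain_point:
  assumes "AE x in M. P x" "X \<in> sets M" "emeasure M X \<noteq> 0"
  shows "\<exists>x\<in>X. P x"
proof (rule ccontr)
  assume none: "\<not> ?thesis"
  from assms(1) have "AE x in M. x \<notin> X" by eventually_elim (use none in blast)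
  moreover have "{x \<in> space M. \<not> x \<notin> X} = X" using sets.sets_into_space[OF assms(2)] by auto
  ultimately have "emeasure M X = 0" using AE_iff_measurable[OF assms(2), of "\<lambda>x. x \<notin> X"] by simp
  then show False using assms(3) by simp
qed

lemma measurable_uminus_group:
  fixes f :: "'a \<Rightarrow> 'g::locally_compact_group"
  assumes "f \<in> borel_measurable M"
  shows "(\<lambda>x. - f x) \<in> borel_measurable M"
  by (rule borel_measurable_continuous_on[OF _ assms]) (intro continuous_intros)

lemma measurable_left_haar_iff:
  "left_haar_measure \<mu> \<Longrightarrow> f \<in> measurable M \<mu> \<longleftrightarrow> f \<in> borel_measurable M"
  by (rule arg_cong2[where f = "(\<in>)", OF refl measurable_cong_sets]) (auto simp: left_haar_measure_def)

lemma measure_iso_translation: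
  fixes \<mu> :: "'g::locally_compact_group measure"
  assumes \<mu>: "left_haar_measure \<mu>"
  shows "measure_iso \<mu> \<mu> (\<lambda>h. g + h) (\<lambda>h. - g + h)"
proof -
  have s: "sets \<mu> = sets borel" and inv: "distr \<mu> borel (\<lambda>x. g + x) = \<mu>"
    using \<mu> by (auto simp: left_haar_measure_def)
  have m: "(\<lambda>h. k + h) \<in> measurable \<mu> \<mu>" for k
  proof -
    have "(\<lambda>h. k + h) \<in> borel_measurable borel"
      by (intro borel_measurable_continuous_onI continuous_intros)
    then show ?thesis using s by (simp cong: measurable_cong_sets)
  qed
  have "distr \<mu> \<mu> (\<lambda>x. g + x) = distr \<mu> borel (\<lambda>x. g + x)" using s by (intro distr_cong) auto
  then show ?thesis unfolding measure_iso_def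
    by (auto simp: m inv add.assoc[symmetric])
qed

text \<open>Over a fixed \<open>y\<close> the map is left translation by the constant
  \<open>b y\<close>, so left invariance applies on every fibre, while measurability of
  \<open>b\<close> makes the whole map measurable.\<close>

lemma measure_iso_skew_translation:
  fixes \<mu> :: "'g::locally_compact_group measure"
  assumes \<mu>: "left_haar_measure \<mu>" and b: "b \<in> borel_measurable M"
  shows "measure_iso (M \<Otimes>\<^sub>M \<mu>) (M \<Otimes>\<^sub>M \<mu>) (\<lambda>(y, g). (y, b y + g)) (\<lambda>(y, g). (y, - b y + g))"
proof (rule measure_iso_fibred)
  have translate: "(\<lambda>(y, g). (y, c y + g)) \<in> measurable (M \<Otimes>\<^sub>M \<mu>) (M \<Otimes>\<^sub>M \<mu>)"
    if c: "c \<in> borel_measurable M" for c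
  proof -
    have "(\<lambda>p. c (fst p)) \<in> borel_measurable (M \<Otimes>\<^sub>M \<mu>)"
      using c by (rule measurable_compose[OF measurable_fst])
    moreover have "(\<lambda>p. snd p) \<in> borel_measurable (M \<Otimes>\<^sub>M \<mu>)"
      using measurable_snd[of M \<mu>] measurable_left_haar_iff[OF \<mu>] by blast
    ultimately have "(\<lambda>p. c (fst p) + snd p) \<in> measurable (M \<Otimes>\<^sub>M \<mu>) \<mu>"
      unfolding measurable_left_haar_iff[OF \<mu>] by (rule borel_measurable_add)
    then show ?thesis unfolding case_prod_unfold by (intro measurable_Pair measurable_fst)
  qed
  show "(\<lambda>(y, g). (y, b y + g)) \<in> measurable (M \<Otimes>\<^sub>M \<mu>) (M \<Otimes>\<^sub>M \<mu>)" by (rule translate[OF b])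
  show "(\<lambda>(y, g). (y, - b y + g)) \<in> measurable (M \<Otimes>\<^sub>M \<mu>) (M \<Otimes>\<^sub>M \<mu>)"
    by (rule translate[OF measurable_uminus_group[OF b]])
qed (rule left_haar_sigma_finite[OF \<mu>] measure_iso_translation[OF \<mu>])+

text \<open>The translations commute with each other and form a set closed under adjoints, so their
  commutant is a von Neumann algebra containing them. As L(G_1) is the smallest such algebra, it
  lies in this commutant.\<close>

lemma group_vn_algebra_commutes:
  fixes \<mu> :: "'g::locally_compact_group measure"
  assumes \<mu>: "left_haar_measure \<mu>" and abelian: "\<forall>x y :: 'g. x + y = y + x"
    and x: "x \<in> group_vn_algebra \<mu>"
  shows "x \<in> bounded_ops \<mu>"
    and "f \<in> l2_funs \<mu> \<Longrightarrow> AE h in \<mu>. op_fun \<mu> x (\<lambda>h. f (g + h)) h = op_fun \<mu> x f (g + h)"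
proof -
  \<comment> \<open>The group algebra is generated by right translations; commutativity rewrites
    them as left translations, under which the Haar measure is invariant.\<close>
  have trans: "group_translation \<mu> k = composition_op \<mu> (\<lambda>h. k + h)" for k
  proof -
    have "h + k = k + h" for h using abelian by blast
    then show ?thesis unfolding group_translation_def composition_op_def fun_op_def by (simp only:)
  qed
  note iso = measure_iso_translation[OF \<mu>]
  have bounded: "group_translation \<mu> k \<in> bounded_ops \<mu>" for k
    unfolding trans by (rule composition_op_bounded[OF iso])
  have commute: "op_mult \<mu> (group_translation \<mu> k) (group_translation \<mu> l)
      = op_mult \<mu> (group_translation \<mu> l) (group_translation \<mu> k)" for k l
  proof (rule bounded_ops_eqI[of _ \<mu>])
    fix f assume f: "f \<in> l2_funs \<mu>"
    have "k + (l + h) = l + (k + h)" for h using abelian by (metis add.assoc)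
    then show "op_mult \<mu> (group_translation \<mu> k) (group_translation \<mu> l) (l2_class \<mu> f)
      = op_mult \<mu> (group_translation \<mu> l) (group_translation \<mu> k) (l2_class \<mu> f)"
      by (simp add: op_mult_class f trans composition_op_class[OF iso] measure_iso_l2[OF iso])
  qed (intro op_mult_bounded bounded)+
  let ?A = "commutant \<mu> (range (group_translation \<mu>))"
  have "von_neumann_algebra \<mu> ?A"
  proof (rule von_neumann_algebra_commutant)
    show "range (group_translation \<mu>) \<subseteq> bounded_ops \<mu>" using bounded by blast
    have "op_adjoint \<mu> (group_translation \<mu> k) = group_translation \<mu> (- k)" for k
      by (simp only: trans op_adjoint_composition[OF iso])
    then show "op_adjoint \<mu> T \<in> range (group_translation \<mu>)" if "T \<in> range (group_translation \<mu>)" for T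
      using that by blast
  qed
  moreover have "range (group_translation \<mu>) \<subseteq> ?A"
    by (auto simp: commutant_def bounded commute)
  ultimately have xA: "x \<in> ?A" using x unfolding group_vn_algebra_def vn_generated_def by blast
  then show xb: "x \<in> bounded_ops \<mu>" by (simp add: commutant_def)
  show "AE h in \<mu>. op_fun \<mu> x (\<lambda>h. f (g + h)) h = op_fun \<mu> x f (g + h)" if f: "f \<in> l2_funs \<mu>"
  proof (rule op_fun_eqI)
    have xf: "op_fun \<mu> x f \<in> l2_funs \<mu>" by (rule op_fun_in_l2_funs[OF xb f])
    have "x (l2_class \<mu> (\<lambda>h. f (g + h))) = op_mult \<mu> x (group_translation \<mu> g) (l2_class \<mu> f)"
      by (simp add: op_mult_class f trans composition_op_class[OF iso])
    also have "\<dots> = op_mult \<mu> (group_translation \<mu> g) x (l2_class \<mu> f)"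
      using xA by (simp add: commutant_def)
    also have "\<dots> = l2_class \<mu> (\<lambda>h. op_fun \<mu> x f (g + h))"
      using composition_op_class[OF iso xf]
      by (simp add: op_mult_class f trans class_op_fun[OF xb f])
    finally show "x (l2_class \<mu> (\<lambda>h. f (g + h))) = l2_class \<mu> (\<lambda>h. op_fun \<mu> x f (g + h))" .
    show "(\<lambda>h. f (g + h)) \<in> l2_funs \<mu>" "(\<lambda>h. op_fun \<mu> x f (g + h)) \<in> l2_funs \<mu>"
      by (rule measure_iso_l2[OF iso], fact)+
  qed
qed

section \<open>The bicrossed product\<close>

locale bicrossed_data =
  fixes \<mu>\<^sub>1 :: "'a::locally_compact_group measure" and \<mu>\<^sub>2 :: "'b::locally_compact_group measure"
    and \<alpha> :: "'a \<Rightarrow> 'b \<Rightarrow> 'b" and \<beta> :: "'b \<Rightarrow> 'a \<Rightarrow> 'a"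
  assumes haar1: "left_haar_measure \<mu>\<^sub>1" and haar2: "left_haar_measure \<mu>\<^sub>2"
    and \<alpha>_measurable: "(\<lambda>(g, h). \<alpha> g h) \<in> borel_measurable (\<mu>\<^sub>1 \<Otimes>\<^sub>M \<mu>\<^sub>2)"
    and \<beta>_measurable: "(\<lambda>(g, h). \<beta> h g) \<in> borel_measurable (\<mu>\<^sub>1 \<Otimes>\<^sub>M \<mu>\<^sub>2)"
begin

abbreviation "\<nu> \<equiv> \<mu>\<^sub>1 \<Otimes>\<^sub>M \<mu>\<^sub>2"
abbreviation "\<pi> \<equiv> \<nu> \<Otimes>\<^sub>M \<nu>"

lemmas sf1 = left_haar_sigma_finite[OF haar1]
lemmas sf2 = left_haar_sigma_finite[OF haar2]
lemmas sf\<nu> = sigma_finite_pair_measure[OF sf1 sf2]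

text \<open>\<open>\<theta>1\<close> and \<open>\<theta>3\<close> single out the first and the third variable of \<open>((g, s), (h, t))\<close>, and \<open>\<theta>4\<close> the
  fourth.\<close>

definition "\<theta>1 = (\<lambda>((s, q), g). ((g, s), q))"
definition "\<theta>1' = (\<lambda>((g, s), q). ((s, q), g))"
definition "\<theta>3 = (\<lambda>((p, t), h). (p, (h, t)))"
definition "\<theta>3' = (\<lambda>(p, (h, t)). ((p, t), h))"
definition "\<theta>4 = (\<lambda>((p, h), t). (p, (h, t)))"
definition "\<theta>4' = (\<lambda>(p, (h, t)). ((p, h), t))"

lemma iso_\<theta>1: "measure_iso ((\<mu>\<^sub>2 \<Otimes>\<^sub>M \<nu>) \<Otimes>\<^sub>M \<mu>\<^sub>1) \<pi> \<theta>1 \<theta>1'"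
proof -
  have eq: "(\<lambda>x. (\<lambda>(x, y, z). ((x, y), z)) ((\<lambda>(y, x). (x, y)) x)) = \<theta>1"
    "(\<lambda>x. (\<lambda>(x, y). (y, x)) ((\<lambda>((x, y), z). (x, y, z)) x)) = \<theta>1'"
    by (auto simp: \<theta>1_def \<theta>1'_def fun_eq_iff)
  show ?thesis
    using measure_iso_comp[OF measure_iso_swap[OF sf1 sigma_finite_pair_measure[OF sf2 sf\<nu>]]
        measure_iso_sym[OF measure_iso_assoc[OF sf2 sf\<nu>, of \<mu>\<^sub>1]]]
    unfolding eq .
qed

lemma iso_\<theta>4: "measure_iso ((\<nu> \<Otimes>\<^sub>M \<mu>\<^sub>1) \<Otimes>\<^sub>M \<mu>\<^sub>2) \<pi> \<theta>4 \<theta>4'"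
  unfolding \<theta>4_def \<theta>4'_def by (rule measure_iso_assoc[OF sf1 sf2])

lemma iso_\<theta>3: "measure_iso ((\<nu> \<Otimes>\<^sub>M \<mu>\<^sub>2) \<Otimes>\<^sub>M \<mu>\<^sub>1) \<pi> \<theta>3 \<theta>3'"
proof -
  have eq: "(\<lambda>x. (\<lambda>(x, y). (x, (\<lambda>(y, x). (x, y)) y)) ((\<lambda>((x, y), z). (x, y, z)) x)) = \<theta>3"
    "(\<lambda>x. (\<lambda>(x, y, z). ((x, y), z)) ((\<lambda>(x, y). (x, (\<lambda>(x, y). (y, x)) y)) x)) = \<theta>3'"
    by (auto simp: \<theta>3_def \<theta>3'_def fun_eq_iff)
  show ?thesis
    using measure_iso_comp[OF measure_iso_assoc[OF sf2 sf1, of \<nu>]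
        measure_iso_snd[OF sigma_finite_pair_measure[OF sf2 sf1] sf\<nu> measure_iso_swap[OF sf1 sf2], of \<nu>]]
    unfolding eq .
qed

section \<open>The two skew translations that make up the bicrossed unitary\<close>

definition "twist\<^sub>\<alpha> = (\<lambda>((g, s), (h, t)). ((g, s), (h, - \<alpha> g s + t)))"
text \<open>The double inverse is kept so that the map is literally the inverse of the skew
  translation by \<open>- \<alpha> g s\<close>.\<close>

definition "twist\<^sub>\<alpha>' = (\<lambda>((g, s), (h, t)). ((g, s), (h, - (- \<alpha> g s) + t)))"
definition "twist\<^sub>\<beta> = (\<lambda>((g, s), (h, t)). ((\<beta> t h + g, s), (h, t)))"
definition "twist\<^sub>\<beta>' = (\<lambda>((g, s), (h, t)). ((- \<beta> t h + g, s), (h, t)))"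

lemma minus_\<alpha>_measurable: "(\<lambda>(g, s). - \<alpha> g s) \<in> borel_measurable \<nu>"
  using measurable_uminus_group[OF \<alpha>_measurable] by (simp add: case_prod_unfold)

text \<open>After \<open>\<theta>4'\<close> has moved t to the last place, this is a skew
  translation over the base ((g, s), h) whose amount depends on the first component only.\<close>

lemma iso_twist\<^sub>\<alpha>: "measure_iso \<pi> \<pi> twist\<^sub>\<alpha> twist\<^sub>\<alpha>'"
proof -
  have "(\<lambda>p. case fst p of (g, s) \<Rightarrow> - \<alpha> g s) \<in> borel_measurable (\<nu> \<Otimes>\<^sub>M \<mu>\<^sub>1)"
    by (rule measurable_compose[OF measurable_fst minus_\<alpha>_measurable])
  from measure_iso_comp[OF measure_iso_comp[OF measure_iso_sym[OF iso_\<theta>4]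
      measure_iso_skew_translation[OF haar2 this]] iso_\<theta>4]
  show ?thesis
  \<comment> \<open>The composed maps are replaced by the named ones in both arguments at once,
    which leaves an equality between two pairs of functions.\<close>
  proof (rule back_subst[of "\<lambda>F. measure_iso \<pi> \<pi> (fst F) (snd F)", where a = "(_, _)" and b = "(twist\<^sub>\<alpha>, twist\<^sub>\<alpha>')", unfolded fst_conv snd_conv])
  qed (auto simp: fun_eq_iff twist\<^sub>\<alpha>_def twist\<^sub>\<alpha>'_def \<theta>4_def \<theta>4'_def)
qed

lemma iso_twist\<^sub>\<beta>: "measure_iso \<pi> \<pi> twist\<^sub>\<beta> twist\<^sub>\<beta>'"
proof -
  have "(\<lambda>p. case snd p of (h, t) \<Rightarrow> \<beta> t h) \<in> borel_measurable (\<mu>\<^sub>2 \<Otimes>\<^sub>M \<nu>)"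
    by (rule measurable_compose[OF measurable_snd \<beta>_measurable])
  from measure_iso_comp[OF measure_iso_comp[OF measure_iso_sym[OF iso_\<theta>1]
      measure_iso_skew_translation[OF haar1 this]] iso_\<theta>1]
  show ?thesis
  proof (rule back_subst[of "\<lambda>F. measure_iso \<pi> \<pi> (fst F) (snd F)", where a = "(_, _)" and b = "(twist\<^sub>\<beta>, twist\<^sub>\<beta>')", unfolded fst_conv snd_conv])
  qed (auto simp: fun_eq_iff twist\<^sub>\<beta>_def twist\<^sub>\<beta>'_def \<theta>1_def \<theta>1'_def)
qed

lemmas iso_twist = measure_iso_comp[OF iso_twist\<^sub>\<alpha> iso_twist\<^sub>\<beta>]

text \<open>The amount \<beta> is evaluated at the already translated fourth coordinate, so
  \<open>twist\<^sub>\<alpha>\<close> acts on the point before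
  \<open>twist\<^sub>\<beta>\<close>.\<close>

lemma bicrossed_unitary_eq:
  "bicrossed_unitary \<mu>\<^sub>1 \<mu>\<^sub>2 \<alpha> \<beta> = composition_op \<pi> (\<lambda>p. twist\<^sub>\<beta> (twist\<^sub>\<alpha> p))"
proof -
  have "(\<lambda>((g, s), h, t). k ((\<beta> (- \<alpha> g s + t) h + g, s), h, - \<alpha> g s + t)) = (\<lambda>p. k (twist\<^sub>\<beta> (twist\<^sub>\<alpha> p)))"
    for k :: "('a \<times> 'b) \<times> 'a \<times> 'b \<Rightarrow> complex"
    by (auto simp: fun_eq_iff twist\<^sub>\<beta>_def twist\<^sub>\<alpha>_def)
  then show ?thesis
    unfolding bicrossed_unitary_def Let_def composition_op_def fun_op_def by simp
qed

section \<open>The first and third legs of an operator on the first group\<close>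

context
  fixes x
  assumes x: "x \<in> bounded_ops \<mu>\<^sub>1"
begin

text \<open>The outer description is tested on products of u and v, but u is itself a general
  function of (g, s). Its image under the inner tensor product is therefore represented by a
  fibrewise image \<open>w\<close>, and \<open>v\<close> is then adjoined as a parameter
  factor.\<close>

lemma op_tensor_leg1:
  "op_tensor \<nu> \<nu> (op_tensor \<mu>\<^sub>1 \<mu>\<^sub>2 x (op_id \<mu>\<^sub>2)) (op_id \<nu>) = leg_op (\<mu>\<^sub>2 \<Otimes>\<^sub>M \<nu>) \<mu>\<^sub>1 \<pi> \<theta>1 x"
proof -
  interpret sw: pair_sigma_finite \<mu>\<^sub>2 \<mu>\<^sub>1 by (rule pair_sigma_finite.intro[OF sf2 sf1])
  interpret pi: pair_sigma_finite \<nu> \<nu> by (rule pair_sigma_finite.intro[OF sf\<nu> sf\<nu>])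
  interpret leg: pair_sigma_finite "\<mu>\<^sub>2 \<Otimes>\<^sub>M \<nu>" \<mu>\<^sub>1
    by (rule pair_sigma_finite.intro[OF sigma_finite_pair_measure[OF sf2 sf\<nu>] sf1])
  let ?X = "op_tensor \<mu>\<^sub>1 \<mu>\<^sub>2 x (op_id \<mu>\<^sub>2)"
  show ?thesis
  proof (rule pi.op_tensor_eqI[OF leg.leg_op_bounded[OF iso_\<theta>1 x]])
    fix u v assume u: "u \<in> l2_funs \<nu>" and v: "v \<in> l2_funs \<nu>"
    obtain w where w: "w \<in> l2_funs \<nu>"
      and fib: "fibrewise \<mu>\<^sub>2 \<mu>\<^sub>1 x (\<lambda>p. u ((\<lambda>(y, x). (x, y)) p)) (\<lambda>p. w ((\<lambda>(y, x). (x, y)) p))"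
      using sw.leg_exists[OF measure_iso_swap[OF sf1 sf2] x u] by blast
    have X: "?X (l2_class \<nu> u) = l2_class \<nu> w"
      unfolding op_tensor_id_right[OF sf1 sf2 x]
      by (rule sw.leg_op_class[OF measure_iso_swap[OF sf1 sf2] x u w fib])
    have "fibrewise (\<mu>\<^sub>2 \<Otimes>\<^sub>M \<nu>) \<mu>\<^sub>1 x (\<lambda>p. (\<lambda>(x, y). u x * v y) (\<theta>1 p)) (\<lambda>p. (\<lambda>(x, y). w x * v y) (\<theta>1 p))"
      using fibrewise_mult_snd[OF x sf\<nu> fib, of v]
      by (simp add: \<theta>1_def case_prod_unfold)
    then have "leg_op (\<mu>\<^sub>2 \<Otimes>\<^sub>M \<nu>) \<mu>\<^sub>1 \<pi> \<theta>1 x (l2_class \<pi> (\<lambda>(x, y). u x * v y)) = l2_class \<pi> (\<lambda>(x, y). w x * v y)"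
      by (rule leg.leg_op_class[OF iso_\<theta>1 x pi.l2_product[OF u v] pi.l2_product[OF w v]])
    then show "leg_op (\<mu>\<^sub>2 \<Otimes>\<^sub>M \<nu>) \<mu>\<^sub>1 \<pi> \<theta>1 x (l2_class \<pi> (\<lambda>(x, y). u x * v y)) =
        l2_tensor \<nu> \<nu> (?X (l2_class \<nu> u)) (op_id \<nu> (l2_class \<nu> v))"
      by (simp only: X op_id_class[OF v] pi.l2_tensor_class[OF w v])
  qed
qed

lemma op_tensor_leg3:
  "op_tensor \<nu> \<nu> (op_id \<nu>) (op_tensor \<mu>\<^sub>1 \<mu>\<^sub>2 x (op_id \<mu>\<^sub>2)) = leg_op (\<nu> \<Otimes>\<^sub>M \<mu>\<^sub>2) \<mu>\<^sub>1 \<pi> \<theta>3 x"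
proof -
  interpret sw: pair_sigma_finite \<mu>\<^sub>2 \<mu>\<^sub>1 by (rule pair_sigma_finite.intro[OF sf2 sf1])
  interpret pi: pair_sigma_finite \<nu> \<nu> by (rule pair_sigma_finite.intro[OF sf\<nu> sf\<nu>])
  interpret leg: pair_sigma_finite "\<nu> \<Otimes>\<^sub>M \<mu>\<^sub>2" \<mu>\<^sub>1
    by (rule pair_sigma_finite.intro[OF sigma_finite_pair_measure[OF sf\<nu> sf2] sf1])
  let ?X = "op_tensor \<mu>\<^sub>1 \<mu>\<^sub>2 x (op_id \<mu>\<^sub>2)"
  show ?thesis
  proof (rule pi.op_tensor_eqI[OF leg.leg_op_bounded[OF iso_\<theta>3 x]])
    fix v u assume v: "v \<in> l2_funs \<nu>" and u: "u \<in> l2_funs \<nu>"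
    obtain w where w: "w \<in> l2_funs \<nu>"
      and fib: "fibrewise \<mu>\<^sub>2 \<mu>\<^sub>1 x (\<lambda>p. u ((\<lambda>(y, x). (x, y)) p)) (\<lambda>p. w ((\<lambda>(y, x). (x, y)) p))"
      using sw.leg_exists[OF measure_iso_swap[OF sf1 sf2] x u] by blast
    have X: "?X (l2_class \<nu> u) = l2_class \<nu> w"
      unfolding op_tensor_id_right[OF sf1 sf2 x]
      by (rule sw.leg_op_class[OF measure_iso_swap[OF sf1 sf2] x u w fib])
    have "fibrewise (\<nu> \<Otimes>\<^sub>M \<mu>\<^sub>2) \<mu>\<^sub>1 x (\<lambda>p. (\<lambda>(x, y). v x * u y) (\<theta>3 p)) (\<lambda>p. (\<lambda>(x, y). v x * w y) (\<theta>3 p))"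
      using fibrewise_mult_fst[OF x sf2 fib, of \<nu> v]
      by (simp add: \<theta>3_def case_prod_unfold)
    then have "leg_op (\<nu> \<Otimes>\<^sub>M \<mu>\<^sub>2) \<mu>\<^sub>1 \<pi> \<theta>3 x (l2_class \<pi> (\<lambda>(x, y). v x * u y)) = l2_class \<pi> (\<lambda>(x, y). v x * w y)"
      by (rule leg.leg_op_class[OF iso_\<theta>3 x pi.l2_product[OF v u] pi.l2_product[OF v w]])
    then show "leg_op (\<nu> \<Otimes>\<^sub>M \<mu>\<^sub>2) \<mu>\<^sub>1 \<pi> \<theta>3 x (l2_class \<pi> (\<lambda>(x, y). v x * u y)) =
        l2_tensor \<nu> \<nu> (op_id \<nu> (l2_class \<nu> v)) (?X (l2_class \<nu> u))"
      by (simp only: X op_id_class[OF v] pi.l2_tensor_class[OF v w])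
  qed
qed

text \<open>Conjugating the third leg by W gives the first leg. The third leg passes through
  \<open>twist\<^sub>\<alpha>\<close> and the first through \<open>twist\<^sub>\<beta>\<close>; once
  both are commuted past their twists, the twists cancel and the legs themselves coincide.\<close>

lemma legs_eq:
  assumes translation: "\<And>f g. f \<in> l2_funs \<mu>\<^sub>1 \<Longrightarrow> AE h in \<mu>\<^sub>1. op_fun \<mu>\<^sub>1 x (\<lambda>h. f (g + h)) h = op_fun \<mu>\<^sub>1 x f (g + h)"
    and comult: "bicrossed_comult \<mu>\<^sub>1 \<mu>\<^sub>2 \<alpha> \<beta> (op_tensor \<mu>\<^sub>1 \<mu>\<^sub>2 x (op_id \<mu>\<^sub>2))
      = op_tensor \<nu> \<nu> (op_tensor \<mu>\<^sub>1 \<mu>\<^sub>2 x (op_id \<mu>\<^sub>2)) (op_id \<nu>)"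
    and f: "f \<in> l2_funs \<pi>"
  shows "leg_op (\<nu> \<Otimes>\<^sub>M \<mu>\<^sub>2) \<mu>\<^sub>1 \<pi> \<theta>3 x (l2_class \<pi> f) = leg_op (\<mu>\<^sub>2 \<Otimes>\<^sub>M \<nu>) \<mu>\<^sub>1 \<pi> \<theta>1 x (l2_class \<pi> f)"
proof -
  interpret l1: pair_sigma_finite "\<mu>\<^sub>2 \<Otimes>\<^sub>M \<nu>" \<mu>\<^sub>1
    by (rule pair_sigma_finite.intro[OF sigma_finite_pair_measure[OF sf2 sf\<nu>] sf1])
  interpret l3: pair_sigma_finite "\<nu> \<Otimes>\<^sub>M \<mu>\<^sub>2" \<mu>\<^sub>1
    by (rule pair_sigma_finite.intro[OF sigma_finite_pair_measure[OF sf\<nu> sf2] sf1])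
  let ?x1 = "leg_op (\<mu>\<^sub>2 \<Otimes>\<^sub>M \<nu>) \<mu>\<^sub>1 \<pi> \<theta>1 x" and ?x3 = "leg_op (\<nu> \<Otimes>\<^sub>M \<mu>\<^sub>2) \<mu>\<^sub>1 \<pi> \<theta>3 x"
  let ?\<Phi> = "\<lambda>p. twist\<^sub>\<beta> (twist\<^sub>\<alpha> p)" and ?\<Phi>' = "\<lambda>p. twist\<^sub>\<alpha>' (twist\<^sub>\<beta>' p)"
  note x1 = l1.leg_op_class[OF iso_\<theta>1 x] and x3 = l3.leg_op_class[OF iso_\<theta>3 x]
  note l2_\<alpha> = measure_iso_l2[OF iso_twist\<^sub>\<alpha>] and l2_\<beta> = measure_iso_l2[OF iso_twist\<^sub>\<beta>]
    and l2_\<beta>' = measure_iso_l2[OF measure_iso_sym[OF iso_twist\<^sub>\<beta>]]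
  \<comment> \<open>Chosen so that W sends \<open>F\<close> to f composed with
    \<open>twist\<^sub>\<alpha>\<close> alone.\<close>
  define F where "F = (\<lambda>p. f (twist\<^sub>\<beta>' p))"
  have F: "F \<in> l2_funs \<pi>" unfolding F_def by (rule l2_\<beta>'[OF f])
  have F_\<beta>: "F (twist\<^sub>\<beta> p) = f p" for p by (simp add: F_def measure_iso_inverse[OF iso_twist\<^sub>\<beta>])
  obtain \<zeta> where \<zeta>: "\<zeta> \<in> l2_funs \<pi>" "fibrewise (\<mu>\<^sub>2 \<Otimes>\<^sub>M \<nu>) \<mu>\<^sub>1 x (\<lambda>p. F (\<theta>1 p)) (\<lambda>p. \<zeta> (\<theta>1 p))"
    using l1.leg_exists[OF iso_\<theta>1 x F] by blast
  have "fibrewise (\<mu>\<^sub>2 \<Otimes>\<^sub>M \<nu>) \<mu>\<^sub>1 x (\<lambda>p. f (\<theta>1 p)) (\<lambda>p. \<zeta> (twist\<^sub>\<beta> (\<theta>1 p)))"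
    using \<zeta>(2) unfolding fibrewise_def
  proof eventually_elim
    case (elim y)
    obtain s h t where y: "y = (s, h, t)" by (cases y)
    \<comment> \<open>The fibre \<open>y\<close> fixes h and t, so the skew translation of g becomes
      translation by this constant and the assumption on translations applies.\<close>
    define b where "b = \<beta> t h"
    have eq: "twist\<^sub>\<beta> (\<theta>1 (y, g)) = \<theta>1 (y, b + g)" for g
      by (simp add: y twist\<^sub>\<beta>_def \<theta>1_def b_def)
    have feq: "f (\<theta>1 (y, g)) = F (\<theta>1 (y, b + g))" for g by (simp add: F_\<beta> flip: eq)
    note iso = measure_iso_translation[OF haar1, of b]
    have l2: "(\<lambda>g. F (\<theta>1 (y, g))) \<in> l2_funs \<mu>\<^sub>1" using elim by simp
    have "AE g in \<mu>\<^sub>1. op_fun \<mu>\<^sub>1 x (\<lambda>g. F (\<theta>1 (y, g))) (b + g) = \<zeta> (\<theta>1 (y, b + g))"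
      using measure_iso_AE[OF iso conjunct2[OF elim]] .
    with translation[OF l2, of b]
    have "AE g in \<mu>\<^sub>1. op_fun \<mu>\<^sub>1 x (\<lambda>g. F (\<theta>1 (y, b + g))) g = \<zeta> (\<theta>1 (y, b + g))"
      by eventually_elim simp
    then show ?case using measure_iso_l2[OF iso l2] by (simp add: eq feq)
  qed
  then have x1f: "?x1 (l2_class \<pi> f) = l2_class \<pi> (\<lambda>p. \<zeta> (twist\<^sub>\<beta> p))"
    by (rule x1[OF f l2_\<beta>[OF \<zeta>(1)]])
  obtain \<eta> where \<eta>: "\<eta> \<in> l2_funs \<pi>" "fibrewise (\<nu> \<Otimes>\<^sub>M \<mu>\<^sub>2) \<mu>\<^sub>1 x (\<lambda>p. f (\<theta>3 p)) (\<lambda>p. \<eta> (\<theta>3 p))"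
    using l3.leg_exists[OF iso_\<theta>3 x f] by blast
  \<comment> \<open>\<open>twist\<^sub>\<alpha>\<close> leaves h alone and only moves the base point
    of the fibre. The move preserves the measure on the base, so a property of almost every fibre is
    carried over.\<close>
  have "fibrewise (\<nu> \<Otimes>\<^sub>M \<mu>\<^sub>2) \<mu>\<^sub>1 x (\<lambda>p. f (twist\<^sub>\<alpha> (\<theta>3 p))) (\<lambda>p. \<eta> (twist\<^sub>\<alpha> (\<theta>3 p)))"
    using measure_iso_AE[OF measure_iso_skew_translation[OF haar2 minus_\<alpha>_measurable] \<eta>(2)[unfolded fibrewise_def]]
    unfolding fibrewise_def
  proof eventually_elim
    case (elim y)
    have eq: "twist\<^sub>\<alpha> (\<theta>3 (y, h)) = \<theta>3 ((case y of (p, t) \<Rightarrow> (p, (case p of (g, s) \<Rightarrow> - \<alpha> g s) + t)), h)" for h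
      by (simp add: twist\<^sub>\<alpha>_def \<theta>3_def split: prod.split)
    show ?case using elim unfolding eq .
  qed
  then have x3f: "?x3 (l2_class \<pi> (\<lambda>p. f (twist\<^sub>\<alpha> p))) = l2_class \<pi> (\<lambda>p. \<eta> (twist\<^sub>\<alpha> p))"
    by (rule x3[OF l2_\<alpha>[OF f] l2_\<alpha>[OF \<eta>(1)]])
  have W: "composition_op \<pi> ?\<Phi> (l2_class \<pi> k) = l2_class \<pi> (\<lambda>p. k (?\<Phi> p))" if "k \<in> l2_funs \<pi>" for k
    by (rule composition_op_class[OF iso_twist that])
  have W': "composition_op \<pi> ?\<Phi>' (l2_class \<pi> k) = l2_class \<pi> (\<lambda>p. k (?\<Phi>' p))" if "k \<in> l2_funs \<pi>" for k
    by (rule composition_op_class[OF measure_iso_sym[OF iso_twist] that])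
  \<comment> \<open>Invariance evaluated at \<open>F\<close>: on the right, W, the third leg and the
    adjoint of W are applied in turn, and \<open>twist\<^sub>\<alpha>\<close> cancels against its
    inverse.\<close>
  have "?x1 (l2_class \<pi> F) = composition_op \<pi> ?\<Phi>' (?x3 (composition_op \<pi> ?\<Phi> (l2_class \<pi> F)))"
    using fun_cong[OF comult, of "l2_class \<pi> F"]
    by (simp add: op_tensor_leg1 op_tensor_leg3 bicrossed_comult_def Let_def bicrossed_unitary_eq
        op_adjoint_composition[OF iso_twist] op_mult_class F)
  also have "composition_op \<pi> ?\<Phi> (l2_class \<pi> F) = l2_class \<pi> (\<lambda>p. f (twist\<^sub>\<alpha> p))"
    by (simp add: W F F_\<beta>)
  also have "composition_op \<pi> ?\<Phi>' (?x3 \<dots>) = l2_class \<pi> (\<lambda>p. \<eta> (twist\<^sub>\<alpha> (?\<Phi>' p)))"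
    by (simp only: x3f W' l2_\<alpha>[OF \<eta>(1)])
  also have "(\<lambda>p. \<eta> (twist\<^sub>\<alpha> (?\<Phi>' p))) = (\<lambda>p. \<eta> (twist\<^sub>\<beta>' p))"
    by (simp add: measure_iso_inverse[OF iso_twist\<^sub>\<alpha>])
  finally have "l2_class \<pi> \<zeta> = l2_class \<pi> (\<lambda>p. \<eta> (twist\<^sub>\<beta>' p))"
    by (simp add: x1[OF F \<zeta>])
  then have "AE p in \<pi>. \<zeta> p = \<eta> (twist\<^sub>\<beta>' p)" by (simp add: l2_class_eq_iff \<zeta>)
  from measure_iso_AE[OF iso_twist\<^sub>\<beta> this] have "AE p in \<pi>. \<zeta> (twist\<^sub>\<beta> p) = \<eta> p"
    by (simp add: measure_iso_inverse[OF iso_twist\<^sub>\<beta>])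
  then have "l2_class \<pi> (\<lambda>p. \<zeta> (twist\<^sub>\<beta> p)) = l2_class \<pi> \<eta>"
    by (simp add: l2_class_eq_iff l2_\<beta>[OF \<zeta>(1)])
  then show ?thesis by (simp add: x1f x3[OF f \<eta>])
qed

text \<open>On product functions the equality of legs reads (x u)(g) v(h) = u(g) (x v)(h) wherever
  the factors in s and t are nonzero. Hence x v is proportional to v, and then every x u is the same
  multiple of u.\<close>

lemma scalar_of_legs_eq:
  assumes legs: "\<And>f. f \<in> l2_funs \<pi> \<Longrightarrow>
    leg_op (\<nu> \<Otimes>\<^sub>M \<mu>\<^sub>2) \<mu>\<^sub>1 \<pi> \<theta>3 x (l2_class \<pi> f) = leg_op (\<mu>\<^sub>2 \<Otimes>\<^sub>M \<nu>) \<mu>\<^sub>1 \<pi> \<theta>1 x (l2_class \<pi> f)"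
  obtains c where "x = op_scale \<mu>\<^sub>1 c (op_id \<mu>\<^sub>1)"
proof -
  interpret p12: pair_sigma_finite \<mu>\<^sub>1 \<mu>\<^sub>2 by (rule pair_sigma_finite.intro[OF sf1 sf2])
  interpret pi: pair_sigma_finite \<nu> \<nu> by (rule pair_sigma_finite.intro[OF sf\<nu> sf\<nu>])
  interpret l1: pair_sigma_finite "\<mu>\<^sub>2 \<Otimes>\<^sub>M \<nu>" \<mu>\<^sub>1
    by (rule pair_sigma_finite.intro[OF sigma_finite_pair_measure[OF sf2 sf\<nu>] sf1])
  interpret l3: pair_sigma_finite "\<nu> \<Otimes>\<^sub>M \<mu>\<^sub>2" \<mu>\<^sub>1
    by (rule pair_sigma_finite.intro[OF sigma_finite_pair_measure[OF sf\<nu> sf2] sf1])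
  obtain X where X: "X \<in> sets \<mu>\<^sub>1" "emeasure \<mu>\<^sub>1 X < \<infinity>" "emeasure \<mu>\<^sub>1 X \<noteq> 0"
    using haar1 left_haar_space[OF haar1] exists_positive_finite_set[OF sf1]
    by (auto simp: left_haar_measure_def)
  obtain Y where Y: "Y \<in> sets \<mu>\<^sub>2" "emeasure \<mu>\<^sub>2 Y < \<infinity>" "emeasure \<mu>\<^sub>2 Y \<noteq> 0"
    using haar2 left_haar_space[OF haar2] exists_positive_finite_set[OF sf2]
    by (auto simp: left_haar_measure_def)
  define v :: "'a \<Rightarrow> complex" where "v = indicator X"
  define w :: "'b \<Rightarrow> complex" where "w = indicator Y"
  have v: "v \<in> l2_funs \<mu>\<^sub>1" unfolding v_def by (rule l2_funs_indicator[OF X(1,2)])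
  have w: "w \<in> l2_funs \<mu>\<^sub>2" unfolding w_def by (rule l2_funs_indicator[OF Y(1,2)])
  \<comment> \<open>The value forced by pairing with \<open>v\<close> in the variable h; it involves
    \<open>v\<close> only, so it serves for all \<open>u\<close>.\<close>
  define c where "c = inner_fun \<mu>\<^sub>1 v (op_fun \<mu>\<^sub>1 x v) / inner_fun \<mu>\<^sub>1 v v"
  have vv: "inner_fun \<mu>\<^sub>1 v v \<noteq> 0"
  proof
    assume "inner_fun \<mu>\<^sub>1 v v = 0"
    then have "l2sq \<mu>\<^sub>1 v = 0" using inner_fun_self(2)[OF v] by simp
    then have "AE h in \<mu>\<^sub>1. v h = 0" using v by (simp add: l2sq_zero_iff l2_funs_measurable)
    from AE_obtain_point[OF this X(1,3)] show False by (auto simp: v_def)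
  qed
  have "AE g in \<mu>\<^sub>1. op_fun \<mu>\<^sub>1 x u g = c * u g" if u: "u \<in> l2_funs \<mu>\<^sub>1" for u
  proof -
    have xu: "op_fun \<mu>\<^sub>1 x u \<in> l2_funs \<mu>\<^sub>1" and xv: "op_fun \<mu>\<^sub>1 x v \<in> l2_funs \<mu>\<^sub>1"
      by (intro op_fun_in_l2_funs x u v)+
    \<comment> \<open>The fixed function \<open>w\<close> fills the two variables s and t, on which
      neither leg acts.\<close>
    let ?f = "\<lambda>u v. \<lambda>(p, q). (\<lambda>(g, s). u g * w s) p * (\<lambda>(h, t). v h * w t) q"
    have l2: "?f u v \<in> l2_funs \<pi>" if "u \<in> l2_funs \<mu>\<^sub>1" "v \<in> l2_funs \<mu>\<^sub>1" for u v
      by (intro pi.l2_product p12.l2_product that w)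
    have "fibrewise (\<mu>\<^sub>2 \<Otimes>\<^sub>M \<nu>) \<mu>\<^sub>1 x (\<lambda>p. ?f u v (\<theta>1 p)) (\<lambda>p. ?f (op_fun \<mu>\<^sub>1 x u) v (\<theta>1 p))"
      using l1.fibrewise_product[OF x u xu, of "\<lambda>(s, (h, t)). w s * (v h * w t)"]
      by (simp add: \<theta>1_def case_prod_unfold ac_simps)
    then have 1: "leg_op (\<mu>\<^sub>2 \<Otimes>\<^sub>M \<nu>) \<mu>\<^sub>1 \<pi> \<theta>1 x (l2_class \<pi> (?f u v)) = l2_class \<pi> (?f (op_fun \<mu>\<^sub>1 x u) v)"
      by (rule l1.leg_op_class[OF iso_\<theta>1 x l2[OF u v] l2[OF xu v]])
    have "fibrewise (\<nu> \<Otimes>\<^sub>M \<mu>\<^sub>2) \<mu>\<^sub>1 x (\<lambda>p. ?f u v (\<theta>3 p)) (\<lambda>p. ?f u (op_fun \<mu>\<^sub>1 x v) (\<theta>3 p))"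
      using l3.fibrewise_product[OF x v xv, of "\<lambda>((g, s), t). u g * w s * w t"]
      by (simp add: \<theta>3_def case_prod_unfold ac_simps)
    then have 3: "leg_op (\<nu> \<Otimes>\<^sub>M \<mu>\<^sub>2) \<mu>\<^sub>1 \<pi> \<theta>3 x (l2_class \<pi> (?f u v)) = l2_class \<pi> (?f u (op_fun \<mu>\<^sub>1 x v))"
      by (rule l3.leg_op_class[OF iso_\<theta>3 x l2[OF u v] l2[OF u xv]])
    have "l2_class \<pi> (?f (op_fun \<mu>\<^sub>1 x u) v) = l2_class \<pi> (?f u (op_fun \<mu>\<^sub>1 x v))"
      using legs[OF l2[OF u v]] unfolding 1 3 by (rule sym)
    then have "AE p in \<pi>. ?f (op_fun \<mu>\<^sub>1 x u) v p = ?f u (op_fun \<mu>\<^sub>1 x v) p"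
      unfolding l2_class_eq_iff[OF l2[OF xu v]] .
    \<comment> \<open>The variables s and t are removed by picking points of \<open>Y\<close>, a set
      of positive measure on which \<open>w\<close> equals 1.\<close>
    from p12.AE_pair[OF pi.AE_pair[OF this]] show ?thesis
    proof eventually_elim
      case (elim g)
      from AE_obtain_point[OF this Y(1,3)] obtain s where s: "s \<in> Y"
        and ae: "AE q in \<nu>. ?f (op_fun \<mu>\<^sub>1 x u) v ((g, s), q) = ?f u (op_fun \<mu>\<^sub>1 x v) ((g, s), q)"
        by blast
      have "AE h in \<mu>\<^sub>1. op_fun \<mu>\<^sub>1 x u g * v h = u g * op_fun \<mu>\<^sub>1 x v h"
        using p12.AE_pair[OF ae]
      proof eventually_elim
        case (elim h)
        from AE_obtain_point[OF this Y(1,3)] obtain t where "t \<in> Y"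
          and "?f (op_fun \<mu>\<^sub>1 x u) v ((g, s), (h, t)) = ?f u (op_fun \<mu>\<^sub>1 x v) ((g, s), (h, t))"
          by blast
        then show ?case using s by (simp add: w_def)
      qed
      then have "inner_fun \<mu>\<^sub>1 v (\<lambda>h. op_fun \<mu>\<^sub>1 x u g * v h) = inner_fun \<mu>\<^sub>1 v (\<lambda>h. u g * op_fun \<mu>\<^sub>1 x v h)"
        by (intro inner_fun_cong_AE l2_funs_cmult v xv) simp_all
      then show ?case using vv unfolding inner_fun_scale_right by (simp add: c_def field_simps)
    qed
  qed
  then have "x (l2_class \<mu>\<^sub>1 u) = op_scale \<mu>\<^sub>1 c (op_id \<mu>\<^sub>1) (l2_class \<mu>\<^sub>1 u)" if u: "u \<in> l2_funs \<mu>\<^sub>1" for u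
    unfolding class_op_fun[OF x u, symmetric] op_scale_id_class[OF u]
      l2_class_eq_iff[OF op_fun_in_l2_funs[OF x u]] using u by blast
  then show thesis by (intro that bounded_ops_eqI[OF x op_scale_id_bounded])
qed

end

end

text \<open>The values of \<open>\<gamma>\<close> and of the comultiplication act on different
  Hilbert spaces, so the formula for \<open>\<gamma>\<close> is read through \<open>\<iota>\<close>,
  the embedding of L(G_1) tensor M into M tensor M.\<close>

theorem proposition4p1:
  fixes \<mu>\<^sub>1 :: "'a::locally_compact_group measure"
    and \<mu>\<^sub>2 :: "'b::locally_compact_group measure"
    and \<mu> :: "'c::locally_compact_group measure"
    and i :: "'a \<Rightarrow> 'c" and j :: "'b \<Rightarrow> 'c"
    and \<alpha> :: "'a \<Rightarrow> 'b \<Rightarrow> 'b" and \<beta> :: "'b \<Rightarrow> 'a \<Rightarrow> 'a"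
    and \<gamma> :: "'a l2_op \<Rightarrow> ('a \<times> 'a \<times> 'b) l2_op"
    and \<iota> :: "('a \<times> 'a \<times> 'b) l2_op \<Rightarrow> (('a \<times> 'b) \<times> ('a \<times> 'b)) l2_op"
  assumes matched: "matched_pair \<mu>\<^sub>1 \<mu>\<^sub>2 \<mu> i j"
    and maps: "matched_pair_maps \<mu>\<^sub>1 \<mu>\<^sub>2 i j \<alpha> \<beta>"
    and abelian: "\<forall>x y :: 'a. x + y = y + x"
    and action: "vn_action \<mu>\<^sub>1 (group_vn_algebra \<mu>\<^sub>1)
        (\<mu>\<^sub>1 \<Otimes>\<^sub>M \<mu>\<^sub>2) (bicrossed_algebra \<mu>\<^sub>1 \<mu>\<^sub>2 \<alpha>) (bicrossed_comult \<mu>\<^sub>1 \<mu>\<^sub>2 \<alpha> \<beta>) \<gamma>"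
    and embedding: "is_tensor_hom \<mu>\<^sub>1 (group_vn_algebra \<mu>\<^sub>1)
        (\<mu>\<^sub>1 \<Otimes>\<^sub>M \<mu>\<^sub>2) (bicrossed_algebra \<mu>\<^sub>1 \<mu>\<^sub>2 \<alpha>)
        (\<mu>\<^sub>1 \<Otimes>\<^sub>M \<mu>\<^sub>2) (bicrossed_algebra \<mu>\<^sub>1 \<mu>\<^sub>2 \<alpha>)
        (\<mu>\<^sub>1 \<Otimes>\<^sub>M \<mu>\<^sub>2) (bicrossed_algebra \<mu>\<^sub>1 \<mu>\<^sub>2 \<alpha>)
        (\<lambda>x. op_tensor \<mu>\<^sub>1 \<mu>\<^sub>2 x (op_id \<mu>\<^sub>2)) (\<lambda>y. y) \<iota>"
    and formula: "\<forall>x\<in>group_vn_algebra \<mu>\<^sub>1.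
        \<iota> (\<gamma> x) = bicrossed_comult \<mu>\<^sub>1 \<mu>\<^sub>2 \<alpha> \<beta> (op_tensor \<mu>\<^sub>1 \<mu>\<^sub>2 x (op_id \<mu>\<^sub>2))"
  shows "ergodic_action \<mu>\<^sub>1 (group_vn_algebra \<mu>\<^sub>1) (\<mu>\<^sub>1 \<Otimes>\<^sub>M \<mu>\<^sub>2) \<gamma>"
proof -
  interpret bicrossed_data \<mu>\<^sub>1 \<mu>\<^sub>2 \<alpha> \<beta>
    using matched maps by unfold_locales (simp_all add: matched_pair_def matched_pair_maps_def)
  interpret act: pair_sigma_finite \<mu>\<^sub>1 \<nu> by (rule pair_sigma_finite.intro[OF sf1 sf\<nu>])
  show ?thesis
    unfolding ergodic_action_def
  proof (intro set_eqI iffI)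
    fix x assume "x \<in> {x \<in> group_vn_algebra \<mu>\<^sub>1. \<gamma> x = op_tensor \<mu>\<^sub>1 \<nu> x (op_id \<nu>)}"
    then have xN: "x \<in> group_vn_algebra \<mu>\<^sub>1" and inv: "\<gamma> x = op_tensor \<mu>\<^sub>1 \<nu> x (op_id \<nu>)" by auto
    note x = group_vn_algebra_commutes[OF haar1 abelian xN]
    \<comment> \<open>The unit must belong to M before the defining property of
      \<open>\<iota>\<close> can be applied to the elementary tensor of \<open>x\<close> and
      1.\<close>
    have "op_id \<nu> \<in> bicrossed_algebra \<mu>\<^sub>1 \<mu>\<^sub>2 \<alpha>"
      using scale_id_in_vn_generated[of \<nu> 1] by (simp add: op_scale_one_id bicrossed_algebra_def)
    then have "\<iota> (\<gamma> x) = op_tensor \<nu> \<nu> (op_tensor \<mu>\<^sub>1 \<mu>\<^sub>2 x (op_id \<mu>\<^sub>2)) (op_id \<nu>)"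
      unfolding inv using embedding xN by (simp add: is_tensor_hom_def)
    then have comult: "bicrossed_comult \<mu>\<^sub>1 \<mu>\<^sub>2 \<alpha> \<beta> (op_tensor \<mu>\<^sub>1 \<mu>\<^sub>2 x (op_id \<mu>\<^sub>2))
        = op_tensor \<nu> \<nu> (op_tensor \<mu>\<^sub>1 \<mu>\<^sub>2 x (op_id \<mu>\<^sub>2)) (op_id \<nu>)"
      using formula xN by simp
    obtain c where "x = op_scale \<mu>\<^sub>1 c (op_id \<mu>\<^sub>1)"
      using scalar_of_legs_eq[OF x(1) legs_eq[OF x(1,2) comult]] by blast
    then show "x \<in> {op_scale \<mu>\<^sub>1 c (op_id \<mu>\<^sub>1) | c. True}" by blast
  next
    fix x assume "x \<in> {op_scale \<mu>\<^sub>1 c (op_id \<mu>\<^sub>1) | c. True}"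
    then obtain c where x: "x = op_scale \<mu>\<^sub>1 c (op_id \<mu>\<^sub>1)" by blast
    \<comment> \<open>Scalars are fixed because \<open>\<gamma>\<close> is linear and
      unital.\<close>
    have N: "op_scale \<mu>\<^sub>1 d (op_id \<mu>\<^sub>1) \<in> group_vn_algebra \<mu>\<^sub>1" for d
      unfolding group_vn_algebra_def by (rule scale_id_in_vn_generated)
    have hom: "normal_unital_star_hom \<mu>\<^sub>1 (group_vn_algebra \<mu>\<^sub>1) (\<mu>\<^sub>1 \<Otimes>\<^sub>M \<nu>)
        (vn_tensor \<mu>\<^sub>1 (group_vn_algebra \<mu>\<^sub>1) \<nu> (bicrossed_algebra \<mu>\<^sub>1 \<mu>\<^sub>2 \<alpha>)) \<gamma>"
      using action by (simp add: vn_action_def)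
    have "op_id \<mu>\<^sub>1 \<in> group_vn_algebra \<mu>\<^sub>1" using N[of 1] by (simp add: op_scale_one_id)
    then have "\<gamma> x = op_scale (\<mu>\<^sub>1 \<Otimes>\<^sub>M \<nu>) c (op_id (\<mu>\<^sub>1 \<Otimes>\<^sub>M \<nu>))"
      using hom by (simp add: normal_unital_star_hom_def x)
    then show "x \<in> {x \<in> group_vn_algebra \<mu>\<^sub>1. \<gamma> x = op_tensor \<mu>\<^sub>1 \<nu> x (op_id \<nu>)}"
      using N by (simp add: x act.op_tensor_scale_id)
  qed
qed

end
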